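(* Let $V\subseteq Y\subseteq X\subseteq H\subseteq X'\subseteq Y'\subseteq V'$ be a chain of spaces with continuous imbeddings, where $V,H$ are Hilbert spaces ($V$ dense in $H$, $H$ identified with its dual) and $X,Y$ are Banach spaces. Let $0<\alpha<\beta$ be real numbers, let $T>0$, and let $F:V\to\mathbb{R}$ and $g:(0,T)\times V\to V'$ be functions such that: (i) $F$ is of class $C^1$, with gradient $\nabla F\in C^0(V,V')$; (ii) for every $v\in L^\infty((0,T),V)$ the function $t\mapsto g(t,v(t))$ belongs to $L^1((0,T),V')$; (iii) there exist $\delta_1>0$ and $C_1\ge 0$ such that $F(u)\ge \delta_1\|u\|_Y^{\beta+2}-C_1$ for all $u\in V$; (iv) there exist $\delta_2>0$ and $C_2\ge 0$ such that $\langle\nabla F(u),u\rangle_{V',V}\ge\delta_2F(u)-C_2$ for all $u\in V$; (v) there exist $\delta_3>0$ and $C_3\ge 0$ such that $\langle g(t,v),v\rangle_{V',V}\ge\delta_3\|v\|_X^{\alpha+2}-C_3$ for every $v\in V$ and almost every $t\in(0,T)$; (vi) $g(t,v)\in X'$ for every $(t,v)\in(0,T)\times V$, and there exist $D_4>0$ and $C_4\ge 0$ such that $\|g(t,v)\|_{X'}\le D_4\|v\|_X^{\alpha+1}+C_4$ for every $v\in V$ and almost every $t\in(0,T)$. Set $$\gamma:=\min\left\{\frac{\alpha}{2},\ \frac{\beta-\alpha}{(\alpha+1)(\beta+2)}\right\}.$$ Then there exist real numbers $\Gamma$ and $\Gamma_*$, depending only on $\alpha$, $\beta$, the imbeddings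 in the chain of spaces, and the constants $\delta_1,\delta_2,\delta_3,D_4,C_1,C_2,C_3,C_4$ (in particular independent of $T$ and of $u$), such that every strong solution $u$ on $(0,T)$ of $$u''(t)+\nabla F(u(t))+g(t,u'(t))=0$$ satisfies $$\|u'(t)\|_H^2+F(u(t))\le \Gamma\,t^{-1/\gamma}+\Gamma_*\qquad\forall t\in(0,T).$$
   Context: In the chain $V\subseteq Y\subseteq X\subseteq H\subseteq X'\subseteq Y'\subseteq V'$, primes denote dual spaces; $V\subseteq H\subseteq V'$ is the usual Hilbert triple obtained by identifying $H$ with $H'$, all inclusions are continuous imbeddings, and the duality pairings are compatible (for $w\in X'$ and $u\in V$, $\langle w,u\rangle_{V',V}=\langle w,u\rangle_{X',X}$). A strong solution on $(0,T)$ of $u''(t)+\nabla F(u(t))+g(t,u'(t))=0$ is a function $u\in W^{1,\infty}((0,T),V)\cap W^{2,1}((0,T),V')$ for which the equation holds as an equality in $L^1((0,T),V')$. Every strong solution belongs to $C^0([0,T],V)\cap C^1([0,T],H)$, so the values $u(t)\in V$ and $u'(t)\in H$ are well defined for every $t\in[0,T]$. *)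

theory Defs
  imports "HOL-Analysis.Analysis"
begin

text \<open>
  The inclusions \<open>V \<subseteq> Y \<subseteq> X \<subseteq> H\<close> are injective bounded linear maps, the dual of a space
  \<open>'a\<close> is the type of bounded functionals \<open>'a \<Rightarrow>\<^sub>L real\<close> with the operator norm, and an
  inclusion of dual spaces is the adjoint of the inclusion of the spaces, i.e. restriction
  of functionals.
\<close>

definition dual_embed ::
  "('a::real_normed_vector \<Rightarrow>\<^sub>L 'b::real_normed_vector) \<Rightarrow> ('b \<Rightarrow>\<^sub>L real) \<Rightarrow> ('a \<Rightarrow>\<^sub>L real)" where
  "dual_embed i w = w o\<^sub>L i"

text \<open>
  With \<open>H\<close> identified with its dual by \<open>blinfun_inner_right\<close>, the second half
  \<open>H \<subseteq> X' \<subseteq> Y' \<subseteq> V'\<close> of the chain consists of imbeddings as well, which is why the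
  adjoint maps are required to be injective.  (For \<open>H \<subseteq> X'\<close> this follows from the density
  of \<open>V\<close> in \<open>H\<close>.)
\<close>

definition space_chain ::
  "('v::{real_inner, complete_space} \<Rightarrow>\<^sub>L 'y::banach) \<Rightarrow> ('y \<Rightarrow>\<^sub>L 'x::banach) \<Rightarrow>
   ('x \<Rightarrow>\<^sub>L 'h::{real_inner, complete_space}) \<Rightarrow> bool" where
  "space_chain iVY iYX iXH \<longleftrightarrow>
     inj (blinfun_apply iVY) \<and> inj (blinfun_apply iYX) \<and> inj (blinfun_apply iXH) \<and>
     closure (range (blinfun_apply (iXH o\<^sub>L iYX o\<^sub>L iVY))) = UNIV \<and>
     inj (dual_embed iYX) \<and> inj (dual_embed iVY)"

text \<open>The imbedding of \<open>V\<close> into \<open>V'\<close> through \<open>H = H'\<close> (not the Riesz map of \<open>V\<close>).\<close>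

definition pivot_embed ::
  "('v::real_inner \<Rightarrow>\<^sub>L 'h::real_inner) \<Rightarrow> 'v \<Rightarrow> ('v \<Rightarrow>\<^sub>L real)" where
  "pivot_embed iVH v = dual_embed iVH (blinfun_inner_right (iVH v))"

text \<open>
  The Bochner integral of the library is restricted to second countable spaces, which
  excludes the dual types \<open>'a \<Rightarrow>\<^sub>L real\<close> and non-separable spaces.  We therefore use
  strong measurability and build on the library's integral of simple functions.
  All measures used below are complete, so membership in the following spaces only depends
  on the almost-everywhere equivalence class.
\<close>

definition strongly_measurable :: "'a measure \<Rightarrow> ('a \<Rightarrow> 'b::real_normed_vector) \<Rightarrow> bool" where
  "strongly_measurable M f \<longleftrightarrow>
     (\<exists>s. (\<forall>i::nat. simple_function M (s i)) \<and> (AE x in M. (\<lambda>i. s i x) \<longlonglongrightarrow> f x))"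

definition has_strong_integral ::
  "'a measure \<Rightarrow> ('a \<Rightarrow> 'b::real_normed_vector) \<Rightarrow> 'b \<Rightarrow> bool" where
  "has_strong_integral M f I \<longleftrightarrow>
     strongly_measurable M f \<and>
     (\<exists>s. (\<forall>i::nat. Bochner_Integration.simple_bochner_integrable M (s i)) \<and>
          (\<lambda>i. \<integral>\<^sup>+x. ennreal (norm (f x - s i x)) \<partial>M) \<longlonglongrightarrow> 0 \<and>
          (\<lambda>i. Bochner_Integration.simple_bochner_integral M (s i)) \<longlonglongrightarrow> I)"

definition L1 :: "real \<Rightarrow> (real \<Rightarrow> 'b::real_normed_vector) set" where
  "L1 T = {f. strongly_measurable (lebesgue_on {0<..<T}) f \<and>
              (\<integral>\<^sup>+t. ennreal (norm (f t)) \<partial>lebesgue_on {0<..<T}) < \<infinity>}"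

definition Linf :: "real \<Rightarrow> (real \<Rightarrow> 'b::real_normed_vector) set" where
  "Linf T = {f. strongly_measurable (lebesgue_on {0<..<T}) f \<and>
                (\<exists>B. AE t in lebesgue_on {0<..<T}. norm (f t) \<le> B)}"

definition test_function :: "real \<Rightarrow> (real \<Rightarrow> real) \<Rightarrow> bool" where
  "test_function T \<phi> \<longleftrightarrow>
     (\<forall>n. (deriv ^^ n) \<phi> differentiable_on UNIV) \<and>
     (\<exists>a b. 0 < a \<and> b < T \<and> (\<forall>t. t \<notin> {a..b} \<longrightarrow> \<phi> t = 0))"

definition weak_deriv ::
  "real \<Rightarrow> (real \<Rightarrow> 'b::real_normed_vector) \<Rightarrow> (real \<Rightarrow> 'b) \<Rightarrow> bool" where
  "weak_deriv T f f' \<longleftrightarrow>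
     (\<forall>\<phi>. test_function T \<phi> \<longrightarrow>
        (\<exists>I. has_strong_integral (lebesgue_on {0<..<T}) (\<lambda>t. deriv \<phi> t *\<^sub>R f t) I \<and>
             has_strong_integral (lebesgue_on {0<..<T}) (\<lambda>t. \<phi> t *\<^sub>R f' t) (- I)))"

definition W1inf :: "real \<Rightarrow> (real \<Rightarrow> 'b::real_normed_vector) set" where
  "W1inf T = {f. f \<in> Linf T \<and> (\<exists>f'. f' \<in> Linf T \<and> weak_deriv T f f')}"

definition W21 :: "real \<Rightarrow> (real \<Rightarrow> 'b::real_normed_vector) set" where
  "W21 T = {f. f \<in> L1 T \<and>
              (\<exists>f' f''. f' \<in> L1 T \<and> f'' \<in> L1 T \<and> weak_deriv T f f' \<and> weak_deriv T f' f'')}"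

text \<open>
  A strong solution is an equivalence class; here \<open>u\<close> is its representative in
  \<open>C\<^sup>0([0,T],V)\<close>.  In the equation, \<open>u1\<close> is the \<open>V\<close>-valued weak derivative of \<open>u\<close> and
  \<open>w2\<close> is the second weak derivative of \<open>u\<close> regarded as a \<open>V'\<close>-valued function.
\<close>

definition strong_solution ::
  "real \<Rightarrow> ('v::real_inner \<Rightarrow>\<^sub>L 'h::real_inner) \<Rightarrow> ('v \<Rightarrow> 'v \<Rightarrow>\<^sub>L real) \<Rightarrow>
   (real \<Rightarrow> 'v \<Rightarrow> 'v \<Rightarrow>\<^sub>L real) \<Rightarrow> (real \<Rightarrow> 'v) \<Rightarrow> bool" where
  "strong_solution T iVH gradF g u \<longleftrightarrow>
     continuous_on {0..T} u \<and>
     u \<in> W1inf T \<and>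
     (\<lambda>t. pivot_embed iVH (u t)) \<in> W21 T \<and>
     (\<exists>u1 w1 w2.
        u1 \<in> Linf T \<and> weak_deriv T u u1 \<and>
        w1 \<in> L1 T \<and> weak_deriv T (\<lambda>t. pivot_embed iVH (u t)) w1 \<and>
        w2 \<in> L1 T \<and> weak_deriv T w1 w2 \<and>
        (AE t in lebesgue_on {0<..<T}. w2 t + gradF (u t) + g t (u1 t) = 0))"

end

theory Submission
  imports Defs
begin

text \<open>
  Write \<open>\<iota>\<close> for the imbedding of \<open>V\<close> into \<open>H\<close>.  Subtracting the equations satisfied by
  \<open>\<langle>u'', v\<rangle>\<close> at two times and testing with \<open>v = u'(t) - u'(s)\<close>, which is bounded in \<open>V\<close>, gives
  \<open>|u'(t) - u'(s)|\<^sub>H\<^sup>2 \<le> 2B \<integral> |u''|\<^sub>V\<^sub>'\<close>; hence \<open>\<iota> u'\<close> has a representative \<open>h\<close> that is continuous in \<open>H\<close>,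
  and the energy \<open>E = |h|\<^sup>2/2 + F(u) + C\<^sub>1 + 1 \<ge> 1\<close> is absolutely continuous with derivative
  \<open>- \<langle>g(t,u'), u'\<rangle>\<close>.  With \<open>P = (h, \<iota> u)\<close> and \<open>\<epsilon>\<close> small, \<open>\<Phi> = E + \<epsilon> E\<^sup>\<gamma> P\<close> is comparable to \<open>E\<close>, and the
  definition of \<open>\<gamma>\<close> is exactly what is needed to absorb the mixed terms of its derivative, so that
  \<open>\<Phi>' \<le> - c \<Phi>\<^sup>1\<^sup>+\<^sup>\<gamma> + C\<close>.  Comparison with \<open>(c \<gamma> t / 2)\<^sup>-\<^sup>1\<^sup>/\<^sup>\<gamma> + K\<close>, which is infinite at \<open>0\<close>, gives
  the bound without any reference to the initial data.

  Since the Bochner integral is not available in \<open>V\<close> and \<open>V'\<close>, all identities are between scalar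
  functions.  Chain and product rules are obtained from local estimates and a bisection
  argument, so that no differentiation almost everywhere is needed.
\<close>

section \<open>Primitives of integrable functions and the chain rule\<close>

text \<open>Both entries of the minimum in \<gamma> come from Young's inequality against the
  dissipation y^(\<alpha>+2), where y is the norm of u' in X. The derivative of P contributes
  E^\<gamma> y^2, which costs E^(\<gamma>(\<alpha>+2)/\<alpha>), and E^\<gamma> y^(\<alpha>+1)
  |u|_X, where (iii) gives |u|_X <= const E^(1/(\<beta>+2)), which costs
  E^((\<gamma>+1/(\<beta>+2))(\<alpha>+2)). These powers stay below the good term E^(1+\<gamma>)
  exactly when \<gamma> is at most \<alpha>/2 and at most
  (\<beta>-\<alpha>)/((\<alpha>+1)(\<beta>+2)). The remainders in Young's inequality carry a higher
  power of \<epsilon> than the good term, so a small \<epsilon> absorbs them even when the exponents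
  are equal. The obstacle in the energy identity is that u' is V-valued but only bounded and
  measurable in time, while its continuous version h lives in H and u'' in V'. The difference
  quotients of u are bounded in V and converge to u' only weakly, so their pairing with u'' needs an
  L^1 approximation of u''.\<close>

text \<open>The estimate is additive over adjacent intervals, so bisection carries it from small
  intervals around each point to the whole of \<open>{a..b}\<close>; as \<open>e\<close> is
  arbitrary, the increment vanishes. Here \<open>m\<close> plays the role of a control measure for
  the errors.\<close>

lemma eq_by_local_estimate:
  fixes J m :: "real \<Rightarrow> real"
  assumes "a \<le> b"
    and loc: "\<And>e x. e > 0 \<Longrightarrow> a \<le> x \<Longrightarrow> x \<le> b \<Longrightarrow>
      \<exists>d>0. \<forall>s t. a \<le> s \<longrightarrow> s \<le> x \<longrightarrow> x \<le> t \<longrightarrow> t \<le> b \<longrightarrow> t - s < d \<longrightarrow> \<bar>J t - J s\<bar> \<le> e * (m t - m s)"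
  shows "J b = J a"
proof -
  have est: "\<bar>J b - J a\<bar> \<le> e * (m b - m a)" if e: "e > 0" for e
  proof -
    let ?P = "\<lambda>p q. a \<le> p \<longrightarrow> q \<le> b \<longrightarrow> \<bar>J q - J p\<bar> \<le> e * (m q - m p)"
    have "?P a b"
    proof (rule Bolzano[where P = ?P, OF \<open>a \<le> b\<close>])
      fix p q r assume trans: "?P p q" "?P q r" "p \<le> q" "q \<le> r"
      show "?P p r"
      proof (intro impI)
        assume "a \<le> p" "r \<le> b"
        then have "\<bar>J q - J p\<bar> \<le> e * (m q - m p)" "\<bar>J r - J q\<bar> \<le> e * (m r - m q)"
          using trans by auto
        then show "\<bar>J r - J p\<bar> \<le> e * (m r - m p)"
          by (simp add: algebra_simps abs_le_iff)
      qed
    next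
      fix x assume local: "a \<le> x" "x \<le> b"
      obtain d where "d > 0" "\<forall>s t. a \<le> s \<longrightarrow> s \<le> x \<longrightarrow> x \<le> t \<longrightarrow> t \<le> b \<longrightarrow> t - s < d \<longrightarrow> \<bar>J t - J s\<bar> \<le> e * (m t - m s)"
        using loc[OF e local] by blast
      then show "\<exists>d>0. \<forall>p q. p \<le> x \<and> x \<le> q \<and> q - p < d \<longrightarrow> ?P p q" by auto
    qed
    then show ?thesis by simp
  qed
  show ?thesis
  proof (rule ccontr)
    assume ne: "J b \<noteq> J a"
    \<comment> \<open>The estimate with \<open>e = 1\<close> already forces this, which makes the
      division in the next choice of \<open>e\<close> legitimate.\<close>
    have pos: "m b - m a > 0"
      using est[of 1] ne by auto
    have "\<bar>J b - J a\<bar> / (2 * (m b - m a)) * (m b - m a) = \<bar>J b - J a\<bar> / 2"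
      using pos by (simp add: divide_simps)
    then have "\<bar>J b - J a\<bar> \<le> \<bar>J b - J a\<bar> / 2"
      using est[of "\<bar>J b - J a\<bar> / (2 * (m b - m a))"] ne pos by simp
    then show False using ne by simp
  qed
qed

text \<open>Absolute continuity of \<open>Q\<close> on \<open>{a..b}\<close> with derivative
  \<open>q\<close> almost everywhere, encoded by the fundamental theorem of calculus. Half-open
  intervals make adjacent pieces disjoint, so that increments add up without correction at the
  common end point.\<close>

definition ac_deriv :: "real \<Rightarrow> real \<Rightarrow> (real \<Rightarrow> real) \<Rightarrow> (real \<Rightarrow> real) \<Rightarrow> bool" where
  "ac_deriv a b Q q \<longleftrightarrow> set_integrable lebesgue {a<..b} q \<and>
     (\<forall>s t. a \<le> s \<longrightarrow> s \<le> t \<longrightarrow> t \<le> b \<longrightarrow> Q t - Q s = (LINT x:{s<..t}|lebesgue. q x))"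

lemma ac_derivI:
  assumes "set_integrable lebesgue {a<..b} q"
    and "\<And>s t. a \<le> s \<Longrightarrow> s \<le> t \<Longrightarrow> t \<le> b \<Longrightarrow> Q t - Q s = (LINT x:{s<..t}|lebesgue. q x)"
  shows "ac_deriv a b Q q"
  using assms by (auto simp: ac_deriv_def)

lemma ac_derivD:
  assumes "ac_deriv a b Q q"
  shows "set_integrable lebesgue {a<..b} q"
    and "\<And>s t. a \<le> s \<Longrightarrow> s \<le> t \<Longrightarrow> t \<le> b \<Longrightarrow> Q t - Q s = (LINT x:{s<..t}|lebesgue. q x)"
  using assms by (auto simp: ac_deriv_def)

lemma set_integrable_Ioc_subset:
  fixes q :: "real \<Rightarrow> 'b::{banach, second_countable_topology}"
  assumes "set_integrable lebesgue {a<..b} q" "a \<le> s" "t \<le> b"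
  shows "set_integrable lebesgue {s<..t} q"
  by (rule set_integrable_subset[OF assms(1)]) (use assms in auto)

lemma ac_deriv_subinterval:
  assumes "ac_deriv a b Q q" "a \<le> s" "t \<le> b"
  shows "ac_deriv s t Q q"
  using assms set_integrable_Ioc_subset[of a b q s t] by (auto simp: ac_deriv_def)

lemma set_integral_Ioc_combine:
  fixes q :: "real \<Rightarrow> 'b::{banach, second_countable_topology}"
  assumes "set_integrable lebesgue {a<..b} q" "a \<le> s" "s \<le> t" "t \<le> b"
  shows "(LINT x:{a<..t}|lebesgue. q x) = (LINT x:{a<..s}|lebesgue. q x) + (LINT x:{s<..t}|lebesgue. q x)"
proof -
  have "{a<..t} = {a<..s} \<union> {s<..t}"
    using assms by auto
  moreover have "set_integrable lebesgue {a<..s} q" "set_integrable lebesgue {s<..t} q"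
    using assms by (auto intro: set_integrable_Ioc_subset[OF assms(1)])
  moreover have "{a<..s} \<inter> {s<..t} = {}"
    by auto
  ultimately show ?thesis
    using set_integral_Un[of "{a<..s}" "{s<..t}" lebesgue q] by metis
qed

lemma ac_deriv_integral:
  assumes "set_integrable lebesgue {a<..b} q"
  shows "ac_deriv a b (\<lambda>t. LINT x:{a<..t}|lebesgue. q x) q"
proof (rule ac_derivI[OF assms])
  fix s t assume "a \<le> s" "s \<le> t" "t \<le> b"
  from set_integral_Ioc_combine[OF assms this]
  show "(LINT x:{a<..t}|lebesgue. q x) - (LINT x:{a<..s}|lebesgue. q x) = (LINT x:{s<..t}|lebesgue. q x)"
    by simp
qed

text \<open>On the compact interval the Lebesgue integral agrees with the gauge integral, whose
  indefinite integral is continuous; the added end point \<open>a\<close> is negligible.\<close>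

lemma ac_deriv_continuous:
  assumes "ac_deriv a b Q q"
  shows "continuous_on {a..b} Q"
proof (cases "a \<le> b")
  case True
  have I: "set_integrable lebesgue {a<..b} q" by (rule ac_derivD[OF assms])
  have i1: "q integrable_on {a..b}"
  proof -
    have "q integrable_on {a<..b}"
      using I by (rule set_lebesgue_integral_eq_integral)
    then show ?thesis
      by (rule integrable_spike_set) (auto intro: negligible_subset[of "{a}"])
  qed
  have eq: "Q x = Q a + integral {a..x} q" if "x \<in> {a..b}" for x
  proof -
    have "Q x - Q a = (LINT x:{a<..x}|lebesgue. q x)"
      using ac_derivD(2)[OF assms, of a x] that by auto
    also have "\<dots> = integral {a<..x} q"
      using set_lebesgue_integral_eq_integral(2)[OF set_integrable_Ioc_subset[OF I, of a x]] that by auto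
    also have "\<dots> = integral {a..x} q"
      by (rule integral_spike_set) (auto intro: negligible_subset[of "{a}"])
    finally show ?thesis by simp
  qed
  have "continuous_on {a..b} (\<lambda>x. Q a + integral {a..x} q)"
    by (intro continuous_intros indefinite_integral_continuous_1 i1)
  moreover have "continuous_on {a..b} Q = continuous_on {a..b} (\<lambda>x. Q a + integral {a..x} q)"
    by (intro continuous_on_cong refl eq)
  ultimately show ?thesis by simp
qed auto

lemma ac_deriv_add:
  assumes "ac_deriv a b P p" "ac_deriv a b Q q"
  shows "ac_deriv a b (\<lambda>t. P t + Q t) (\<lambda>t. p t + q t)"
proof (rule ac_derivI)
  show "set_integrable lebesgue {a<..b} (\<lambda>t. p t + q t)"
    using assms by (intro set_integral_add ac_derivD)
  fix s t assume *: "a \<le> s" "s \<le> t" "t \<le> b"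
  have "set_integrable lebesgue {s<..t} p" "set_integrable lebesgue {s<..t} q"
    using assms[THEN ac_derivD(1)] * by (auto intro: set_integrable_Ioc_subset)
  then show "P t + Q t - (P s + Q s) = (LINT x:{s<..t}|lebesgue. p x + q x)"
    using ac_derivD(2)[OF assms(1) *] ac_derivD(2)[OF assms(2) *] by simp
qed

lemma ac_deriv_cmult:
  assumes "ac_deriv a b P p"
  shows "ac_deriv a b (\<lambda>t. c * P t) (\<lambda>t. c * p t)"
proof (rule ac_derivI)
  show "set_integrable lebesgue {a<..b} (\<lambda>t. c * p t)"
    using assms by (auto intro: ac_derivD)
  fix s t assume *: "a \<le> s" "s \<le> t" "t \<le> b"
  show "c * P t - c * P s = (LINT x:{s<..t}|lebesgue. c * p x)"
    using ac_derivD(2)[OF assms(1) *] by (simp flip: right_diff_distrib)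
qed

lemma ac_deriv_const: "ac_deriv a b (\<lambda>t. c) (\<lambda>t. 0)"
  by (rule ac_derivI) (auto simp: set_integrable_def set_lebesgue_integral_def)

lemma ac_deriv_cong:
  assumes "ac_deriv a b P p" "\<And>t. a \<le> t \<Longrightarrow> t \<le> b \<Longrightarrow> P t = Q t"
    and ae: "AE t\<in>{a<..b} in lebesgue. p t = q t"
    and q: "set_integrable lebesgue {a<..b} q"
  shows "ac_deriv a b Q q"
proof (rule ac_derivI[OF q])
  fix s t assume *: "a \<le> s" "s \<le> t" "t \<le> b"
  have "(LINT x:{s<..t}|lebesgue. p x) = (LINT x:{s<..t}|lebesgue. q x)"
    unfolding set_lebesgue_integral_def
  proof (rule integral_cong_AE)
    show "(\<lambda>x. indicator {s<..t} x *\<^sub>R p x) \<in> borel_measurable lebesgue"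
      using set_integrable_Ioc_subset[OF ac_derivD(1)[OF assms(1)], of s t] *
      unfolding set_integrable_def by (auto intro: borel_measurable_integrable)
    show "(\<lambda>x. indicator {s<..t} x *\<^sub>R q x) \<in> borel_measurable lebesgue"
      using set_integrable_Ioc_subset[OF q, of s t] *
      unfolding set_integrable_def by (auto intro: borel_measurable_integrable)
    show "AE x in lebesgue. indicator {s<..t} x *\<^sub>R p x = indicator {s<..t} x *\<^sub>R q x"
      using ae by eventually_elim (use * in \<open>auto simp: indicator_def\<close>)
  qed
  then show "Q t - Q s = (LINT x:{s<..t}|lebesgue. q x)"
    using ac_derivD(2)[OF assms(1) *] assms(2)[of s] assms(2)[of t] * by simp
qed

lemma set_integrable_Ioc_continuous:
  fixes q :: "real \<Rightarrow> real"
  assumes "continuous_on {a..b} q"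
  shows "set_integrable lebesgue {a<..b} q"
proof -
  have "set_integrable lebesgue {a..b} q"
    by (rule absolutely_integrable_continuous_real[OF assms])
  then show ?thesis
    by (rule set_integrable_subset) auto
qed

lemma ac_deriv_C1:
  assumes "\<And>x. a \<le> x \<Longrightarrow> x \<le> b \<Longrightarrow> (Q has_real_derivative q x) (at x within {a..b})"
    and "continuous_on {a..b} q"
  shows "ac_deriv a b Q q"
proof (rule ac_derivI)
  show I: "set_integrable lebesgue {a<..b} q"
    by (rule set_integrable_Ioc_continuous[OF assms(2)])
  fix s t assume *: "a \<le> s" "s \<le> t" "t \<le> b"
  have "(q has_integral Q t - Q s) {s..t}"
    using * by (intro fundamental_theorem_of_calculus)
      (auto intro!: DERIV_subset[OF assms(1)] simp: has_real_derivative_iff_has_vector_derivative[symmetric])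
  moreover have "(LINT x:{s<..t}|lebesgue. q x) = integral {s<..t} q"
    using set_lebesgue_integral_eq_integral(2)[OF set_integrable_Ioc_subset[OF I, of s t]] * by auto
  moreover have "integral {s<..t} q = integral {s..t} q"
    by (rule integral_spike_set) (auto intro: negligible_subset[of "{s}"])
  ultimately show "Q t - Q s = (LINT x:{s<..t}|lebesgue. q x)"
    by (simp add: integral_unique)
qed

text \<open>The common source of the chain and the product rule. On a short interval the increment
  of \<open>G\<close> only has to be the integral of some \<open>q\<close>, which may depend on the
  interval, typically \<open>g\<close> with a continuous factor frozen at one point. The freezing
  error is small relative to the fixed integrable weight \<open>m\<close>, so \<open>G\<close> minus
  the primitive of \<open>g\<close> satisfies \<open>eq_by_local_estimate\<close>.\<close>

lemma ac_deriv_local: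
  fixes G g m :: "real \<Rightarrow> real"
  assumes g: "set_integrable lebesgue {a<..b} g" and m: "set_integrable lebesgue {a<..b} m"
    and loc: "\<And>e x. e > 0 \<Longrightarrow> x \<in> {a..b} \<Longrightarrow>
      \<exists>d>0. \<forall>s t. a \<le> s \<longrightarrow> s \<le> x \<longrightarrow> x \<le> t \<longrightarrow> t \<le> b \<longrightarrow> t - s < d \<longrightarrow>
        (\<exists>q. set_integrable lebesgue {s<..t} q \<and> G t - G s = (LINT y:{s<..t}|lebesgue. q y) \<and>
          (\<forall>y\<in>{s<..t}. \<bar>q y - g y\<bar> \<le> e * m y))"
  shows "ac_deriv a b G g"
proof (rule ac_derivI[OF g])
  fix s0 t0 assume st: "a \<le> s0" "s0 \<le> t0" "t0 \<le> b"
  define J where "J t = G t - (LINT x:{s0<..t}|lebesgue. g x)" for t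
  define M where "M t = (LINT x:{s0<..t}|lebesgue. m x)" for t
  have i: "set_integrable lebesgue {s<..t} g" "set_integrable lebesgue {s<..t} m" if "a \<le> s" "t \<le> b" for s t
    using set_integrable_Ioc_subset[OF g that] set_integrable_Ioc_subset[OF m that] by simp_all
  have "J t0 = J s0"
  proof (rule eq_by_local_estimate[where m = M, OF \<open>s0 \<le> t0\<close>])
    fix e x :: real assume e: "e > 0" and x: "s0 \<le> x" "x \<le> t0"
    have "x \<in> {a..b}" using x st by auto
    from loc[OF e this] obtain d where d: "d > 0" and
      ex: "\<forall>s t. a \<le> s \<longrightarrow> s \<le> x \<longrightarrow> x \<le> t \<longrightarrow> t \<le> b \<longrightarrow> t - s < d \<longrightarrow>
        (\<exists>q. set_integrable lebesgue {s<..t} q \<and> G t - G s = (LINT y:{s<..t}|lebesgue. q y) \<and>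
          (\<forall>y\<in>{s<..t}. \<bar>q y - g y\<bar> \<le> e * m y))"
      by blast
    show "\<exists>d>0. \<forall>s t. s0 \<le> s \<longrightarrow> s \<le> x \<longrightarrow> x \<le> t \<longrightarrow> t \<le> t0 \<longrightarrow> t - s < d \<longrightarrow> \<bar>J t - J s\<bar> \<le> e * (M t - M s)"
    proof (intro exI[of _ d] conjI allI impI d)
      fix s t assume *: "s0 \<le> s" "s \<le> x" "x \<le> t" "t \<le> t0" "t - s < d"
      have ab: "a \<le> s" "t \<le> b" using * st by auto
      obtain q where q: "set_integrable lebesgue {s<..t} q" "G t - G s = (LINT y:{s<..t}|lebesgue. q y)"
        and le: "\<And>y. y \<in> {s<..t} \<Longrightarrow> \<bar>q y - g y\<bar> \<le> e * m y"
        using ex[rule_format, OF ab(1) *(2,3) ab(2) *(5)] by blast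
      have qg: "set_integrable lebesgue {s<..t} (\<lambda>y. q y - g y)"
        using q(1) i(1)[OF ab] by (rule set_integral_diff)
      have "J t - J s = (LINT y:{s<..t}|lebesgue. q y) - (LINT y:{s<..t}|lebesgue. g y)"
        using set_integral_Ioc_combine[OF i(1), of s0 b s t] q(2) * st by (simp add: J_def)
      also have "\<dots> = (LINT y:{s<..t}|lebesgue. q y - g y)"
        using q(1) i(1)[OF ab] by simp
      finally have "\<bar>J t - J s\<bar> \<le> (LINT y:{s<..t}|lebesgue. norm (q y - g y))"
        using set_integral_norm_bound[OF qg] by simp
      also have "\<dots> \<le> (LINT y:{s<..t}|lebesgue. e * m y)"
        by (rule set_integral_mono[OF set_integrable_norm[OF qg]]) (use i(2)[OF ab] le in auto)
      also have "\<dots> = e * (M t - M s)"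
        using set_integral_Ioc_combine[OF i(2), of s0 b s t] * st by (simp add: M_def)
      finally show "\<bar>J t - J s\<bar> \<le> e * (M t - M s)" .
    qed
  qed
  then show "G t0 - G s0 = (LINT x:{s0<..t0}|lebesgue. g x)"
    by (simp add: J_def set_lebesgue_integral_def)
qed

text \<open>The path \<open>f\<close> is known to be a primitive only after application of a fixed
  functional. The mean value theorem supplies one: the increment of \<open>G\<close> along the
  segment from \<open>f s\<close> to \<open>f t\<close> is \<open>A (f t - f s)\<close> with
  \<open>A\<close> a single value of \<open>dG\<close>, and continuity of \<open>dG\<close> bounds
  the distance of \<open>A\<close> to \<open>dG (f y)\<close>.\<close>

lemma ac_deriv_chain:
  fixes f f1 :: "real \<Rightarrow> 'b::real_normed_vector" and G :: "'b \<Rightarrow> real"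
  assumes f: "\<And>\<phi> :: 'b \<Rightarrow>\<^sub>L real. ac_deriv a b (\<lambda>t. \<phi> (f t)) (\<lambda>t. \<phi> (f1 t))"
    and cont: "continuous_on {a..b} f"
    and int: "set_integrable lebesgue {a<..b} (\<lambda>t. norm (f1 t))"
    and intG: "set_integrable lebesgue {a<..b} (\<lambda>t. blinfun_apply (dG (f t)) (f1 t))"
    and S: "open S" "\<And>t. a \<le> t \<Longrightarrow> t \<le> b \<Longrightarrow> f t \<in> S"
    and G: "\<And>x. x \<in> S \<Longrightarrow> (G has_derivative blinfun_apply (dG x)) (at x)"
    and dG: "continuous_on S dG"
  shows "ac_deriv a b (\<lambda>t. G (f t)) (\<lambda>t. blinfun_apply (dG (f t)) (f1 t))"
proof (rule ac_deriv_local[OF intG int])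
  fix e x :: real assume e: "e > 0" and x: "x \<in> {a..b}"
  have fx: "f x \<in> S" using S(2) x by auto
  \<comment> \<open>A ball, because its convexity keeps the segments used below inside
    \<open>S\<close>; \<open>e / 2\<close> is spent twice, once for the intermediate point and once
    for \<open>f y\<close>.\<close>
  obtain r where r: "r > 0" "ball (f x) r \<subseteq> S" and
    rd: "\<And>y. y \<in> ball (f x) r \<Longrightarrow> norm (dG y - dG (f x)) \<le> e / 2"
  proof -
    obtain r1 where r1: "r1 > 0" "ball (f x) r1 \<subseteq> S"
      using S(1) fx by (auto simp: open_contains_ball)
    obtain r2 where r2: "r2 > 0" "\<And>y. y \<in> S \<Longrightarrow> dist y (f x) < r2 \<Longrightarrow> dist (dG y) (dG (f x)) < e / 2"
      using dG fx e unfolding continuous_on_iff by (metis half_gt_zero)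
    show ?thesis
    proof (rule that[of "min r1 r2"])
      show "0 < min r1 r2" "ball (f x) (min r1 r2) \<subseteq> S" using r1 r2 by auto
      show "norm (dG y - dG (f x)) \<le> e / 2" if "y \<in> ball (f x) (min r1 r2)" for y
        using r2(2)[of y] that r1 by (auto simp: dist_commute dist_norm[symmetric] subset_iff)
    qed
  qed
  obtain d where d: "d > 0" "\<And>y. y \<in> {a..b} \<Longrightarrow> dist y x < d \<Longrightarrow> dist (f y) (f x) < r"
    using cont x r(1) unfolding continuous_on_iff by blast
  show "\<exists>d>0. \<forall>s t. a \<le> s \<longrightarrow> s \<le> x \<longrightarrow> x \<le> t \<longrightarrow> t \<le> b \<longrightarrow> t - s < d \<longrightarrow>
    (\<exists>q. set_integrable lebesgue {s<..t} q \<and> G (f t) - G (f s) = (LINT y:{s<..t}|lebesgue. q y) \<and>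
      (\<forall>y\<in>{s<..t}. \<bar>q y - blinfun_apply (dG (f y)) (f1 y)\<bar> \<le> e * norm (f1 y)))"
  proof (intro exI[of _ d] conjI allI impI \<open>d > 0\<close>)
    fix s t assume *: "a \<le> s" "s \<le> x" "x \<le> t" "t \<le> b" "t - s < d"
    have near: "f y \<in> ball (f x) r" if "y \<in> {s..t}" for y
      using d(2)[of y] that * by (auto simp: dist_real_def dist_commute)
    let ?p = "\<lambda>\<tau>. f s + \<tau> *\<^sub>R (f t - f s)"
    have seg: "?p \<tau> \<in> ball (f x) r" if "0 \<le> \<tau>" "\<tau> \<le> 1" for \<tau>
    proof -
      have "(1 - \<tau>) *\<^sub>R f s + \<tau> *\<^sub>R f t \<in> ball (f x) r"
        using near[of s] near[of t] that * by (intro convexD[OF convex_ball]) auto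
      then show ?thesis by (simp add: algebra_simps)
    qed
    \<comment> \<open>Mean value theorem for the scalar function of the segment parameter.\<close>
    have "\<exists>\<tau>\<in>{0<..<1}. G (?p 1) - G (?p 0) = blinfun_apply (dG (?p \<tau>)) ((1 - 0) *\<^sub>R (f t - f s))"
    proof (rule mvt_simple[where f' = "\<lambda>\<tau> h. blinfun_apply (dG (?p \<tau>)) (h *\<^sub>R (f t - f s))"])
      fix \<tau> :: real assume "0 \<le> \<tau>" "\<tau> \<le> 1"
      then have "?p \<tau> \<in> S" using seg r by auto
      from G[OF this] show "((\<lambda>\<tau>. G (?p \<tau>)) has_derivative (\<lambda>h. blinfun_apply (dG (?p \<tau>)) (h *\<^sub>R (f t - f s)))) (at \<tau> within {0..1})"
        by (rule has_derivative_compose[rotated]) (auto intro!: derivative_eq_intros)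
    qed simp
    then obtain \<tau> where "\<tau> \<in> {0<..<1}" and mv: "G (f t) - G (f s) = blinfun_apply (dG (?p \<tau>)) (f t - f s)"
      by auto
    then have \<tau>: "0 \<le> \<tau>" "\<tau> \<le> 1"
      by auto
    let ?A = "dG (?p \<tau>)"
    show "\<exists>q. set_integrable lebesgue {s<..t} q \<and> G (f t) - G (f s) = (LINT y:{s<..t}|lebesgue. q y) \<and>
      (\<forall>y\<in>{s<..t}. \<bar>q y - blinfun_apply (dG (f y)) (f1 y)\<bar> \<le> e * norm (f1 y))"
    proof (intro exI[of _ "\<lambda>y. ?A (f1 y)"] conjI ballI)
      show "set_integrable lebesgue {s<..t} (\<lambda>t. ?A (f1 t))"
        using ac_derivD(1)[OF f[of ?A]] * by (auto intro: set_integrable_Ioc_subset)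
      show "G (f t) - G (f s) = (LINT y:{s<..t}|lebesgue. ?A (f1 y))"
        using ac_derivD(2)[OF f[of ?A], of s t] * mv by (simp add: blinfun.diff_right)
      fix y assume y: "y \<in> {s<..t}"
      have "norm (?A - dG (f y)) \<le> norm (?A - dG (f x)) + norm (dG (f y) - dG (f x))"
        using norm_triangle_ineq4[of "?A - dG (f x)" "dG (f y) - dG (f x)"] by simp
      also have "\<dots> \<le> e"
        using rd[OF seg[OF \<tau>]] rd[OF near[of y]] y by auto
      finally have "norm (?A - dG (f y)) * norm (f1 y) \<le> e * norm (f1 y)"
        by (rule mult_right_mono) simp
      moreover have "norm ((?A - dG (f y)) (f1 y)) \<le> norm (?A - dG (f y)) * norm (f1 y)"
        by (rule norm_blinfun)
      ultimately show "\<bar>?A (f1 y) - blinfun_apply (dG (f y)) (f1 y)\<bar> \<le> e * norm (f1 y)"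
        by (simp add: blinfun.diff_left)
    qed
  qed
qed

lemma set_integrable_continuous_mult:
  fixes c r :: "real \<Rightarrow> real"
  assumes c: "continuous_on {a..b} c" and r: "set_integrable lebesgue {a<..b} r"
  shows "set_integrable lebesgue {a<..b} (\<lambda>t. c t * r t)"
proof -
  have "bounded (c ` {a..b})"
    using c by (intro compact_imp_bounded compact_continuous_image) auto
  then have "bounded (c ` {a<..b})"
    by (rule bounded_subset) auto
  moreover have "c \<in> borel_measurable (lebesgue_on {a<..b})"
    by (rule continuous_imp_measurable_on_sets_lebesgue[OF continuous_on_subset[OF c]]) auto
  ultimately show ?thesis
    using r by (intro absolutely_integrable_bounded_measurable_product_real) auto
qed

text \<open>The case of a curve in the plane, where every functional is a linear combination of the
  coordinates. It yields the product rule and, on a half plane, the derivative of the Lyapunov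
  functional.\<close>

lemma ac_deriv_chain2:
  fixes G :: "real \<times> real \<Rightarrow> real"
  assumes P: "ac_deriv a b P p" and Q: "ac_deriv a b Q q"
    and S: "open S" "\<And>t. a \<le> t \<Longrightarrow> t \<le> b \<Longrightarrow> (P t, Q t) \<in> S"
    and G: "\<And>x. x \<in> S \<Longrightarrow> (G has_derivative (\<lambda>h. G1 x * fst h + G2 x * snd h)) (at x)"
    and cont: "continuous_on S G1" "continuous_on S G2"
  shows "ac_deriv a b (\<lambda>t. G (P t, Q t)) (\<lambda>t. G1 (P t, Q t) * p t + G2 (P t, Q t) * q t)"
proof -
  let ?f = "\<lambda>t. (P t, Q t)" and ?f1 = "\<lambda>t. (p t, q t)"
  let ?dG = "\<lambda>x. G1 x *\<^sub>R fst_blinfun + G2 x *\<^sub>R (snd_blinfun :: (real \<times> real) \<Rightarrow>\<^sub>L real)"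
  have contf: "continuous_on {a..b} ?f"
    by (intro continuous_on_Pair ac_deriv_continuous[OF P] ac_deriv_continuous[OF Q])
  have bdd: "set_integrable lebesgue {a<..b} (\<lambda>t. h (P t, Q t) * r t)"
    if h: "continuous_on S h" and r: "set_integrable lebesgue {a<..b} r" for h :: "real \<times> real \<Rightarrow> real" and r
  proof -
    have c: "continuous_on {a..b} (\<lambda>t. h (P t, Q t))"
      by (rule continuous_on_compose2[OF h contf]) (use S in auto)
    then show ?thesis
      using r by (rule set_integrable_continuous_mult)
  qed
  have "ac_deriv a b (\<lambda>t. G (?f t)) (\<lambda>t. blinfun_apply (?dG (?f t)) (?f1 t))"
  proof (rule ac_deriv_chain[OF _ contf _ _ S])
    fix \<phi> :: "(real \<times> real) \<Rightarrow>\<^sub>L real"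
    obtain c d where \<phi>: "\<And>x y. blinfun_apply \<phi> (x, y) = c * x + d * y"
    proof
      fix x y :: real
      have "(x, y) = x *\<^sub>R (1, 0) + y *\<^sub>R (0, 1)" by simp
      then show "blinfun_apply \<phi> (x, y) = blinfun_apply \<phi> (1, 0) * x + blinfun_apply \<phi> (0, 1) * y"
        by (simp only: blinfun.add_right blinfun.scaleR_right real_scaleR_def mult.commute)
    qed
    show "ac_deriv a b (\<lambda>t. blinfun_apply \<phi> (P t, Q t)) (\<lambda>t. blinfun_apply \<phi> (p t, q t))"
      unfolding \<phi> by (intro ac_deriv_add ac_deriv_cmult P Q)
  next
    have "set_integrable lebesgue {a<..b} ?f1"
      using ac_derivD(1)[OF P] ac_derivD(1)[OF Q]
      by (subst absolutely_integrable_componentwise_iff) (auto simp: Basis_prod_def)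
    then show "set_integrable lebesgue {a<..b} (\<lambda>t. norm (p t, q t))"
      by (rule set_integrable_norm)
    show "set_integrable lebesgue {a<..b} (\<lambda>t. blinfun_apply (?dG (P t, Q t)) (p t, q t))"
      by (auto simp: blinfun.add_left blinfun.scaleR_left intro!: set_integral_add(1) bdd cont ac_derivD[OF P] ac_derivD[OF Q])
    show "continuous_on S ?dG"
      by (intro continuous_intros cont)
    fix x assume "x \<in> S"
    from G[OF this] show "(G has_derivative blinfun_apply (?dG x)) (at x)"
      by (rule has_derivative_eq_rhs) (auto simp: blinfun.add_left blinfun.scaleR_left)
  qed
  then show ?thesis
    by (simp add: blinfun.add_left blinfun.scaleR_left)
qed

lemma ac_deriv_mult:
  assumes "ac_deriv a b P p" "ac_deriv a b Q q"
  shows "ac_deriv a b (\<lambda>t. P t * Q t) (\<lambda>t. Q t * p t + P t * q t)"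
proof -
  have "ac_deriv a b (\<lambda>t. fst (P t, Q t) * snd (P t, Q t)) (\<lambda>t. snd (P t, Q t) * p t + fst (P t, Q t) * q t)"
    by (rule ac_deriv_chain2[OF assms open_UNIV])
      (auto intro!: derivative_eq_intros continuous_intros simp: mult.commute)
  then show ?thesis by simp
qed

section \<open>From intervals to measurable sets\<close>

text \<open>A Dynkin system argument: half-open intervals are stable under intersection and generate
  the Borel sets. Complements use the integral over the whole line, and disjoint countable unions
  use domination by \<open>w\<close>.\<close>

lemma measurable_sets_integral_tendsto_0:
  fixes g :: "nat \<Rightarrow> real \<Rightarrow> real"
  assumes w: "integrable lebesgue w"
    and g: "\<And>n. g n \<in> borel_measurable lebesgue" "\<And>n. AE x in lebesgue. \<bar>g n x\<bar> \<le> w x"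
    and Ioc: "\<And>s t. (\<lambda>n. LINT x:{s<..t}|lebesgue. g n x) \<longlonglongrightarrow> 0"
    and all: "(\<lambda>n. LINT x|lebesgue. g n x) \<longlonglongrightarrow> 0"
    and A: "A \<in> sets lebesgue"
  shows "(\<lambda>n. LINT x:A|lebesgue. g n x) \<longlonglongrightarrow> 0"
proof -
  have gi: "integrable lebesgue (g n)" for n
    using w g(1)[of n] by (rule Bochner_Integration.integrable_bound) (use g(2)[of n] in \<open>eventually_elim, auto\<close>)
  have gis: "set_integrable lebesgue B (g n)" and wis: "set_integrable lebesgue B w" if "B \<in> sets lebesgue" for B n
    using integrable_mult_indicator[OF that gi] integrable_mult_indicator[OF that w]
    by (simp_all add: set_integrable_def)
  have borel: "(\<lambda>n. LINT x:B|lebesgue. g n x) \<longlonglongrightarrow> 0" if "B \<in> sets borel" for B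
  proof -
    have S: "sets (borel :: real measure) = sigma_sets UNIV (range (\<lambda>(a, b). {a<..b}))"
      by (subst borel_sigma_sets_Ioc) (simp add: sets_measure_of)
    have "Int_stable (range (\<lambda>(a, b). {a<..b::real}))"
      by (auto simp: Int_stable_def)
    moreover have "range (\<lambda>(a, b). {a<..b::real}) \<subseteq> Pow UNIV" by simp
    moreover have "B \<in> sigma_sets UNIV (range (\<lambda>(a, b). {a<..b}))"
      using that S by simp
    ultimately show ?thesis
    proof (induction rule: sigma_sets_induct_disjoint)
      case (basic A)
      then show ?case using Ioc by auto
    next
      case empty
      then show ?case by (simp add: set_lebesgue_integral_def)
    next
      case (compl A)
      then have A: "A \<in> sets lebesgue" unfolding S[symmetric] by simp
      have "(LINT x:UNIV - A|lebesgue. g n x) = (LINT x|lebesgue. g n x) - (LINT x:A|lebesgue. g n x)" for n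
      proof -
        have "(LINT x:A \<union> (UNIV - A)|lebesgue. g n x) = (LINT x:A|lebesgue. g n x) + (LINT x:UNIV - A|lebesgue. g n x)"
          using A by (intro set_integral_Un gis) auto
        then show ?thesis by (simp add: set_lebesgue_integral_def)
      qed
      then show ?case using tendsto_diff[OF all compl(2)] by simp
    next
      case (union A)
      then have A: "A i \<in> sets lebesgue" for i unfolding S[symmetric] by (auto simp: subset_iff)
      have disj: "i \<noteq> j \<Longrightarrow> A i \<inter> A j = {}" for i j
        using union(1) by (auto simp: disjoint_family_on_def)
      have eq: "(LINT x:(\<Union>i. A i)|lebesgue. g n x) = (\<Sum>i. LINT x:A i|lebesgue. g n x)" for n
        by (intro lebesgue_integral_countable_add A disj gis sets.countable_UN) (use A in auto)
      \<comment> \<open>The integrals of \<open>w\<close> over the pieces form the summable majorant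
        required by Tannery's theorem.\<close>
      have "(\<lambda>i. LINT x:A i|lebesgue. w x) sums (LINT x:(\<Union>i. A i)|lebesgue. w x)"
      proof -
        have "summable (\<lambda>i. LINT x:A i|lebesgue. w x)"
        proof (rule summableI_nonneg_bounded[where x = "LINT x|lebesgue. w x"])
          have wn: "AE x in lebesgue. 0 \<le> w x"
            using g(2)[of 0] by eventually_elim auto
          show "0 \<le> (LINT x:A i|lebesgue. w x)" for i
            unfolding set_lebesgue_integral_def by (intro integral_nonneg_AE eventually_mono[OF wn]) auto
          fix n
          have "(\<Sum>i<n. LINT x:A i|lebesgue. w x) = (LINT x:(\<Union>i<n. A i)|lebesgue. w x)"
            by (rule set_integral_finite_Union[symmetric]) (use disj A wis in \<open>auto simp: disjoint_family_on_def\<close>)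
          also have "\<dots> \<le> (LINT x|lebesgue. w x)"
            unfolding set_lebesgue_integral_def
          proof (rule integral_mono_AE[OF _ w])
            show "integrable lebesgue (\<lambda>x. indicator (\<Union>i<n. A i) x *\<^sub>R w x)"
              by (intro integrable_mult_indicator w sets.finite_UN) (use A in auto)
            show "AE x in lebesgue. indicator (\<Union>i<n. A i) x *\<^sub>R w x \<le> w x"
              using wn by eventually_elim (auto simp: indicator_def)
          qed
          finally show "(\<Sum>i<n. LINT x:A i|lebesgue. w x) \<le> (LINT x|lebesgue. w x)" .
        qed
        moreover have "(LINT x:(\<Union>i. A i)|lebesgue. w x) = (\<Sum>i. LINT x:A i|lebesgue. w x)"
          by (intro lebesgue_integral_countable_add A disj wis sets.countable_UN) (use A in auto)
        ultimately show ?thesis by (simp add: summable_sums)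
      qed
      then have sm: "summable (\<lambda>i. LINT x:A i|lebesgue. w x)" by (rule sums_summable)
      have bd: "norm (LINT x:A i|lebesgue. g n x) \<le> (LINT x:A i|lebesgue. w x)" for i n
      proof -
        have "norm (LINT x:A i|lebesgue. g n x) \<le> (LINT x:A i|lebesgue. norm (g n x))"
          by (intro set_integral_norm_bound gis A)
        also have "\<dots> \<le> (LINT x:A i|lebesgue. w x)"
          by (rule set_integral_mono_AE[OF set_integrable_norm[OF gis[OF A]] wis[OF A]])
            (use g(2)[of n] in auto)
        finally show ?thesis .
      qed
      have "((\<lambda>n. \<Sum>i. LINT x:A i|lebesgue. g n x) \<longlongrightarrow> (\<Sum>i. 0)) sequentially"
      proof -
        have "\<forall>\<^sub>F (i, n) in sequentially \<times>\<^sub>F sequentially. norm (LINT x:A i|lebesgue. g n x) \<le> (LINT x:A i|lebesgue. w x)"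
          by (intro always_eventually) (use bd in auto)
        from tannerys_theorem[OF union(3) this sm] show ?thesis by simp
      qed
      then show ?case by (simp add: eq)
    qed
  qed
  \<comment> \<open>A Lebesgue set differs from a Borel set only within a null set, which does not
    affect the integrals.\<close>
  obtain B N N' where AB: "A = B \<union> N" "N \<subseteq> N'" "N' \<in> null_sets lborel" "B \<in> sets lborel"
    using A by (elim sets_completionE)
  have "(LINT x:A|lebesgue. g n x) = (LINT x:B|lebesgue. g n x)" for n
    unfolding set_lebesgue_integral_def
  proof (rule integral_cong_AE)
    have "N' \<in> null_sets lebesgue" using AB(3) by (rule null_sets_completionI)
    then have "AE x in lebesgue. x \<notin> N'" by (rule AE_not_in)
    then show "AE x in lebesgue. indicator A x *\<^sub>R g n x = indicator B x *\<^sub>R g n x"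
      by eventually_elim (use AB in \<open>auto simp: indicator_def\<close>)
    show "(\<lambda>x. indicator A x *\<^sub>R g n x) \<in> borel_measurable lebesgue"
      using A g(1) by (intro borel_measurable_scaleR borel_measurable_indicator) auto
    show "(\<lambda>x. indicator B x *\<^sub>R g n x) \<in> borel_measurable lebesgue"
      using AB(4) g(1) by (intro borel_measurable_scaleR borel_measurable_indicator) auto
  qed
  then show ?thesis using borel[of B] AB(4) by simp
qed

text \<open>The preceding lemma for a constant sequence shows that the integral vanishes over every
  measurable set, and this determines an integrable function almost everywhere.\<close>

lemma AE_eq_0_if_Ioc_integrals_eq_0:
  fixes f :: "real \<Rightarrow> real"
  assumes f: "integrable lebesgue f"
    and Ioc: "\<And>s t. (LINT x:{s<..t}|lebesgue. f x) = 0"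
    and all: "(LINT x|lebesgue. f x) = 0"
  shows "AE x in lebesgue. f x = 0"
proof (rule density_unique_real[OF f integrable_zero])
  fix A :: "real set" assume A: "A \<in> sets lebesgue"
  have "(\<lambda>n::nat. LINT x:A|lebesgue. f x) \<longlonglongrightarrow> 0"
    by (rule measurable_sets_integral_tendsto_0[OF integrable_abs[OF f]]) (use f Ioc all A in auto)
  then have "(LINT x:A|lebesgue. f x) = 0"
    using LIMSEQ_const_iff by blast
  then show "(LINT x:A|lebesgue. f x) = (LINT x:A|lebesgue. 0)"
    by (simp add: set_lebesgue_integral_def)
qed

section \<open>Smooth bump functions and the du Bois-Reymond lemma\<close>

text \<open>The smooth function exp(-1/x), extended by zero, together with all functions that arise
  from it by differentiation: these are polynomials in 1/x times exp(-1/x).\<close>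

definition flat_exp :: "real poly \<Rightarrow> real \<Rightarrow> real" where
  "flat_exp p x = (if x > 0 then poly p (inverse x) * exp (- inverse x) else 0)"

text \<open>The extra factor \<open>y ^ k\<close> is there for the induction: splitting off the
  constant coefficient leaves a polynomial of lower degree times one more power of
  \<open>y\<close>.\<close>

lemma tendsto_poly_div_exp_0: "((\<lambda>y. y ^ k * poly p y * exp (- y)) \<longlongrightarrow> (0::real)) at_top"
proof (induction p arbitrary: k)
  case 0
  then show ?case by simp
next
  case (pCons c p)
  have "((\<lambda>y. c * (y ^ k / exp y) + y ^ Suc k * poly p y * exp (- y)) \<longlongrightarrow> c * 0 + 0) at_top"
    by (intro tendsto_intros tendsto_power_div_exp_0 pCons)
  then show ?case
    by (simp add: exp_minus field_simps)
qed

text \<open>For x > 0, differentiating p(1/x) exp(-1/x) produces the factor 1/x^2 and the polynomial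
  p - p'. At 0 the right difference quotient is y p(y) exp(-y) with y = 1/h, which tends to 0, and
  the left one is identically 0.\<close>

lemma flat_exp_DERIV:
  "(flat_exp p has_real_derivative flat_exp ([:0, 0, 1:] * (p - pderiv p)) x) (at x)"
proof -
  consider "x > 0" | "x < 0" | "x = 0" by linarith
  then show ?thesis
  proof cases
    case 1
    have "((\<lambda>x. poly p (inverse x) * exp (- inverse x)) has_real_derivative
        flat_exp ([:0, 0, 1:] * (p - pderiv p)) x) (at x)"
      using 1 by (auto intro!: derivative_eq_intros DERIV_chain2[OF poly_DERIV] simp: flat_exp_def algebra_simps power2_eq_square)
    then show ?thesis
    proof (rule has_field_derivative_transform_within_open[of _ _ _ "{0<..}"])
      show "\<And>y. y \<in> {0<..} \<Longrightarrow> poly p (inverse y) * exp (- inverse y) = flat_exp p y"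
        by (simp add: flat_exp_def)
    qed (use 1 in auto)
  next
    case 2
    have "((\<lambda>x. 0) has_real_derivative flat_exp ([:0, 0, 1:] * (p - pderiv p)) x) (at x)"
      using 2 by (simp add: flat_exp_def)
    then show ?thesis
      by (rule has_field_derivative_transform_within_open[of _ _ _ "{..<0}"]) (use 2 in \<open>auto simp: flat_exp_def\<close>)
  next
    case 3
    have "((\<lambda>h. inverse h * poly p (inverse h) * exp (- inverse h)) \<longlongrightarrow> 0) (at_right 0)"
      using filterlim_compose[OF tendsto_poly_div_exp_0[of 1 p] filterlim_inverse_at_top_right] by simp
    then have r: "((\<lambda>h. flat_exp p h / h) \<longlongrightarrow> 0) (at_right 0)"
      by (rule Lim_transform_eventually)
        (auto simp: eventually_at_filter flat_exp_def field_simps)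
    have l: "((\<lambda>h. flat_exp p h / h) \<longlongrightarrow> 0) (at_left 0)"
      by (rule Lim_transform_eventually[OF tendsto_const]) (auto simp: eventually_at_filter flat_exp_def)
    have "((\<lambda>h. flat_exp p h / h) \<longlongrightarrow> 0) (at 0)"
      using l r filterlim_split_at by blast
    then show ?thesis
      unfolding 3 DERIV_def by (simp add: flat_exp_def)
  qed
qed

lemma flat_exp_smult: "flat_exp (smult c p) x = c * flat_exp p x"
  by (simp add: flat_exp_def)

text \<open>A class large enough to be closed under differentiation, so that smoothness of all
  orders follows from one differentiation step. Sums enter through the product rule; the scaling
  \<open>n\<close> sharpens the flanks at \<open>a\<close> and \<open>b\<close>.\<close>

inductive_set bump_span :: "(real \<Rightarrow> real) set" where
  base: "(\<lambda>x. flat_exp p (n * (x - a)) * flat_exp q (n * (b - x))) \<in> bump_span"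
| add: "f \<in> bump_span \<Longrightarrow> g \<in> bump_span \<Longrightarrow> (\<lambda>x. f x + g x) \<in> bump_span"

lemma bump_span_cmult: "f \<in> bump_span \<Longrightarrow> (\<lambda>x. c * f x) \<in> bump_span"
proof (induction rule: bump_span.induct)
  case (base p n a q b)
  then show ?case
    using bump_span.base[of "smult c p" n a q b] by (simp add: flat_exp_smult mult.assoc)
qed (auto simp: distrib_left intro: bump_span.add)

lemma bump_span_DERIV: "f \<in> bump_span \<Longrightarrow> \<exists>g\<in>bump_span. \<forall>x. (f has_real_derivative g x) (at x)"
proof (induction rule: bump_span.induct)
  case (base p n a q b)
  let ?D = "\<lambda>p. [:0, 0, 1:] * (p - pderiv p)"
  let ?g = "\<lambda>x. flat_exp (smult n (?D p)) (n * (x - a)) * flat_exp q (n * (b - x))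
    + flat_exp p (n * (x - a)) * flat_exp (smult (- n) (?D q)) (n * (b - x))"
  have g: "?g \<in> bump_span"
    by (intro bump_span.intros)
  have "((\<lambda>x. flat_exp p (n * (x - a)) * flat_exp q (n * (b - x))) has_real_derivative ?g x) (at x)" for x
    unfolding flat_exp_smult
    by (rule derivative_eq_intros DERIV_chain2[OF flat_exp_DERIV] refl)+ (simp add: algebra_simps)
  then show ?case
    by (intro bexI[OF _ g] allI)
next
  case (add f g)
  then obtain f' g' where "f' \<in> bump_span" "g' \<in> bump_span"
    "\<And>x. (f has_real_derivative f' x) (at x)" "\<And>x. (g has_real_derivative g' x) (at x)"
    by blast
  then show ?case
    by (intro bexI[of _ "\<lambda>x. f' x + g' x"]) (auto intro!: bump_span.add derivative_eq_intros)
qed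

lemma bump_span_smooth:
  assumes "f \<in> bump_span"
  shows "(deriv ^^ n) f differentiable_on UNIV"
proof -
  have "(deriv ^^ n) f \<in> bump_span"
  proof (induction n)
    case (Suc n)
    then obtain g where g: "g \<in> bump_span" "\<And>x. ((deriv ^^ n) f has_real_derivative g x) (at x)"
      using bump_span_DERIV by blast
    have "deriv ((deriv ^^ n) f) = g"
      using g(2) by (auto intro: DERIV_imp_deriv)
    then show ?case using g(1) by simp
  qed (use assms in simp)
  then show ?thesis
    using bump_span_DERIV by (metis differentiable_on_def real_differentiable_def differentiable_at_withinI)
qed

lemma bump_span_continuous: "f \<in> bump_span \<Longrightarrow> continuous_on A f"
  using bump_span_DERIV by (meson DERIV_continuous_on DERIV_subset subset_UNIV)

definition bump :: "real \<Rightarrow> real \<Rightarrow> real \<Rightarrow> real \<Rightarrow> real" where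
  "bump n a b x = flat_exp 1 (n * (x - a)) * flat_exp 1 (n * (b - x))"

lemma bump_in_span: "bump n a b \<in> bump_span"
  unfolding bump_def[abs_def] by (rule bump_span.base)

lemma flat_exp_1_bounds: "0 \<le> flat_exp 1 x" "flat_exp 1 x \<le> 1"
  by (auto simp: flat_exp_def)

lemma bump_bounds: "0 \<le> bump n a b x" "bump n a b x \<le> 1"
  using flat_exp_1_bounds by (auto simp: bump_def mult_le_one)

lemma bump_outside: "n > 0 \<Longrightarrow> x \<notin> {a<..<b} \<Longrightarrow> bump n a b x = 0"
  by (auto simp: bump_def flat_exp_def zero_less_mult_iff)

lemma bump_pos: "n > 0 \<Longrightarrow> x \<in> {a<..<b} \<Longrightarrow> bump n a b x > 0"
  by (auto simp: bump_def flat_exp_def)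

text \<open>At distance d > 0 from an end point the factor exp(-1/(n d)) tends to 1, whereas the
  function is exactly 0 outside the open interval.\<close>

lemma bump_tendsto_indicator: "(\<lambda>n. bump (real (Suc n)) a b x) \<longlonglongrightarrow> indicator {a<..<b} x"
proof (cases "x \<in> {a<..<b}")
  case True
  have *: "(\<lambda>n. flat_exp 1 (real (Suc n) * d)) \<longlonglongrightarrow> 1" if "d > 0" for d
  proof -
    have "(\<lambda>n. exp (- (inverse (real (Suc n)) * inverse d))) \<longlonglongrightarrow> exp (- (0 * inverse d))"
      by (intro tendsto_intros LIMSEQ_inverse_real_of_nat)
    then show ?thesis
      using that by (simp add: flat_exp_def)
  qed
  have "(\<lambda>n. flat_exp 1 (real (Suc n) * (x - a)) * flat_exp 1 (real (Suc n) * (b - x))) \<longlonglongrightarrow> 1 * 1"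
    by (intro tendsto_mult *) (use True in auto)
  then show ?thesis
    using True by (simp add: bump_def)
next
  case False
  then show ?thesis by (simp add: bump_outside)
qed

text \<open>The mean zero condition makes the primitive vanish again to the right of the support, so
  that it is itself an admissible test function.\<close>

lemma test_function_antideriv:
  assumes \<rho>: "\<rho> \<in> bump_span" and ab: "0 < a" "a \<le> b" "b < T"
    and supp: "\<And>x. x \<notin> {a..b} \<Longrightarrow> \<rho> x = 0"
    and mean: "integral {a..b} \<rho> = 0"
  obtains \<theta> where "test_function T \<theta>" "\<And>x. (\<theta> has_real_derivative \<rho> x) (at x)"
    "\<And>x. x \<notin> {a..b} \<Longrightarrow> \<theta> x = 0"
proof -
  \<comment> \<open>The integration starts at \<open>a - 1\<close> rather than \<open>a\<close> so
    that \<open>a\<close> is an interior point and the derivative there is two-sided.\<close>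
  define \<theta> where "\<theta> x = integral {a - 1..x} \<rho>" for x
  have cont: "continuous_on A \<rho>" for A by (rule bump_span_continuous[OF \<rho>])
  have low: "\<theta> x = 0" if "x \<le> a" for x
  proof -
    have "\<theta> x = integral {a - 1..x} (\<lambda>x. 0)"
      unfolding \<theta>_def
    proof (rule integral_spike[of "{a}"])
      show "0 = \<rho> y" if "y \<in> {a - 1..x} - {a}" for y
        using supp[of y] that \<open>x \<le> a\<close> by auto
    qed auto
    then show ?thesis by simp
  qed
  have high: "\<theta> x = 0" if "b < x" for x
  proof -
    have int: "\<rho> integrable_on {s..t}" for s t by (rule integrable_continuous_real[OF cont])
    have "\<theta> x = integral {a - 1..a} \<rho> + integral {a..x} \<rho>"
      unfolding \<theta>_def using ab that by (intro Henstock_Kurzweil_Integration.integral_combine[symmetric] int) auto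
    also have "integral {a..x} \<rho> = integral {a..b} \<rho> + integral {b..x} \<rho>"
      using ab that by (intro Henstock_Kurzweil_Integration.integral_combine[symmetric] int) auto
    also have "integral {b..x} \<rho> = integral {b..x} (\<lambda>x. 0)"
    proof (rule integral_spike[of "{b}"])
      show "0 = \<rho> y" if "y \<in> {b..x} - {b}" for y
        using supp[of y] that by auto
    qed auto
    finally show ?thesis using mean low[of a] by (simp add: \<theta>_def)
  qed
  have D: "(\<theta> has_real_derivative \<rho> x) (at x)" for x
  proof (cases "x < a")
    case True
    have "((\<lambda>x. 0) has_real_derivative \<rho> x) (at x)"
      using True supp[of x] by simp
    then show ?thesis
      by (rule has_field_derivative_transform_within_open[of _ _ _ "{..<a}"]) (use True low in auto)
  next
    case False
    have "(\<theta> has_real_derivative \<rho> x) (at x within {a - 1..x + 1})"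
      unfolding \<theta>_def[abs_def] using False by (intro integral_has_real_derivative cont) auto
    moreover have "at x within {a - 1..x + 1} = at x"
      using False by (intro at_within_interior) auto
    ultimately show ?thesis by simp
  qed
  have d: "deriv \<theta> = \<rho>"
    using D by (auto intro: DERIV_imp_deriv)
  have "(deriv ^^ n) \<theta> differentiable_on UNIV" for n
  proof (cases n)
    case 0
    then show ?thesis
      using D by (auto simp: differentiable_on_def real_differentiable_def intro: differentiable_at_withinI)
  next
    case (Suc m)
    then show ?thesis
      using bump_span_smooth[OF \<rho>, of m] by (simp add: funpow_Suc_right d del: funpow.simps)
  qed
  moreover have supp\<theta>: "\<theta> x = 0" if "x \<notin> {a..b}" for x
    using low[of x] high[of x] that by (cases "x \<le> a") auto
  ultimately have "test_function T \<theta>"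
    unfolding test_function_def using ab by blast
  then show ?thesis using D supp\<theta> that by blast
qed

text \<open>Let \<open>r\<close> be \<open>p\<close> minus a primitive of \<open>q\<close>.
  Integration by parts shows that \<open>r\<close> annihilates every derivative of a test function,
  that is, every bump of mean zero. After subtraction of a constant it annihilates all bumps, and
  these approximate indicators of intervals.\<close>

lemma du_bois_reymond:
  fixes p q :: "real \<Rightarrow> real"
  assumes T: "T > 0"
    and p: "set_integrable lebesgue {0<..T} p" and q: "set_integrable lebesgue {0<..T} q"
    and weak: "\<And>\<theta>. test_function T \<theta> \<Longrightarrow>
      (LINT x:{0<..T}|lebesgue. deriv \<theta> x * p x) = - (LINT x:{0<..T}|lebesgue. \<theta> x * q x)"
  shows "\<exists>c. AE x\<in>{0<..T} in lebesgue. p x = c + (LINT y:{0<..x}|lebesgue. q y)"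
proof -
  define Q where "Q t = (LINT y:{0<..t}|lebesgue. q y)" for t
  have Q: "ac_deriv 0 T Q q"
    unfolding Q_def by (rule ac_deriv_integral[OF q])
  define r where "r t = p t - Q t" for t
  have Qi: "set_integrable lebesgue {0<..T} Q"
    by (rule set_integrable_Ioc_continuous[OF ac_deriv_continuous[OF Q]])
  have r: "set_integrable lebesgue {0<..T} r"
    unfolding r_def[abs_def] using p Qi by (rule set_integral_diff)
  note cont = bump_span_continuous
  have zero: "(LINT x:{0<..T}|lebesgue. \<rho> x * r x) = 0"
    if \<rho>: "\<rho> \<in> bump_span" "0 < a" "a \<le> b" "b < T" "\<And>x. x \<notin> {a..b} \<Longrightarrow> \<rho> x = 0" "integral {0..T} \<rho> = 0" for \<rho> a b
  proof -
    have "integral {a..b} \<rho> = integral {0..T} \<rho>"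
    proof (rule integral_spike_set)
      have e: "{x \<in> {a..b} - {0..T}. \<rho> x \<noteq> 0} = {}" "{x \<in> {0..T} - {a..b}. \<rho> x \<noteq> 0} = {}"
        using \<rho>(2-5) by auto
      show "negligible {x \<in> {a..b} - {0..T}. \<rho> x \<noteq> 0}" "negligible {x \<in> {0..T} - {a..b}. \<rho> x \<noteq> 0}"
        unfolding e by simp_all
    qed
    then obtain \<theta> where \<theta>: "test_function T \<theta>" "\<And>x. (\<theta> has_real_derivative \<rho> x) (at x)"
      "\<And>x. x \<notin> {a..b} \<Longrightarrow> \<theta> x = 0"
      using test_function_antideriv[of \<rho> a b T] \<rho> by auto
    have d: "deriv \<theta> x = \<rho> x" for x
      using \<theta>(2) by (auto intro: DERIV_imp_deriv)
    have "ac_deriv 0 T \<theta> \<rho>"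
      by (rule ac_deriv_C1[OF DERIV_subset[OF \<theta>(2)] cont[OF \<rho>(1)]]) auto
    \<comment> \<open>Integration by parts; the boundary terms vanish because \<theta> is 0 at both
      ends.\<close>
    from ac_derivD(2)[OF ac_deriv_mult[OF this Q], of 0 T]
    have "0 = (LINT x:{0<..T}|lebesgue. Q x * \<rho> x + \<theta> x * q x)"
      using \<rho> T \<theta>(3)[of 0] \<theta>(3)[of T] by simp
    also have "\<dots> = (LINT x:{0<..T}|lebesgue. \<rho> x * Q x) + (LINT x:{0<..T}|lebesgue. \<theta> x * q x)"
    proof -
      have "set_integrable lebesgue {0<..T} (\<lambda>x. \<rho> x * Q x)"
        by (rule set_integrable_continuous_mult[OF cont[OF \<rho>(1)] Qi])
      moreover have "set_integrable lebesgue {0<..T} (\<lambda>x. \<theta> x * q x)"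
        by (rule set_integrable_continuous_mult[OF DERIV_continuous_on[OF DERIV_subset[OF \<theta>(2)]] q]) auto
      ultimately show ?thesis
        by (subst set_integral_add(2)[symmetric]) (simp_all add: mult.commute)
    qed
    also have "(LINT x:{0<..T}|lebesgue. \<theta> x * q x) = - (LINT x:{0<..T}|lebesgue. \<rho> x * p x)"
      using weak[OF \<theta>(1)] by (simp add: d)
    finally have "(LINT x:{0<..T}|lebesgue. \<rho> x * p x) - (LINT x:{0<..T}|lebesgue. \<rho> x * Q x) = 0"
      by simp
    then show ?thesis
      unfolding r_def right_diff_distrib
      by (subst set_integral_diff(2)) (auto intro!: set_integrable_continuous_mult p Qi cont[OF \<rho>(1)])
  qed
  \<comment> \<open>A fixed bump of nonzero mean \<open>m0\<close>; subtracting a multiple of it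
    gives any other bump mean zero.\<close>
  define \<rho>0 where "\<rho>0 = bump 1 (T/3) (2*T/3)"
  have \<rho>0: "\<rho>0 \<in> bump_span" by (simp add: \<rho>0_def bump_in_span)
  define m0 where "m0 = integral {0..T} \<rho>0"
  have "m0 \<noteq> 0"
  proof
    assume "m0 = 0"
    then have "\<rho>0 (T/2) = 0"
      unfolding m0_def using integral_eq_0_iff[OF cont[OF \<rho>0] T] bump_bounds T by (auto simp: \<rho>0_def)
    moreover have "\<rho>0 (T/2) > 0" unfolding \<rho>0_def by (rule bump_pos) (use T in auto)
    ultimately show False by simp
  qed
  \<comment> \<open>The only possible constant: it makes \<open>r - c\<close> annihilate
    \<rho>0.\<close>
  define c where "c = (LINT x:{0<..T}|lebesgue. \<rho>0 x * r x) / m0"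
  define f where "f x = r x - c" for x
  have f: "set_integrable lebesgue {0<..T} f"
    unfolding f_def[abs_def] by (intro set_integral_diff r set_integrable_Ioc_continuous) auto
  have bump0: "(LINT x:{0<..T}|lebesgue. bump n a b x * f x) = 0" if "0 < a" "a < b" "b < T" "n > 0" for a b n
  proof -
    define m where "m = integral {0..T} (bump n a b)"
    let ?\<rho> = "\<lambda>x. bump n a b x + (- m / m0) * \<rho>0 x"
    have int: "(\<lambda>x. g x) integrable_on {0..T}" if "g \<in> bump_span" for g
      by (rule integrable_continuous_real[OF cont[OF that]])
    have I: "integral {0..T} ?\<rho> = 0"
    proof -
      have "integral {0..T} ?\<rho> = m + integral {0..T} (\<lambda>x. (- m / m0) * \<rho>0 x)"
        unfolding m_def
        by (rule Henstock_Kurzweil_Integration.integral_add) (intro int bump_in_span bump_span_cmult \<rho>0)+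
      also have "integral {0..T} (\<lambda>x. (- m / m0) * \<rho>0 x) = (- m / m0) * m0"
        unfolding m0_def by (rule integral_mult_right)
      finally show ?thesis using \<open>m0 \<noteq> 0\<close> by simp
    qed
    have i1: "set_integrable lebesgue {0<..T} (\<lambda>x. bump n a b x * g x)" "set_integrable lebesgue {0<..T} (\<lambda>x. \<rho>0 x * g x)"
      if "set_integrable lebesgue {0<..T} g" for g
      using that by (auto intro!: set_integrable_continuous_mult cont \<rho>0 bump_in_span)
    have "(LINT x:{0<..T}|lebesgue. ?\<rho> x * r x) = 0"
    proof (rule zero)
      show "?\<rho> \<in> bump_span"
        by (intro bump_span.add bump_span_cmult \<rho>0 bump_in_span)
      fix x assume "x \<notin> {min a (T/3)..max b (2*T/3)}"
      then have "x \<notin> {a<..<b}" "x \<notin> {T/3<..<2*T/3}" by auto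
      then show "?\<rho> x = 0" using \<open>n > 0\<close> by (simp add: bump_outside \<rho>0_def)
    qed (use that T I in auto)
    moreover have "(LINT x:{0<..T}|lebesgue. ?\<rho> x * r x)
        = (LINT x:{0<..T}|lebesgue. bump n a b x * r x) + (- m / m0) * (LINT x:{0<..T}|lebesgue. \<rho>0 x * r x)"
    proof -
      have "(LINT x:{0<..T}|lebesgue. ?\<rho> x * r x) = (LINT x:{0<..T}|lebesgue. bump n a b x * r x + (- m / m0) * (\<rho>0 x * r x))"
        by (simp add: algebra_simps)
      also have "\<dots> = (LINT x:{0<..T}|lebesgue. bump n a b x * r x) + (LINT x:{0<..T}|lebesgue. (- m / m0) * (\<rho>0 x * r x))"
        using i1[OF r] by (intro set_integral_add(2) set_integrable_mult_right) auto
      also have "(LINT x:{0<..T}|lebesgue. (- m / m0) * (\<rho>0 x * r x)) = (- m / m0) * (LINT x:{0<..T}|lebesgue. \<rho>0 x * r x)"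
        by (rule set_integral_mult_right)
      finally show ?thesis .
    qed
    ultimately have "(LINT x:{0<..T}|lebesgue. bump n a b x * r x) = m * c"
      by (simp add: c_def)
    moreover have "(LINT x:{0<..T}|lebesgue. bump n a b x) = m"
    proof -
      have "set_integrable lebesgue {0<..T} (bump n a b)"
        by (intro set_integrable_Ioc_continuous cont bump_in_span)
      then have "(LINT x:{0<..T}|lebesgue. bump n a b x) = integral {0<..T} (bump n a b)"
        by (rule set_lebesgue_integral_eq_integral(2))
      also have "\<dots> = m"
        unfolding m_def by (rule integral_spike_set) (auto intro: negligible_subset[of "{0}"])
      finally show ?thesis .
    qed
    moreover have "(LINT x:{0<..T}|lebesgue. bump n a b x * f x)
        = (LINT x:{0<..T}|lebesgue. bump n a b x * r x) - (LINT x:{0<..T}|lebesgue. bump n a b x * c)"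
      unfolding f_def right_diff_distrib
      by (intro set_integral_diff(2) i1[OF r] set_integrable_mult_left set_integrable_Ioc_continuous cont bump_in_span)
    ultimately show ?thesis by simp
  qed
  define R where "R t = (LINT x:{0<..t}|lebesgue. f x)" for t
  have R: "ac_deriv 0 T R f"
    unfolding R_def by (rule ac_deriv_integral[OF f])
  have Req: "R a = R b" if ab: "0 < a" "a < b" "b < T" for a b
  proof -
    let ?f = "\<lambda>x. indicator {0<..T} x *\<^sub>R f x"
    have fi: "integrable lebesgue ?f" using f by (simp add: set_integrable_def)
    have bm: "g \<in> borel_measurable lebesgue" if "g \<in> bump_span" for g
      using borel_measurable_continuous_onI[OF cont[OF that]] by (intro measurable_completion) simp
    \<comment> \<open>Dominated convergence replaces the bump by the indicator of the interval; the
      bumps are bounded by 1.\<close>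
    have "(\<lambda>n. LINT x|lebesgue. bump (real (Suc n)) a b x * ?f x) \<longlonglongrightarrow> (LINT x|lebesgue. indicator {a<..<b} x * ?f x)"
    proof (rule integral_dominated_convergence[where w = "\<lambda>x. norm (?f x)"])
      show "integrable lebesgue (\<lambda>x. norm (?f x))" using fi by (rule integrable_norm)
      show "(\<lambda>x. indicator {a<..<b} x * ?f x) \<in> borel_measurable lebesgue"
        using fi by (intro borel_measurable_times borel_measurable_indicator) auto
      show "(\<lambda>x. bump (real (Suc n)) a b x * ?f x) \<in> borel_measurable lebesgue" for n
        using fi bm[OF bump_in_span] by (intro borel_measurable_times) auto
      show "AE x in lebesgue. (\<lambda>n. bump (real (Suc n)) a b x * ?f x) \<longlonglongrightarrow> indicator {a<..<b} x * ?f x"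
        by (intro always_eventually allI tendsto_mult_right bump_tendsto_indicator)
      show "AE x in lebesgue. norm (bump (real (Suc n)) a b x * ?f x) \<le> norm (?f x)" for n
        using bump_bounds[of "real (Suc n)" a b]
        by (intro always_eventually allI) (simp add: abs_mult mult_left_le_one_le)
    qed
    moreover have "(LINT x|lebesgue. bump (real (Suc n)) a b x * ?f x) = 0" for n
      using bump0[OF ab, of "real (Suc n)"] by (simp add: set_lebesgue_integral_def mult.left_commute)
    ultimately have "(LINT x|lebesgue. indicator {a<..<b} x * ?f x) = 0"
      by (simp add: LIMSEQ_const_iff)
    also have "(LINT x|lebesgue. indicator {a<..<b} x * ?f x) = (LINT x:{a<..b}|lebesgue. f x)"
      unfolding set_lebesgue_integral_def
    proof (rule integral_cong_AE)
      show "(\<lambda>x. indicator {a<..<b} x * ?f x) \<in> borel_measurable lebesgue"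
        using fi by (intro borel_measurable_times borel_measurable_indicator) auto
      show "(\<lambda>x. indicator {a<..b} x *\<^sub>R f x) \<in> borel_measurable lebesgue"
        using set_integrable_Ioc_subset[OF f, of a b] ab
        unfolding set_integrable_def by (auto intro: borel_measurable_integrable)
      have "{b} \<in> null_sets lebesgue" by simp
      from AE_not_in[OF this]
      show "AE x in lebesgue. indicator {a<..<b} x * ?f x = indicator {a<..b} x *\<^sub>R f x"
        by eventually_elim (use ab in \<open>auto simp: indicator_def\<close>)
    qed
    finally show ?thesis
      using ac_derivD(2)[OF R, of a b] ab by simp
  qed
  \<comment> \<open>\<open>R\<close> is constant on the open interval, where bumps are available,
    and continuity extends this to the end points, where \<open>R 0 = 0\<close>.\<close>
  have R0: "R t = 0" if "t \<in> {0..T}" for t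
  proof -
    have "continuous_on {0..T} R" by (rule ac_deriv_continuous[OF R])
    moreover have "closure {0<..<T} = {0..T}" using T by (rule closure_greaterThanLessThan)
    ultimately have const: "R x = R (T/2)" if "x \<in> {0..T}" for x
    proof (intro continuous_constant_on_closure[of "{0<..<T}" R "R (T/2)" x])
      fix y assume "y \<in> {0<..<T}"
      then show "R y = R (T/2)"
      proof (cases y "T/2" rule: linorder_cases)
        case less
        then show ?thesis using \<open>y \<in> {0<..<T}\<close> by (intro Req) auto
      next
        case greater
        then show ?thesis using \<open>y \<in> {0<..<T}\<close> T by (intro Req[symmetric]) auto
      next
        case equal
        then show ?thesis by (simp only:)
      qed
    qed (use that in auto)
    have "R t = R 0" using const[OF that] const[of 0] T by simp
    also have "R 0 = 0" by (simp add: R_def set_lebesgue_integral_def)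
    finally show ?thesis .
  qed
  have "AE x in lebesgue. indicator {0<..T} x *\<^sub>R f x = 0"
  proof (rule AE_eq_0_if_Ioc_integrals_eq_0)
    show "integrable lebesgue (\<lambda>x. indicator {0<..T} x *\<^sub>R f x)"
      using f by (simp add: set_integrable_def)
    show "(LINT x|lebesgue. indicator {0<..T} x *\<^sub>R f x) = 0"
      using R0[of T] T by (simp add: R_def set_lebesgue_integral_def)
    fix s t :: real
    define s' where "s' = max s 0"
    define t' where "t' = min t T"
    have "(LINT x:{s<..t}|lebesgue. indicator {0<..T} x *\<^sub>R f x) = (LINT x:{s'<..t'}|lebesgue. f x)"
      unfolding set_lebesgue_integral_def
      by (rule Bochner_Integration.integral_cong) (auto simp: s'_def t'_def indicator_def)
    also have "\<dots> = 0"
    proof (cases "s' \<le> t'")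
      case True
      then show ?thesis
        using ac_derivD(2)[OF R, of s' t'] R0[of s'] R0[of t'] by (simp add: s'_def t'_def)
    qed (simp add: set_lebesgue_integral_def)
    finally show "(LINT x:{s<..t}|lebesgue. indicator {0<..T} x *\<^sub>R f x) = 0" .
  qed
  then have "AE x\<in>{0<..T} in lebesgue. p x = c + (LINT y:{0<..x}|lebesgue. q y)"
    by eventually_elim (auto simp: f_def r_def Q_def)
  then show ?thesis by blast
qed

section \<open>Strong measurability and weak derivatives\<close>

lemma strongly_measurable_compose2:
  assumes f: "strongly_measurable M f" and g: "strongly_measurable M g"
    and p: "continuous_on UNIV (\<lambda>z. p (fst z) (snd z))"
  shows "strongly_measurable M (\<lambda>x. p (f x) (g x))"
proof -
  obtain s t where s: "\<And>i::nat. simple_function M (s i)" "AE x in M. (\<lambda>i. s i x) \<longlonglongrightarrow> f x"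
    and t: "\<And>i::nat. simple_function M (t i)" "AE x in M. (\<lambda>i. t i x) \<longlonglongrightarrow> g x"
    using f g unfolding strongly_measurable_def by blast
  have "AE x in M. (\<lambda>i. p (s i x) (t i x)) \<longlonglongrightarrow> p (f x) (g x)"
    using s(2) t(2)
  proof eventually_elim
    case (elim x)
    have "(\<lambda>i. (s i x, t i x)) \<longlonglongrightarrow> (f x, g x)"
      using elim by (intro tendsto_Pair)
    moreover have "isCont (\<lambda>z. p (fst z) (snd z)) (f x, g x)"
      using p by (simp add: continuous_on_eq_continuous_at)
    ultimately show ?case
      using isCont_tendsto_compose by fastforce
  qed
  moreover have "simple_function M (\<lambda>x. p (s i x) (t i x))" for i
    using s(1) t(1) by (rule simple_function_compose2)
  ultimately show ?thesis
    unfolding strongly_measurable_def by (intro exI[of _ "\<lambda>i x. p (s i x) (t i x)"]) auto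
qed

lemma strongly_measurable_compose:
  assumes "strongly_measurable M f" "continuous_on UNIV p"
  shows "strongly_measurable M (\<lambda>x. p (f x))"
  using strongly_measurable_compose2[OF assms(1,1), of "\<lambda>x y. p x"] assms(2)
    continuous_on_compose2[OF assms(2) continuous_on_fst[OF continuous_on_id]] by auto

lemma strongly_measurable_subset:
  fixes f :: "real \<Rightarrow> 'b::real_normed_vector"
  assumes f: "strongly_measurable (lebesgue_on S) f"
    and A: "A \<subseteq> S" "A \<in> sets lebesgue" and S: "S \<in> sets lebesgue"
  shows "strongly_measurable (lebesgue_on A) f"
proof -
  obtain s where s: "\<And>i::nat. simple_function (lebesgue_on S) (s i)" "AE x in lebesgue_on S. (\<lambda>i. s i x) \<longlonglongrightarrow> f x"
    using f unfolding strongly_measurable_def by blast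
  have "simple_function (lebesgue_on A) (s i)" for i
  proof -
    have "simple_function lebesgue (\<lambda>x. indicator A x *\<^sub>R (indicator S x *\<^sub>R s i x))"
    proof (rule simple_function_compose2[where h = "\<lambda>c y. c *\<^sub>R y"])
      show "simple_function lebesgue (\<lambda>x. indicator S x *\<^sub>R s i x)"
        using s(1)[of i] S by (subst (asm) simple_function_restrict_space) auto
      show "simple_function lebesgue (indicator A :: real \<Rightarrow> real)"
        using A by (intro simple_function_indicator) auto
    qed
    also have "(\<lambda>x. indicator A x *\<^sub>R (indicator S x *\<^sub>R s i x)) = (\<lambda>x. indicator A x *\<^sub>R s i x)"
      using A by (intro ext) (auto split: split_indicator)
    finally show ?thesis
      using A by (subst simple_function_restrict_space) auto
  qed
  moreover have "AE x in lebesgue_on A. (\<lambda>i. s i x) \<longlonglongrightarrow> f x"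
    using s(2) A S by (auto simp: AE_restrict_space_iff)
  ultimately show ?thesis
    unfolding strongly_measurable_def by blast
qed

text \<open>The pointwise \<open>lim\<close> of the simple functions is Borel measurable whatever
  its value where they diverge, and by completeness the change on a null set to \<open>f\<close> is
  harmless.\<close>

lemma strongly_measurable_imp_borel:
  fixes f :: "real \<Rightarrow> real"
  assumes f: "strongly_measurable (lebesgue_on S) f" and S: "S \<in> sets lebesgue"
  shows "set_borel_measurable lebesgue S f"
proof -
  obtain s where s: "\<And>i::nat. simple_function (lebesgue_on S) (s i)" "AE x in lebesgue_on S. (\<lambda>i. s i x) \<longlonglongrightarrow> f x"
    using f unfolding strongly_measurable_def by blast
  have m: "(\<lambda>x. indicator S x *\<^sub>R s i x) \<in> borel_measurable lebesgue" for i
    using borel_measurable_simple_function[OF s(1)[of i]] S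
    by (subst (asm) borel_measurable_restrict_space_iff) auto
  have "(\<lambda>x. lim (\<lambda>i. indicator S x *\<^sub>R s i x)) \<in> borel_measurable lebesgue"
    by (rule borel_measurable_lim_metric[OF m])
  moreover have "AE x in lebesgue. lim (\<lambda>i. indicator S x *\<^sub>R s i x) = indicator S x *\<^sub>R f x"
  proof -
    have "AE x in lebesgue. x \<in> S \<longrightarrow> (\<lambda>i. s i x) \<longlonglongrightarrow> f x"
      using s(2) S by (subst (asm) AE_restrict_space_iff) auto
    then show ?thesis
      by eventually_elim (auto simp: indicator_def intro!: limI)
  qed
  ultimately show ?thesis
    unfolding set_borel_measurable_def by (rule borel_measurable_AE)
qed

text \<open>The function is sampled on the grid of mesh \<open>1 / Suc n\<close>: the sampling point
  takes finitely many values on the bounded interval, and this makes the composition simple also for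
  values in a nonseparable space.\<close>

lemma continuous_imp_strongly_measurable:
  fixes v :: "real \<Rightarrow> 'b::real_normed_vector"
  assumes v: "continuous_on {a..b} v"
  shows "strongly_measurable (lebesgue_on {a<..b}) v"
proof -
  \<comment> \<open>Rounding down may leave the interval on the left, hence the maximum with
    \<open>a\<close>.\<close>
  define \<tau> where "\<tau> n x = max a (of_int \<lfloor>real (Suc n) * x\<rfloor> / real (Suc n))" for n x
  have sf: "simple_function (lebesgue_on {a<..b}) (\<tau> n)" for n
  proof (rule simple_function_borel_measurable)
    have "\<tau> n \<in> borel_measurable borel"
      unfolding \<tau>_def[abs_def] by measurable
    then have "\<tau> n \<in> borel_measurable lebesgue"
      by (intro measurable_completion) simp
    then show "\<tau> n \<in> borel_measurable (lebesgue_on {a<..b})"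
      by (rule measurable_restrict_space1)
    have "\<tau> n ` {a<..b} \<subseteq> (\<lambda>k. max a (of_int k / real (Suc n))) ` {\<lfloor>real (Suc n) * a\<rfloor>..\<lfloor>real (Suc n) * b\<rfloor>}"
    proof
      fix y assume "y \<in> \<tau> n ` {a<..b}"
      then obtain x where x: "a < x" "x \<le> b" "y = \<tau> n x" by auto
      have "\<lfloor>real (Suc n) * a\<rfloor> \<le> \<lfloor>real (Suc n) * x\<rfloor>" "\<lfloor>real (Suc n) * x\<rfloor> \<le> \<lfloor>real (Suc n) * b\<rfloor>"
        using x by (auto intro!: floor_mono mult_left_mono)
      then show "y \<in> (\<lambda>k. max a (of_int k / real (Suc n))) ` {\<lfloor>real (Suc n) * a\<rfloor>..\<lfloor>real (Suc n) * b\<rfloor>}"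
        using x by (auto simp: \<tau>_def)
    qed
    then show "finite (\<tau> n ` space (lebesgue_on {a<..b}))"
      by (simp add: finite_subset)
  qed
  have near: "\<bar>\<tau> n x - x\<bar> \<le> 1 / real (Suc n)" "\<tau> n x \<in> {a..b}" if "x \<in> {a<..b}" for n x
  proof -
    have "real (Suc n) * x - 1 < of_int \<lfloor>real (Suc n) * x\<rfloor>" "of_int \<lfloor>real (Suc n) * x\<rfloor> \<le> real (Suc n) * x"
      by linarith+
    moreover have "x - 1 / N < z / N" "z / N \<le> x" if "N * x - 1 < z" "z \<le> N * x" "N > 0" for N z :: real
      using that by (simp_all add: less_divide_eq divide_le_eq right_diff_distrib mult.commute)
    ultimately have "x - 1 / real (Suc n) < of_int \<lfloor>real (Suc n) * x\<rfloor> / real (Suc n)"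
        "of_int \<lfloor>real (Suc n) * x\<rfloor> / real (Suc n) \<le> x"
      by (meson of_nat_0_less_iff zero_less_Suc)+
    then show "\<bar>\<tau> n x - x\<bar> \<le> 1 / real (Suc n)" "\<tau> n x \<in> {a..b}"
      using that by (auto simp: \<tau>_def max_def abs_if)
  qed
  have "(\<lambda>n. v (\<tau> n x)) \<longlonglongrightarrow> v x" if x: "x \<in> {a<..b}" for x
  proof -
    have "(\<lambda>n. \<tau> n x - x) \<longlonglongrightarrow> 0"
    proof (rule tendsto_rabs_zero_cancel, rule tendsto_sandwich[OF _ _ tendsto_const LIMSEQ_inverse_real_of_nat])
      show "\<forall>\<^sub>F n in sequentially. \<bar>\<tau> n x - x\<bar> \<le> inverse (real (Suc n))"
        using near(1)[OF x] by (simp add: inverse_eq_divide)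
    qed simp
    then have "(\<lambda>n. \<tau> n x) \<longlonglongrightarrow> x"
      by (simp add: LIM_zero_iff)
    then show ?thesis
      by (rule continuous_on_tendsto_compose[OF v]) (use x near(2)[OF x] in auto)
  qed
  then have "AE x in lebesgue_on {a<..b}. (\<lambda>n. v (\<tau> n x)) \<longlonglongrightarrow> v x"
    by (intro AE_I2) auto
  moreover have "simple_function (lebesgue_on {a<..b}) (\<lambda>x. v (\<tau> n x))" for n
    by (rule simple_function_compose1[OF sf])
  ultimately show ?thesis
    unfolding strongly_measurable_def by (intro exI[of _ "\<lambda>n x. v (\<tau> n x)"]) auto
qed

text \<open>The bridge from vector to scalar integrals: a functional maps the approximating simple
  functions to simple functions and enlarges the L^1 errors by at most its norm.\<close>

lemma has_strong_integral_blinfun: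
  fixes \<phi> :: "'b::real_normed_vector \<Rightarrow>\<^sub>L real" and f :: "real \<Rightarrow> 'b"
  assumes f: "has_strong_integral (lebesgue_on S) f I" and S: "S \<in> sets lebesgue"
  shows "has_bochner_integral (lebesgue_on S) (\<lambda>x. \<phi> (f x)) (\<phi> I)"
proof -
  let ?M = "lebesgue_on S"
  obtain s where s: "\<And>i::nat. Bochner_Integration.simple_bochner_integrable ?M (s i)"
    "(\<lambda>i. \<integral>\<^sup>+x. ennreal (norm (f x - s i x)) \<partial>?M) \<longlonglongrightarrow> 0"
    "(\<lambda>i. Bochner_Integration.simple_bochner_integral ?M (s i)) \<longlonglongrightarrow> I"
    and sm: "strongly_measurable ?M f"
    using f unfolding has_strong_integral_def by blast
  have "strongly_measurable ?M (\<lambda>x. \<phi> (f x))"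
    by (rule strongly_measurable_compose[OF sm]) (intro continuous_intros)
  then have m: "(\<lambda>x. \<phi> (f x)) \<in> borel_measurable ?M"
    using strongly_measurable_imp_borel[OF _ S, of "\<lambda>x. \<phi> (f x)"] S
    by (subst borel_measurable_restrict_space_iff) (auto simp: set_borel_measurable_def)
  show ?thesis
  proof (rule has_bochner_integral.intros[OF m])
    show "Bochner_Integration.simple_bochner_integrable ?M (\<lambda>x. \<phi> (s i x))" for i
      using simple_bochner_integrable_compose2[OF _ s(1)[of i] s(1)[of i], of "\<lambda>x y. \<phi> x"]
      by (simp add: blinfun.zero_right)
    show "(\<lambda>i. \<integral>\<^sup>+x. ennreal (norm (\<phi> (f x) - \<phi> (s i x))) \<partial>?M) \<longlonglongrightarrow> 0"
    proof (rule tendsto_sandwich[OF always_eventually always_eventually tendsto_const])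
      show "\<forall>i. 0 \<le> (\<integral>\<^sup>+x. ennreal (norm (\<phi> (f x) - \<phi> (s i x))) \<partial>?M)" by simp
      have nm: "(\<lambda>x. ennreal (norm (f x - s i x))) \<in> borel_measurable ?M" for i
      proof -
        have si: "strongly_measurable ?M (s i)"
          using s(1)[of i] unfolding strongly_measurable_def
          by (intro exI[of _ "\<lambda>_. s i"]) (auto elim: simple_bochner_integrable.cases)
        have "strongly_measurable ?M (\<lambda>x. norm (f x - s i x))"
          by (rule strongly_measurable_compose2[OF sm si]) (intro continuous_intros)
        then have "(\<lambda>x. norm (f x - s i x)) \<in> borel_measurable ?M"
          using strongly_measurable_imp_borel[OF _ S, of "\<lambda>x. norm (f x - s i x)"] S
          by (subst borel_measurable_restrict_space_iff) (auto simp: set_borel_measurable_def)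
        then show ?thesis by measurable
      qed
      show "\<forall>i. (\<integral>\<^sup>+x. ennreal (norm (\<phi> (f x) - \<phi> (s i x))) \<partial>?M)
          \<le> ennreal (norm \<phi>) * (\<integral>\<^sup>+x. ennreal (norm (f x - s i x)) \<partial>?M)"
      proof
        fix i
        have "(\<integral>\<^sup>+x. ennreal (norm (\<phi> (f x) - \<phi> (s i x))) \<partial>?M)
            \<le> (\<integral>\<^sup>+x. ennreal (norm \<phi>) * ennreal (norm (f x - s i x)) \<partial>?M)"
          by (intro nn_integral_mono)
            (metis blinfun.diff_right ennreal_leI ennreal_mult norm_blinfun norm_ge_zero)
        also have "\<dots> = ennreal (norm \<phi>) * (\<integral>\<^sup>+x. ennreal (norm (f x - s i x)) \<partial>?M)"
          by (rule nn_integral_cmult[OF nm])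
        finally show "(\<integral>\<^sup>+x. ennreal (norm (\<phi> (f x) - \<phi> (s i x))) \<partial>?M)
          \<le> ennreal (norm \<phi>) * (\<integral>\<^sup>+x. ennreal (norm (f x - s i x)) \<partial>?M)" .
      qed
      show "(\<lambda>i. ennreal (norm \<phi>) * (\<integral>\<^sup>+x. ennreal (norm (f x - s i x)) \<partial>?M)) \<longlonglongrightarrow> 0"
        using ennreal_tendsto_cmult[OF _ s(2), of "ennreal (norm \<phi>)"] by simp
    qed
    have "Bochner_Integration.simple_bochner_integral ?M (\<lambda>x. \<phi> (s i x))
        = \<phi> (Bochner_Integration.simple_bochner_integral ?M (s i))" for i
      by (rule simple_bochner_integral_linear[OF _ s(1)])
        (auto intro: bounded_linear.linear blinfun.bounded_linear_right)
    then show "(\<lambda>i. Bochner_Integration.simple_bochner_integral ?M (\<lambda>x. \<phi> (s i x))) \<longlonglongrightarrow> \<phi> I"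
      using s(3) by (auto intro!: tendsto_intros)
  qed
qed

lemma set_integrable_Ioo_iff_Ioc:
  fixes f :: "real \<Rightarrow> real"
  shows "set_integrable lebesgue {a<..<b} f \<longleftrightarrow> set_integrable lebesgue {a<..b} f"
  by (rule absolutely_integrable_spike_set_eq) (auto intro: negligible_subset[of "{b}"])

text \<open>The end point is a null set; if one side is not integrable then neither is the other,
  and both integrals take the default value 0.\<close>

lemma set_integral_Ioo_eq_Ioc:
  fixes f :: "real \<Rightarrow> real"
  shows "(LINT x:{a<..<b}|lebesgue. f x) = (LINT x:{a<..b}|lebesgue. f x)"
proof (cases "set_integrable lebesgue {a<..b} f")
  case True
  then have "set_integrable lebesgue {a<..<b} f"
    by (simp add: set_integrable_Ioo_iff_Ioc)
  moreover have "integral {a<..<b} f = integral {a<..b} f"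
    by (rule integral_spike_set) (auto intro: negligible_subset[of "{b}"])
  ultimately show ?thesis
    using True by (simp add: set_lebesgue_integral_eq_integral)
next
  case False
  then show ?thesis
    using set_integrable_Ioo_iff_Ioc[of a b f]
    by (simp add: set_lebesgue_integral_def set_integrable_def not_integrable_integral_eq)
qed

lemma weak_deriv_blinfun:
  fixes \<phi> :: "'b::real_normed_vector \<Rightarrow>\<^sub>L real"
  assumes w: "weak_deriv T f f'" and \<theta>: "test_function T \<theta>"
  shows "(LINT x:{0<..T}|lebesgue. deriv \<theta> x * \<phi> (f x)) = - (LINT x:{0<..T}|lebesgue. \<theta> x * \<phi> (f' x))"
proof -
  obtain I where I: "has_strong_integral (lebesgue_on {0<..<T}) (\<lambda>t. deriv \<theta> t *\<^sub>R f t) I"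
    "has_strong_integral (lebesgue_on {0<..<T}) (\<lambda>t. \<theta> t *\<^sub>R f' t) (- I)"
    using w \<theta> unfolding weak_deriv_def by blast
  have "(LINT x|lebesgue_on {0<..<T}. deriv \<theta> x * \<phi> (f x)) = \<phi> I"
    using has_bochner_integral_integral_eq[OF has_strong_integral_blinfun[OF I(1), of \<phi>]]
    by (simp add: blinfun.scaleR_right)
  moreover have "(LINT x|lebesgue_on {0<..<T}. \<theta> x * \<phi> (f' x)) = - \<phi> I"
    using has_bochner_integral_integral_eq[OF has_strong_integral_blinfun[OF I(2), of \<phi>]]
    by (simp add: blinfun.scaleR_right blinfun.minus_right)
  ultimately show ?thesis
    unfolding set_integral_Ioo_eq_Ioc[symmetric]
    by (simp add: integral_restrict_space set_lebesgue_integral_def)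
qed

lemma test_function_deriv:
  assumes "test_function T \<theta>"
  shows "test_function T (deriv \<theta>)"
proof -
  obtain a b where ab: "0 < a" "b < T" "\<And>t. t \<notin> {a..b} \<Longrightarrow> \<theta> t = 0"
    and d: "\<And>n. (deriv ^^ n) \<theta> differentiable_on UNIV"
    using assms unfolding test_function_def by blast
  have "(deriv ^^ n) (deriv \<theta>) differentiable_on UNIV" for n
    using d[of "Suc n"] by (simp only: funpow_Suc_right o_def)
  moreover have "deriv \<theta> t = 0" if t: "t \<notin> {a..b}" for t
  proof -
    have "((\<lambda>x. 0) has_real_derivative 0) (at t)" by simp
    then have "(\<theta> has_real_derivative 0) (at t)"
      by (rule has_field_derivative_transform_within_open[of _ _ _ "- {a..b}"])
        (use t ab(3) in auto)
    then show ?thesis by (rule DERIV_imp_deriv)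
  qed
  ultimately show ?thesis
    unfolding test_function_def using ab by blast
qed

lemma AE_lebesgue_on_IooD:
  fixes a b :: real
  assumes "AE x in lebesgue_on {a<..<b}. P x"
  shows "AE x\<in>{a<..b} in lebesgue. P x"
proof -
  have "AE x\<in>{a<..<b} in lebesgue. P x"
    using assms by (subst (asm) AE_restrict_space_iff) auto
  moreover have "AE x in lebesgue. x \<notin> {b}"
    by (rule AE_not_in) simp
  ultimately show ?thesis
    by eventually_elim auto
qed

lemma strongly_measurable_Ioc:
  fixes f :: "real \<Rightarrow> 'b::real_normed_vector"
  assumes f: "strongly_measurable (lebesgue_on {a<..<b}) f"
  shows "strongly_measurable (lebesgue_on {a<..b}) f"
proof -
  obtain s where s: "\<And>i::nat. simple_function (lebesgue_on {a<..<b}) (s i)" "AE x in lebesgue_on {a<..<b}. (\<lambda>i. s i x) \<longlonglongrightarrow> f x"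
    using f unfolding strongly_measurable_def by blast
  \<comment> \<open>The approximants are controlled only on the open interval, so their value at the
    null point \<open>b\<close> is set to 0.\<close>
  let ?s = "\<lambda>i x. if x < b then s i x else 0"
  have "simple_function (lebesgue_on {a<..b}) (?s i)" for i
  proof -
    have "(\<lambda>x. indicator {a<..b} x *\<^sub>R ?s i x) = (\<lambda>x. indicator {a<..<b} x *\<^sub>R s i x)"
      by (intro ext) (auto split: split_indicator)
    then show ?thesis
      using s(1)[of i] by (simp add: simple_function_restrict_space)
  qed
  moreover have "AE x in lebesgue_on {a<..b}. (\<lambda>i. ?s i x) \<longlonglongrightarrow> f x"
  proof -
    have "AE x\<in>{a<..b} in lebesgue. (\<lambda>i. s i x) \<longlonglongrightarrow> f x"
      by (rule AE_lebesgue_on_IooD[OF s(2)])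
    moreover have "AE x in lebesgue. x \<notin> {b}"
      by (rule AE_not_in) simp
    ultimately have "AE x\<in>{a<..b} in lebesgue. (\<lambda>i. ?s i x) \<longlonglongrightarrow> f x"
      by eventually_elim auto
    then show ?thesis
      by (subst AE_restrict_space_iff) auto
  qed
  ultimately show ?thesis
    unfolding strongly_measurable_def by (intro exI[of _ ?s]) auto
qed

lemma set_integrable_dominated:
  fixes f g :: "real \<Rightarrow> real"
  assumes f: "set_borel_measurable lebesgue S f" and g: "set_integrable lebesgue S g"
    and le: "AE x in lebesgue. x \<in> S \<longrightarrow> \<bar>f x\<bar> \<le> g x"
  shows "set_integrable lebesgue S f"
  unfolding set_integrable_def
proof (rule Bochner_Integration.integrable_bound)
  show "integrable lebesgue (\<lambda>x. indicator S x *\<^sub>R g x)"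
    using g by (simp add: set_integrable_def)
  show "(\<lambda>x. indicator S x *\<^sub>R f x) \<in> borel_measurable lebesgue"
    using f by (simp add: set_borel_measurable_def)
  show "AE x in lebesgue. norm (indicator S x *\<^sub>R f x) \<le> norm (indicator S x *\<^sub>R g x)"
    using le by eventually_elim (auto split: split_indicator)
qed

lemma set_integrable_const_Ioc: "set_integrable lebesgue {a<..b::real} (\<lambda>x. c :: real)"
  by (rule set_integrable_Ioc_continuous[OF continuous_on_const])

lemma L1_D:
  fixes f :: "real \<Rightarrow> 'b::real_normed_vector"
  assumes "f \<in> L1 T"
  shows "strongly_measurable (lebesgue_on {0<..T}) f" "set_integrable lebesgue {0<..T} (\<lambda>t. norm (f t))"
proof -
  let ?M = "lebesgue_on {0<..<T}"
  have sm: "strongly_measurable ?M f" and fin: "(\<integral>\<^sup>+t. ennreal (norm (f t)) \<partial>?M) < \<infinity>"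
    using assms by (auto simp: L1_def)
  show "strongly_measurable (lebesgue_on {0<..T}) f"
    by (rule strongly_measurable_Ioc[OF sm])
  have "set_borel_measurable lebesgue {0<..<T} (\<lambda>t. norm (f t))"
    by (intro strongly_measurable_imp_borel strongly_measurable_compose[OF sm] continuous_intros) auto
  then have "(\<lambda>t. norm (f t)) \<in> borel_measurable ?M"
    by (subst borel_measurable_restrict_space_iff) (auto simp: set_borel_measurable_def)
  then have "integrable ?M (\<lambda>t. norm (f t))"
    by (rule integrableI_bounded) (use fin in simp)
  then have "set_integrable lebesgue {0<..<T} (\<lambda>t. norm (f t))"
    unfolding set_integrable_def by (subst (asm) integrable_restrict_space) auto
  then show "set_integrable lebesgue {0<..T} (\<lambda>t. norm (f t))"
    by (simp add: set_integrable_Ioo_iff_Ioc)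
qed

lemma Linf_D:
  fixes f :: "real \<Rightarrow> 'b::real_normed_vector"
  assumes "f \<in> Linf T"
  obtains B where "strongly_measurable (lebesgue_on {0<..T}) f" "B \<ge> 0"
    "AE t\<in>{0<..T} in lebesgue. norm (f t) \<le> B"
proof -
  obtain B where B: "AE t in lebesgue_on {0<..<T}. norm (f t) \<le> B"
    and sm: "strongly_measurable (lebesgue_on {0<..<T}) f"
    using assms by (auto simp: Linf_def)
  have "AE t\<in>{0<..T} in lebesgue. norm (f t) \<le> max 0 B"
    using AE_lebesgue_on_IooD[OF B] by eventually_elim auto
  then show ?thesis
    using that[of "max 0 B"] strongly_measurable_Ioc[OF sm] by auto
qed

text \<open>The set of coincidence is closed and contains almost every point of an open interval,
  hence all of it and its closure.\<close>

lemma continuous_AE_eq: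
  fixes f g :: "real \<Rightarrow> real"
  assumes "continuous_on {a..b} f" "continuous_on {a..b} g" "a < b"
    and "AE x\<in>{a<..b} in lebesgue. f x = g x"
  shows "x \<in> {a..b} \<Longrightarrow> f x = g x"
proof -
  let ?C = "{x \<in> {a..b}. f x = g x}"
  have "closed {x \<in> {a..b}. f x - g x = 0}"
    by (intro continuous_closed_preimage_constant continuous_intros assms)
  then have C: "closed ?C"
    by simp
  have "{a<..<b} \<subseteq> ?C"
  proof
    fix x assume "x \<in> {a<..<b}"
    moreover have "AE x\<in>{a<..<b} in lebesgue. x \<in> ?C"
      using assms(4) by eventually_elim auto
    ultimately show "x \<in> ?C"
      using mem_closed_if_AE_lebesgue_open[OF open_greaterThanLessThan C] by blast
  qed
  then have "closure {a<..<b} \<subseteq> ?C"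
    using C by (rule closure_minimal)
  then show "x \<in> {a..b} \<Longrightarrow> f x = g x"
    using assms(3) by auto
qed

text \<open>Evaluation at \<open>v\<close> as an element of the bidual. It turns statements on
  functions with values in the dual space into scalar ones.\<close>

lemma blinfun_eval:
  obtains \<phi> :: "('a::real_normed_vector \<Rightarrow>\<^sub>L real) \<Rightarrow>\<^sub>L real" where "\<And>w. blinfun_apply \<phi> w = blinfun_apply w v"
proof -
  have "bounded_linear (\<lambda>w :: 'a \<Rightarrow>\<^sub>L real. blinfun_apply w v)"
    by (rule blinfun.bounded_linear_left)
  then show ?thesis
    using that[of "Blinfun (\<lambda>w. blinfun_apply w v)"] by (simp add: bounded_linear_Blinfun_apply)
qed

lemma set_integrable_blinfun_L1:
  fixes f :: "real \<Rightarrow> 'b::real_normed_vector" and \<phi> :: "'b \<Rightarrow>\<^sub>L real"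
  assumes sm: "strongly_measurable (lebesgue_on {a<..b}) f" and int: "set_integrable lebesgue {a<..b} (\<lambda>t. norm (f t))"
  shows "set_integrable lebesgue {a<..b} (\<lambda>t. blinfun_apply \<phi> (f t))"
proof (rule set_integrable_dominated)
  show "set_borel_measurable lebesgue {a<..b} (\<lambda>t. blinfun_apply \<phi> (f t))"
    by (intro strongly_measurable_imp_borel strongly_measurable_compose[OF sm] continuous_intros) auto
  show "set_integrable lebesgue {a<..b} (\<lambda>t. norm \<phi> * norm (f t))"
    using int by auto
  show "AE x\<in>{a<..b} in lebesgue. \<bar>blinfun_apply \<phi> (f x)\<bar> \<le> norm \<phi> * norm (f x)"
    using norm_blinfun[of \<phi>] by (auto simp flip: real_norm_def)
qed

lemma set_integrable_norm_bounded:
  fixes f :: "real \<Rightarrow> 'b::real_normed_vector"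
  assumes sm: "strongly_measurable (lebesgue_on {a<..b}) f"
    and le: "AE t\<in>{a<..b} in lebesgue. norm (f t) \<le> B"
  shows "set_integrable lebesgue {a<..b} (\<lambda>t. norm (f t))"
proof (rule set_integrable_dominated[OF _ set_integrable_const_Ioc[where c = B]])
  show "set_borel_measurable lebesgue {a<..b} (\<lambda>t. norm (f t))"
    by (intro strongly_measurable_imp_borel strongly_measurable_compose[OF sm] continuous_intros) auto
  show "AE x\<in>{a<..b} in lebesgue. \<bar>norm (f x)\<bar> \<le> B"
    using le by simp
qed

text \<open>The du Bois-Reymond lemma identifies each scalar component with a primitive almost
  everywhere; continuity of \<open>f\<close> removes the exceptional set.\<close>

lemma weak_deriv_primitive:
  fixes f f' :: "real \<Rightarrow> 'b::real_normed_vector" and \<phi> :: "'b \<Rightarrow>\<^sub>L real"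
  assumes w: "weak_deriv T f f'" and T: "T > 0" and cont: "continuous_on {0..T} f"
    and f': "strongly_measurable (lebesgue_on {0<..T}) f'" "set_integrable lebesgue {0<..T} (\<lambda>t. norm (f' t))"
  shows "ac_deriv 0 T (\<lambda>t. \<phi> (f t)) (\<lambda>t. \<phi> (f' t))"
proof -
  have c: "continuous_on {0..T} (\<lambda>t. \<phi> (f t))"
    by (intro continuous_intros cont)
  have q: "set_integrable lebesgue {0<..T} (\<lambda>t. \<phi> (f' t))"
    by (rule set_integrable_blinfun_L1[OF f'])
  obtain c where c': "AE x\<in>{0<..T} in lebesgue. \<phi> (f x) = c + (LINT y:{0<..x}|lebesgue. \<phi> (f' y))"
    using du_bois_reymond[OF T set_integrable_Ioc_continuous[OF c] q weak_deriv_blinfun[OF w]] by blast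
  note ac = ac_deriv_add[OF ac_deriv_const[of 0 T c] ac_deriv_integral[OF q], simplified]
  show ?thesis
    by (rule ac_deriv_cong[OF ac _ _ q])
      (use continuous_AE_eq[OF c ac_deriv_continuous[OF ac] T c'] in auto)
qed

text \<open>
  Testing with derivatives of test functions avoids the almost everywhere identification of
  \<open>w1\<close> with the image of \<open>u1\<close> in \<open>V'\<close>.
\<close>

lemma weak_deriv2_primitive:
  fixes u u1 :: "real \<Rightarrow> 'v::real_inner" and iVH :: "'v \<Rightarrow>\<^sub>L 'h::real_inner"
  assumes T: "T > 0" and wu: "weak_deriv T u u1"
    and w1: "weak_deriv T (\<lambda>t. pivot_embed iVH (u t)) w1" and w2: "weak_deriv T w1 w2"
    and u1: "strongly_measurable (lebesgue_on {0<..T}) u1" "set_integrable lebesgue {0<..T} (\<lambda>t. norm (u1 t))"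
    and w2': "w2 \<in> L1 T"
  shows "\<exists>c. AE t\<in>{0<..T} in lebesgue. iVH v \<bullet> iVH (u1 t) = c + (LINT y:{0<..t}|lebesgue. w2 y v)"
proof -
  obtain ev :: "('v \<Rightarrow>\<^sub>L real) \<Rightarrow>\<^sub>L real" where ev: "\<And>w. blinfun_apply ev w = blinfun_apply w v"
    using blinfun_eval by blast
  let ?\<phi> = "pivot_embed iVH v"
  have \<phi>: "blinfun_apply (pivot_embed iVH y) x = iVH y \<bullet> iVH x" for x y
    by (simp add: pivot_embed_def dual_embed_def)
  show ?thesis
  proof (rule du_bois_reymond[OF T])
    show "set_integrable lebesgue {0<..T} (\<lambda>t. iVH v \<bullet> iVH (u1 t))"
      using set_integrable_blinfun_L1[OF u1, of ?\<phi>] by (simp add: \<phi>)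
    show "set_integrable lebesgue {0<..T} (\<lambda>t. w2 t v)"
      using set_integrable_blinfun_L1[OF L1_D[OF w2'], of ev] by (simp add: ev)
    fix \<theta> assume \<theta>: "test_function T \<theta>"
    have "(LINT x:{0<..T}|lebesgue. deriv \<theta> x * (iVH v \<bullet> iVH (u1 x))) = - (LINT x:{0<..T}|lebesgue. deriv (deriv \<theta>) x * (iVH v \<bullet> iVH (u x)))"
      using weak_deriv_blinfun[OF wu test_function_deriv[OF \<theta>], of ?\<phi>] by (simp add: \<phi>)
    also have "\<dots> = (LINT x:{0<..T}|lebesgue. deriv \<theta> x * w1 x v)"
      using weak_deriv_blinfun[OF w1 test_function_deriv[OF \<theta>], of ev] by (simp add: ev \<phi> inner_commute)
    also have "\<dots> = - (LINT x:{0<..T}|lebesgue. \<theta> x * w2 x v)"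
      using weak_deriv_blinfun[OF w2 \<theta>, of ev] by (simp add: ev)
    finally show "(LINT x:{0<..T}|lebesgue. deriv \<theta> x * (iVH v \<bullet> iVH (u1 x))) = - (LINT x:{0<..T}|lebesgue. \<theta> x * w2 x v)" .
  qed
qed

section \<open>The velocity as a continuous function\<close>

lemma ac_deriv_blinfun_bound:
  fixes w :: "real \<Rightarrow> 'v::real_normed_vector \<Rightarrow>\<^sub>L real"
  assumes w: "strongly_measurable (lebesgue_on {a<..b}) w" "set_integrable lebesgue {a<..b} (\<lambda>t. norm (w t))"
    and st: "a \<le> s" "s \<le> t" "t \<le> b"
  shows "\<bar>LINT y:{s<..t}|lebesgue. w y v\<bar> \<le> norm v * (LINT y:{s<..t}|lebesgue. norm (w y))"
proof -
  obtain ev :: "('v \<Rightarrow>\<^sub>L real) \<Rightarrow>\<^sub>L real" where ev: "\<And>w. blinfun_apply ev w = blinfun_apply w v"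
    using blinfun_eval by blast
  have i: "set_integrable lebesgue {s<..t} (\<lambda>y. w y v)"
    using set_integrable_blinfun_L1[OF w, of ev] st by (auto simp: ev intro: set_integrable_Ioc_subset)
  have n: "set_integrable lebesgue {s<..t} (\<lambda>y. norm v * norm (w y))"
    using set_integrable_Ioc_subset[OF w(2), of s t] st by auto
  have "\<bar>LINT y:{s<..t}|lebesgue. w y v\<bar> \<le> (LINT y:{s<..t}|lebesgue. norm (w y v))"
    using set_integral_norm_bound[OF i] by simp
  also have "\<dots> \<le> (LINT y:{s<..t}|lebesgue. norm v * norm (w y))"
    by (rule set_integral_mono[OF set_integrable_norm[OF i] n]) (metis norm_blinfun mult.commute)
  finally show ?thesis by simp
qed

text \<open>The null set in \<open>rel\<close> depends on \<open>v\<close>, whereas the vector to be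
  tested, \<open>u1 y - u1 x\<close>, varies with both times. Restricting first to a countable set
  of vectors gives one common null set, off which \<iota> \<open>u1\<close> has a modulus of
  continuity controlled by the primitive \<open>N\<close> of the norm of \<open>w2\<close>.\<close>

lemma velocity_exists:
  fixes u1 :: "real \<Rightarrow> 'v::real_inner" and w2 :: "real \<Rightarrow> 'v \<Rightarrow>\<^sub>L real"
    and \<iota> :: "'v \<Rightarrow>\<^sub>L 'h::{real_inner, complete_space}"
  assumes T: "T > 0"
    and u1: "strongly_measurable (lebesgue_on {0<..T}) u1" "AE t\<in>{0<..T} in lebesgue. norm (u1 t) \<le> B" "B \<ge> 0"
    and w2: "strongly_measurable (lebesgue_on {0<..T}) w2" "set_integrable lebesgue {0<..T} (\<lambda>t. norm (w2 t))"
    and rel: "\<And>v. \<exists>c. AE t\<in>{0<..T} in lebesgue. \<iota> v \<bullet> \<iota> (u1 t) = c + (LINT y:{0<..t}|lebesgue. w2 y v)"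
  obtains h where "continuous_on {0..T} h" "AE t\<in>{0<..T} in lebesgue. \<iota> (u1 t) = h t"
    "\<And>v. ac_deriv 0 T (\<lambda>t. \<iota> v \<bullet> h t) (\<lambda>t. w2 t v)"
proof -
  have w2v: "set_integrable lebesgue {0<..T} (\<lambda>t. w2 t v)" for v
  proof -
    obtain ev :: "('v \<Rightarrow>\<^sub>L real) \<Rightarrow>\<^sub>L real" where ev: "\<And>w. blinfun_apply ev w = blinfun_apply w v"
      using blinfun_eval by blast
    show ?thesis
      using set_integrable_blinfun_L1[OF w2, of ev] by (simp add: ev)
  qed
  define N where "N t = (LINT y:{0<..t}|lebesgue. norm (w2 y))" for t
  have N: "ac_deriv 0 T N (\<lambda>t. norm (w2 t))"
    unfolding N_def by (rule ac_deriv_integral[OF w2(2)])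
  define c where "c v = (SOME c. AE t\<in>{0<..T} in lebesgue. \<iota> v \<bullet> \<iota> (u1 t) = c + (LINT y:{0<..t}|lebesgue. w2 y v))" for v
  have c: "AE t\<in>{0<..T} in lebesgue. \<iota> v \<bullet> \<iota> (u1 t) = c v + (LINT y:{0<..t}|lebesgue. w2 y v)" for v
    unfolding c_def by (rule someI_ex[OF rel])
  obtain s where s: "\<And>i::nat. simple_function (lebesgue_on {0<..T}) (s i)" "AE x in lebesgue_on {0<..T}. (\<lambda>i. s i x) \<longlonglongrightarrow> u1 x"
    using u1(1) unfolding strongly_measurable_def by blast
  \<comment> \<open>All values of the simple approximants of \<open>u1\<close>. The set is
    countable, and the values of \<open>u1\<close> outside a null set are limits of its
    elements.\<close>
  define D where "D = (\<Union>i. s i ` {0<..T})"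
  have "countable D"
    unfolding D_def using simple_functionD(1)[OF s(1)] by (auto intro: countable_finite)
  define P where "P t \<longleftrightarrow> t \<in> {0<..T} \<and> (\<lambda>i. s i t) \<longlonglongrightarrow> u1 t \<and> norm (u1 t) \<le> B \<and>
    (\<forall>v\<in>D. \<iota> v \<bullet> \<iota> (u1 t) = c v + (LINT y:{0<..t}|lebesgue. w2 y v))" for t
  have P: "AE t\<in>{0<..T} in lebesgue. P t"
  proof -
    have "AE t\<in>{0<..T} in lebesgue. (\<lambda>i. s i t) \<longlonglongrightarrow> u1 t"
      using s(2) by (subst (asm) AE_restrict_space_iff) auto
    moreover have "AE t in lebesgue. \<forall>v\<in>D. t \<in> {0<..T} \<longrightarrow> \<iota> v \<bullet> \<iota> (u1 t) = c v + (LINT y:{0<..t}|lebesgue. w2 y v)"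
      using c \<open>countable D\<close> by (subst AE_ball_countable) auto
    ultimately show ?thesis
      using u1(2) by eventually_elim (auto simp: P_def)
  qed
  have est: "(norm (\<iota> (u1 y) - \<iota> (u1 x)))\<^sup>2 \<le> 2 * B * (N y - N x)" if "P x" "P y" "x \<le> y" for x y
  proof -
    let ?d = "\<iota> (u1 y) - \<iota> (u1 x)"
    have xy: "0 < x" "y \<le> T" using that by (auto simp: P_def)
    have Nd: "N y - N x = (LINT z:{x<..y}|lebesgue. norm (w2 z))"
      using ac_derivD(2)[OF N, of x y] xy that by simp
    have dv: "\<iota> v \<bullet> ?d = (LINT z:{x<..y}|lebesgue. w2 z v)" if "v \<in> D" for v
    proof -
      have "\<iota> v \<bullet> ?d = (LINT z:{0<..y}|lebesgue. w2 z v) - (LINT z:{0<..x}|lebesgue. w2 z v)"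
        using \<open>P x\<close> \<open>P y\<close> that by (simp add: P_def inner_diff_right)
      also have "\<dots> = (LINT z:{x<..y}|lebesgue. w2 z v)"
        using set_integral_Ioc_combine[OF w2v[of v], of x y] xy \<open>x \<le> y\<close> by simp
      finally show ?thesis .
    qed
    have "\<bar>\<iota> (s i y - s i x) \<bullet> ?d\<bar> \<le> norm (s i y - s i x) * (N y - N x)" for i
    proof -
      have D: "s i y \<in> D" "s i x \<in> D" unfolding D_def using \<open>x \<le> y\<close> xy by (auto intro!: exI[of _ i])
      have "\<iota> (s i y - s i x) \<bullet> ?d = (LINT z:{x<..y}|lebesgue. w2 z (s i y)) - (LINT z:{x<..y}|lebesgue. w2 z (s i x))"
        using dv[OF D(1)] dv[OF D(2)] by (simp add: blinfun.diff_right inner_diff_left)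
      also have "\<dots> = (LINT z:{x<..y}|lebesgue. w2 z (s i y - s i x))"
        unfolding blinfun.diff_right
        using xy that by (intro set_integral_diff(2)[symmetric] set_integrable_Ioc_subset[OF w2v]) auto
      finally show ?thesis
        using ac_deriv_blinfun_bound[OF w2, of x y] xy that by (simp add: Nd)
    qed
    \<comment> \<open>The estimate passes from differences of elements of \<open>D\<close> to the
      difference of \<open>u1\<close> itself.\<close>
    moreover have "(\<lambda>i. \<bar>\<iota> (s i y - s i x) \<bullet> ?d\<bar>) \<longlonglongrightarrow> \<bar>\<iota> (u1 y - u1 x) \<bullet> ?d\<bar>"
      "(\<lambda>i. norm (s i y - s i x) * (N y - N x)) \<longlonglongrightarrow> norm (u1 y - u1 x) * (N y - N x)"
      using that by (auto simp: P_def intro!: tendsto_intros)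
    ultimately have "\<bar>\<iota> (u1 y - u1 x) \<bullet> ?d\<bar> \<le> norm (u1 y - u1 x) * (N y - N x)"
      by (intro LIMSEQ_le) auto
    also have "\<dots> \<le> 2 * B * (N y - N x)"
    proof (rule mult_right_mono)
      show "norm (u1 y - u1 x) \<le> 2 * B"
        using that norm_triangle_ineq4[of "u1 y" "u1 x"] by (auto simp: P_def)
      show "0 \<le> N y - N x"
        unfolding Nd set_lebesgue_integral_def by (rule integral_nonneg_AE) auto
    qed
    finally show ?thesis
      by (simp add: blinfun.diff_right power2_norm_eq_inner)
  qed
  have est': "(norm (\<iota> (u1 y) - \<iota> (u1 x)))\<^sup>2 \<le> 2 * B * \<bar>N y - N x\<bar>" if "P x" "P y" for x y
  proof (cases "x \<le> y")
    case True
    then show ?thesis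
      using est[OF that True] mult_left_mono[OF abs_ge_self[of "N y - N x"], of "2 * B"] u1(3) by linarith
  next
    case False
    then show ?thesis
      using est[of y x] that mult_left_mono[OF abs_ge_minus_self[of "N y - N x"], of "2 * B"] u1(3)
      by (simp add: norm_minus_commute algebra_simps)
  qed
  have "uniformly_continuous_on {0..T} N"
    by (rule compact_uniformly_continuous[OF ac_deriv_continuous[OF N]]) simp
  have "uniformly_continuous_on (Collect P) (\<lambda>t. \<iota> (u1 t))"
    unfolding uniformly_continuous_on_def
  proof (intro allI impI)
    fix e :: real assume "e > 0"
    \<comment> \<open>The summand 1 avoids division by zero when \<open>B = 0\<close>.\<close>
    then have "e\<^sup>2 / (2 * B + 1) > 0" using u1(3) by auto
    then obtain d where d: "d > 0" "\<And>x y. x \<in> {0..T} \<Longrightarrow> y \<in> {0..T} \<Longrightarrow> dist y x < d \<Longrightarrow> dist (N y) (N x) < e\<^sup>2 / (2 * B + 1)"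
      using \<open>uniformly_continuous_on {0..T} N\<close> unfolding uniformly_continuous_on_def by metis
    show "\<exists>d>0. \<forall>x\<in>Collect P. \<forall>y\<in>Collect P. dist y x < d \<longrightarrow> dist (\<iota> (u1 y)) (\<iota> (u1 x)) < e"
    proof (intro exI[of _ d] conjI ballI impI d(1))
      fix x y assume xy: "x \<in> Collect P" "y \<in> Collect P" "dist y x < d"
      then have "\<bar>N y - N x\<bar> < e\<^sup>2 / (2 * B + 1)"
        using d(2)[of x y] by (auto simp: P_def dist_real_def)
      then have "(2 * B + 1) * \<bar>N y - N x\<bar> < e\<^sup>2"
        using u1(3) by (simp add: less_divide_eq mult.commute)
      moreover have "2 * B * \<bar>N y - N x\<bar> \<le> (2 * B + 1) * \<bar>N y - N x\<bar>"
        by (intro mult_right_mono) auto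
      ultimately have "(norm (\<iota> (u1 y) - \<iota> (u1 x)))\<^sup>2 < e\<^sup>2"
        using est'[of x y] xy by auto
      then show "dist (\<iota> (u1 y)) (\<iota> (u1 x)) < e"
        using \<open>e > 0\<close> by (auto simp: dist_norm intro: power2_less_imp_less)
    qed
  qed
  then obtain h where h: "uniformly_continuous_on (closure (Collect P)) h" "\<And>t. t \<in> Collect P \<Longrightarrow> \<iota> (u1 t) = h t"
    by (rule uniformly_continuous_on_extension_on_closure) blast
  \<comment> \<open>A set of full measure is dense, so the extension by uniform continuity is
    defined on the whole interval.\<close>
  have sub: "{0..T} \<subseteq> closure (Collect P)"
  proof -
    have "{0<..<T} \<subseteq> closure (Collect P)"
    proof
      fix x assume "x \<in> {0<..<T}"
      moreover have "AE x\<in>{0<..<T} in lebesgue. x \<in> closure (Collect P)"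
        using P by eventually_elim (auto intro: closure_subset[THEN subsetD])
      ultimately show "x \<in> closure (Collect P)"
        using mem_closed_if_AE_lebesgue_open[OF open_greaterThanLessThan closed_closure] by blast
    qed
    then have "closure {0<..<T} \<subseteq> closure (Collect P)"
      by (rule closure_minimal) simp
    then show ?thesis using T by simp
  qed
  have hc: "continuous_on {0..T} h"
    by (rule continuous_on_subset[OF uniformly_continuous_imp_continuous[OF h(1)] sub])
  have hAE: "AE t\<in>{0<..T} in lebesgue. \<iota> (u1 t) = h t"
    using P by eventually_elim (use h(2) in auto)
  have "ac_deriv 0 T (\<lambda>t. \<iota> v \<bullet> h t) (\<lambda>t. w2 t v)" for v
  proof -
    note ac = ac_deriv_add[OF ac_deriv_const[of 0 T "c v"] ac_deriv_integral[OF w2v[of v]], simplified]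
    have eq: "AE t\<in>{0<..T} in lebesgue. c v + (LINT y:{0<..t}|lebesgue. w2 y v) = \<iota> v \<bullet> h t"
      using hAE c[of v] by eventually_elim auto
    have "continuous_on {0..T} (\<lambda>t. \<iota> v \<bullet> h t)"
      by (intro continuous_intros hc)
    from continuous_AE_eq[OF ac_deriv_continuous[OF ac] this T eq] show ?thesis
      by (intro ac_deriv_cong[OF ac _ _ w2v]) auto
  qed
  then show ?thesis
    using that hc hAE by blast
qed

text \<open>The hypothesis on \<open>k\<close> is only componentwise. To recover a derivative in
  norm, the remainder of the increment is tested against itself; Cauchy-Schwarz then allows one
  factor of its norm to be cancelled.\<close>

lemma velocity_has_vector_derivative:
  fixes k h :: "real \<Rightarrow> 'h::real_inner"
  assumes h: "continuous_on {0..T} h" and k: "\<And>e. ac_deriv 0 T (\<lambda>t. e \<bullet> k t) (\<lambda>t. e \<bullet> h t)"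
    and t: "0 < t" "t < T"
  shows "(k has_vector_derivative h t) (at t)"
proof -
  have est: "norm (k y - k x - (y - x) *\<^sub>R h t) \<le> \<epsilon> * (y - x)"
    if xy: "0 \<le> x" "x \<le> y" "y \<le> T" and le: "\<And>z. z \<in> {x..y} \<Longrightarrow> norm (h z - h t) \<le> \<epsilon>" for x y \<epsilon>
  proof (cases "x < y")
    case True
    define E where "E = k y - k x - (y - x) *\<^sub>R h t"
    have c: "continuous_on {x..y} (\<lambda>z. E \<bullet> h z)"
      by (intro continuous_intros continuous_on_subset[OF h]) (use xy in auto)
    have i1: "set_integrable lebesgue {x<..y} (\<lambda>z. E \<bullet> h z)"
      by (rule set_integrable_Ioc_continuous[OF c])
    have "E \<bullet> E = (E \<bullet> k y - E \<bullet> k x) - (y - x) * (E \<bullet> h t)"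
      by (subst (2) E_def) (simp only: inner_diff_right inner_scaleR_right)
    also have "E \<bullet> k y - E \<bullet> k x = (LINT z:{x<..y}|lebesgue. E \<bullet> h z)"
      using ac_derivD(2)[OF k[of E], of x y] xy by simp
    also have "(y - x) * (E \<bullet> h t) = (LINT z:{x<..y}|lebesgue. E \<bullet> h t)"
      using xy by (simp add: set_lebesgue_integral_def)
    also have "(LINT z:{x<..y}|lebesgue. E \<bullet> h z) - (LINT z:{x<..y}|lebesgue. E \<bullet> h t)
        = (LINT z:{x<..y}|lebesgue. E \<bullet> h z - E \<bullet> h t)"
      by (rule set_integral_diff(2)[OF i1 set_integrable_const_Ioc, symmetric])
    also have "\<dots> \<le> (LINT z:{x<..y}|lebesgue. norm E * \<epsilon>)"
    proof (rule set_integral_mono[OF set_integral_diff(1)[OF i1 set_integrable_const_Ioc] set_integrable_const_Ioc])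
      fix z assume "z \<in> {x<..y}"
      then have "norm E * norm (h z - h t) \<le> norm E * \<epsilon>"
        by (intro mult_left_mono le) auto
      then show "E \<bullet> h z - E \<bullet> h t \<le> norm E * \<epsilon>"
        using norm_cauchy_schwarz[of E "h z - h t"] by (simp add: inner_diff_right[symmetric])
    qed
    also have "\<dots> = norm E * (\<epsilon> * (y - x))"
      using xy by (simp add: set_lebesgue_integral_def)
    finally have "norm E * norm E \<le> norm E * (\<epsilon> * (y - x))"
      by (simp only: dot_square_norm power2_eq_square)
    then have "norm E \<le> \<epsilon> * (y - x)"
    proof (cases "E = 0")
      case True
      have "norm (h x - h t) \<le> \<epsilon>" using xy by (intro le) auto
      then have "0 \<le> \<epsilon>" by (rule order_trans[OF norm_ge_zero])
      then show ?thesis using True xy by simp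
    qed simp
    then show ?thesis unfolding E_def .
  qed (use xy in simp)
  show ?thesis
    unfolding has_vector_derivative_def has_derivative_at_alt
  proof (intro conjI allI impI)
    show "bounded_linear (\<lambda>x. x *\<^sub>R h t)" by (rule bounded_linear_scaleR_left)
    fix e :: real assume "e > 0"
    then obtain d where d: "d > 0" "\<And>y. y \<in> {0..T} \<Longrightarrow> dist y t < d \<Longrightarrow> dist (h y) (h t) < e"
      using h t unfolding continuous_on_iff by (metis atLeastAtMost_iff less_imp_le)
    show "\<exists>d>0. \<forall>y. norm (y - t) < d \<longrightarrow> norm (k y - k t - (y - t) *\<^sub>R h t) \<le> e * norm (y - t)"
    proof (intro exI[of _ "min d (min t (T - t))"] conjI allI impI)
      show "0 < min d (min t (T - t))" using d t by simp
      fix y assume y: "norm (y - t) < min d (min t (T - t))"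
      have near: "norm (h z - h t) \<le> e" if "z \<in> {min y t..max y t}" for z
      proof -
        have "norm (z - t) \<le> norm (y - t)" using that by auto
        then show ?thesis
          using d(2)[of z] y that t by (force simp: dist_norm)
      qed
      show "norm (k y - k t - (y - t) *\<^sub>R h t) \<le> e * norm (y - t)"
      proof (cases "t \<le> y")
        case True
        then show ?thesis
          using est[of t y e] near y t by simp
      next
        case False
        have "k y - k t - (y - t) *\<^sub>R h t = - (k t - k y - (t - y) *\<^sub>R h t)"
          by (simp add: algebra_simps)
        then show ?thesis
          using est[of y t e] near y t False by (simp only: norm_minus_cancel) simp
      qed
    qed
  qed
qed

section \<open>Pairings between a space and its dual: product rule and weak convergence\<close>

lemma set_integrable_pairing:
  fixes f :: "real \<Rightarrow> 'v::real_normed_vector" and w :: "real \<Rightarrow> 'v \<Rightarrow>\<^sub>L real"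
  assumes w: "strongly_measurable (lebesgue_on {a<..b}) w" "set_integrable lebesgue {a<..b} (\<lambda>t. norm (w t))"
    and f: "strongly_measurable (lebesgue_on {a<..b}) f" "AE t\<in>{a<..b} in lebesgue. norm (f t) \<le> B"
  shows "set_integrable lebesgue {a<..b} (\<lambda>t. w t (f t))"
proof (rule set_integrable_dominated)
  show "set_borel_measurable lebesgue {a<..b} (\<lambda>t. w t (f t))"
    by (intro strongly_measurable_imp_borel strongly_measurable_compose2[OF w(1) f(1)] continuous_intros) auto
  show "set_integrable lebesgue {a<..b} (\<lambda>t. B * norm (w t))"
    using w(2) by auto
  show "AE x\<in>{a<..b} in lebesgue. \<bar>w x (f x)\<bar> \<le> B * norm (w x)"
    using f(2)
  proof eventually_elim
    case (elim x)
    show ?case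
    proof
      assume "x \<in> {a<..b}"
      then have "norm (w x) * norm (f x) \<le> norm (w x) * B"
        using elim by (intro mult_left_mono) auto
      then show "\<bar>w x (f x)\<bar> \<le> B * norm (w x)"
        using norm_blinfun[of "w x" "f x"] by (simp add: mult.commute)
    qed
  qed
qed

lemma continuous_bounded_Icc:
  fixes f :: "real \<Rightarrow> 'v::real_normed_vector"
  assumes "continuous_on {a..b} f"
  obtains B where "B \<ge> 0" "\<And>t. t \<in> {a..b} \<Longrightarrow> norm (f t) \<le> B"
proof -
  have "bounded (f ` {a..b})"
    using assms by (intro compact_imp_bounded compact_continuous_image) auto
  then obtain B where "\<forall>x\<in>f ` {a..b}. norm x \<le> B"
    by (auto simp only: bounded_iff)
  then have "\<And>t. t \<in> {a..b} \<Longrightarrow> norm (f t) \<le> B"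
    by blast
  then show ?thesis
    using that[of "max 0 B"] by (meson max.cobounded1 max.coboundedI2)
qed

text \<open>The increment of the product splits into an increment of \<open>h\<close> against
  \<open>f t\<close> and an increment of \<open>f\<close> against \<open>h s\<close>. With these
  factors frozen both parts are known integrals, and unfreezing them costs at most \<open>e\<close>
  times the weight formed by the norm of \<open>w\<close> and a bound of \<open>k1\<close>.\<close>

lemma ac_deriv_pairing:
  fixes f :: "real \<Rightarrow> 'v::real_normed_vector" and w :: "real \<Rightarrow> 'v \<Rightarrow>\<^sub>L real"
    and \<iota> :: "'v \<Rightarrow>\<^sub>L 'h::real_inner"
  assumes w: "strongly_measurable (lebesgue_on {a<..b}) w" "set_integrable lebesgue {a<..b} (\<lambda>t. norm (w t))"
    and h: "continuous_on {a..b} h" "\<And>v. ac_deriv a b (\<lambda>t. \<iota> v \<bullet> h t) (\<lambda>t. w t v)"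
    and f: "continuous_on {a..b} f" and k1: "continuous_on {a..b} k1"
    and fk: "\<And>e. ac_deriv a b (\<lambda>t. e \<bullet> \<iota> (f t)) (\<lambda>t. e \<bullet> k1 t)"
  shows "ac_deriv a b (\<lambda>t. h t \<bullet> \<iota> (f t)) (\<lambda>t. w t (f t) + h t \<bullet> k1 t)"
proof -
  obtain B where B: "B \<ge> 0" "\<And>t. t \<in> {a..b} \<Longrightarrow> norm (f t) \<le> B"
    using continuous_bounded_Icc[OF f] by blast
  obtain C where C: "C \<ge> 0" "\<And>t. t \<in> {a..b} \<Longrightarrow> norm (k1 t) \<le> C"
    using continuous_bounded_Icc[OF k1] by blast
  have i1: "set_integrable lebesgue {a<..b} (\<lambda>t. w t (f t))"
    by (rule set_integrable_pairing[OF w continuous_imp_strongly_measurable[OF f], of B]) (use B in auto)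
  have i2: "set_integrable lebesgue {a<..b} (\<lambda>t. h t \<bullet> k1 t)"
    by (intro set_integrable_Ioc_continuous continuous_intros h k1)
  have ig: "set_integrable lebesgue {a<..b} (\<lambda>t. w t (f t) + h t \<bullet> k1 t)"
    using i1 i2 by (rule set_integral_add)
  have im: "set_integrable lebesgue {a<..b} (\<lambda>t. norm (w t) + C)"
    using w(2) set_integrable_const_Ioc by (rule set_integral_add)
  show ?thesis
  proof (rule ac_deriv_local[OF ig im])
    fix e x :: real assume e: "e > 0" and x: "x \<in> {a..b}"
    obtain d1 where d1: "d1 > 0" "\<And>y. y \<in> {a..b} \<Longrightarrow> dist y x < d1 \<Longrightarrow> dist (f y) (f x) < e / 2"
      using f x e unfolding continuous_on_iff by (metis half_gt_zero)
    obtain d2 where d2: "d2 > 0" "\<And>y. y \<in> {a..b} \<Longrightarrow> dist y x < d2 \<Longrightarrow> dist (h y) (h x) < e / 2"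
      using h(1) x e unfolding continuous_on_iff by (metis half_gt_zero)
    show "\<exists>d>0. \<forall>s t. a \<le> s \<longrightarrow> s \<le> x \<longrightarrow> x \<le> t \<longrightarrow> t \<le> b \<longrightarrow> t - s < d \<longrightarrow>
      (\<exists>q. set_integrable lebesgue {s<..t} q \<and> h t \<bullet> \<iota> (f t) - h s \<bullet> \<iota> (f s) = (LINT y:{s<..t}|lebesgue. q y) \<and>
        (\<forall>y\<in>{s<..t}. \<bar>q y - (w y (f y) + h y \<bullet> k1 y)\<bar> \<le> e * (norm (w y) + C)))"
    proof (intro exI[of _ "min d1 d2"] conjI allI impI)
      show "min d1 d2 > 0" using d1 d2 by simp
      fix s t assume *: "a \<le> s" "s \<le> x" "x \<le> t" "t \<le> b" "t - s < min d1 d2"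
      have near: "dist (f y) (f x) < e / 2" "dist (h y) (h x) < e / 2" if "y \<in> {s..t}" for y
        using d1(2)[of y] d2(2)[of y] that * by (auto simp: dist_real_def)
      have A1: "set_integrable lebesgue {s<..t} (\<lambda>y. w y (f t))"
        using ac_derivD(1)[OF h(2)[of "f t"]] * by (auto intro: set_integrable_Ioc_subset)
      have A2: "set_integrable lebesgue {s<..t} (\<lambda>y. h s \<bullet> k1 y)"
        using ac_derivD(1)[OF fk[of "h s"]] * by (auto intro: set_integrable_Ioc_subset)
      show "\<exists>q. set_integrable lebesgue {s<..t} q \<and> h t \<bullet> \<iota> (f t) - h s \<bullet> \<iota> (f s) = (LINT y:{s<..t}|lebesgue. q y) \<and>
        (\<forall>y\<in>{s<..t}. \<bar>q y - (w y (f y) + h y \<bullet> k1 y)\<bar> \<le> e * (norm (w y) + C))"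
      proof (intro exI[of _ "\<lambda>y. w y (f t) + h s \<bullet> k1 y"] conjI ballI)
        show "set_integrable lebesgue {s<..t} (\<lambda>y. w y (f t) + h s \<bullet> k1 y)"
          using A1 A2 by (rule set_integral_add)
        have "h t \<bullet> \<iota> (f t) - h s \<bullet> \<iota> (f s) = (\<iota> (f t) \<bullet> h t - \<iota> (f t) \<bullet> h s) + (h s \<bullet> \<iota> (f t) - h s \<bullet> \<iota> (f s))"
          by (simp add: inner_commute)
        also have "\<dots> = (LINT y:{s<..t}|lebesgue. w y (f t)) + (LINT y:{s<..t}|lebesgue. h s \<bullet> k1 y)"
          using ac_derivD(2)[OF h(2)[of "f t"], of s t] ac_derivD(2)[OF fk[of "h s"], of s t] * by simp
        also have "\<dots> = (LINT y:{s<..t}|lebesgue. w y (f t) + h s \<bullet> k1 y)"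
          using A1 A2 by simp
        finally show "h t \<bullet> \<iota> (f t) - h s \<bullet> \<iota> (f s) = (LINT y:{s<..t}|lebesgue. w y (f t) + h s \<bullet> k1 y)" .
        fix y assume y: "y \<in> {s<..t}"
        have "norm (f t - f y) \<le> e"
          using near(1)[of t] near(1)[of y] y * dist_triangle_half_l[of "f t" "f x" e "f y"]
          by (auto simp: dist_norm)
        then have "norm (w y) * norm (f t - f y) \<le> norm (w y) * e"
          by (intro mult_left_mono) auto
        then have a1: "\<bar>w y (f t - f y)\<bar> \<le> e * norm (w y)"
          using norm_blinfun[of "w y" "f t - f y"] by (simp add: mult.commute)
        have "norm (h s - h y) \<le> e"
          using near(2)[of s] near(2)[of y] y * dist_triangle_half_l[of "h s" "h x" e "h y"]
          by (auto simp: dist_norm)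
        then have "norm (h s - h y) * norm (k1 y) \<le> e * C"
          using C y * e by (intro mult_mono) auto
        then have a2: "\<bar>(h s - h y) \<bullet> k1 y\<bar> \<le> e * C"
          using Cauchy_Schwarz_ineq2[of "h s - h y" "k1 y"] by linarith
        have "(w y (f t) + h s \<bullet> k1 y) - (w y (f y) + h y \<bullet> k1 y) = w y (f t - f y) + (h s - h y) \<bullet> k1 y"
          by (simp add: blinfun.diff_right inner_diff_left)
        then show "\<bar>w y (f t) + h s \<bullet> k1 y - (w y (f y) + h y \<bullet> k1 y)\<bar> \<le> e * (norm (w y) + C)"
          using a1 a2 by (simp add: distrib_left)
      qed
    qed
  qed
qed

text \<open>Almost everywhere convergence of simple functions becomes convergence in L^1 once they
  are cut off where they exceed twice the norm of the limit; \<open>3 * norm (w x)\<close> is then a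
  majorant.\<close>

lemma strongly_measurable_L1_approx:
  fixes w :: "real \<Rightarrow> 'v::real_normed_vector"
  assumes w: "strongly_measurable (lebesgue_on {a<..b}) w" "set_integrable lebesgue {a<..b} (\<lambda>t. norm (w t))"
    and e: "e > 0"
  obtains s where "simple_function (lebesgue_on {a<..b}) s" "set_integrable lebesgue {a<..b} (\<lambda>t. norm (w t - s t))"
    "(LINT t:{a<..b}|lebesgue. norm (w t - s t)) < e"
proof -
  let ?M = "lebesgue_on {a<..b}"
  obtain s where s: "\<And>i::nat. simple_function ?M (s i)" "AE x in ?M. (\<lambda>i. s i x) \<longlonglongrightarrow> w x"
    using w(1) unfolding strongly_measurable_def by blast
  define s' where "s' i x = (if norm (s i x) \<le> 2 * norm (w x) then s i x else 0)" for i x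
  have meas: "(\<lambda>x. norm (f x)) \<in> borel_measurable ?M" if "strongly_measurable ?M f" for f :: "real \<Rightarrow> 'v"
  proof -
    have "set_borel_measurable lebesgue {a<..b} (\<lambda>t. norm (f t))"
      by (intro strongly_measurable_imp_borel strongly_measurable_compose[OF that] continuous_intros) auto
    then show ?thesis
      by (subst borel_measurable_restrict_space_iff) (auto simp: set_borel_measurable_def)
  qed
  have simple_sm: "strongly_measurable ?M f" if "simple_function ?M f" for f :: "real \<Rightarrow> 'v"
    unfolding strongly_measurable_def using that by (intro exI[of _ "\<lambda>_. f"]) auto
  have s': "simple_function ?M (s' i)" for i
    unfolding s'_def[abs_def]
  proof (rule simple_function_If[OF s(1)])
    have "(\<lambda>x. norm (s i x)) \<in> borel_measurable ?M" "(\<lambda>x. norm (w x)) \<in> borel_measurable ?M"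
      using meas simple_sm[OF s(1)] w(1) by auto
    then show "{x \<in> space ?M. norm (s i x) \<le> 2 * norm (w x)} \<in> sets ?M"
      by measurable
  qed simp
  have sm: "strongly_measurable ?M (\<lambda>x. w x - s' i x)" for i
    by (rule strongly_measurable_compose2[OF w(1) simple_sm[OF s']]) (intro continuous_intros)
  have bd: "norm (w x - s' i x) \<le> 3 * norm (w x)" for i x
    using norm_triangle_ineq4[of "w x" "s i x"] by (auto simp: s'_def)
  have int: "set_integrable lebesgue {a<..b} (\<lambda>t. norm (w t - s' i t))" for i
  proof (rule set_integrable_dominated)
    show "set_borel_measurable lebesgue {a<..b} (\<lambda>t. norm (w t - s' i t))"
      by (intro strongly_measurable_imp_borel strongly_measurable_compose[OF sm] continuous_intros) auto
    show "set_integrable lebesgue {a<..b} (\<lambda>t. 3 * norm (w t))"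
      using w(2) by auto
    show "AE x\<in>{a<..b} in lebesgue. \<bar>norm (w x - s' i x)\<bar> \<le> 3 * norm (w x)"
      using bd by simp
  qed
  \<comment> \<open>Where \<open>w x\<close> is nonzero the cutoff is eventually inactive, and where
    it is zero the cutoff itself yields 0.\<close>
  have lim: "(\<lambda>i. s' i x) \<longlonglongrightarrow> w x" if x: "(\<lambda>i. s i x) \<longlonglongrightarrow> w x" for x
  proof (cases "w x = 0")
    case True
    then have "s' i x = 0" for i
      by (simp add: s'_def)
    then show ?thesis using True by simp
  next
    case False
    have "(\<lambda>i. norm (s i x)) \<longlonglongrightarrow> norm (w x)"
      by (intro tendsto_intros x)
    then have "eventually (\<lambda>i. norm (s i x) < 2 * norm (w x)) sequentially"
      by (rule order_tendstoD) (use False in simp)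
    then have "eventually (\<lambda>i. s i x = s' i x) sequentially"
      by eventually_elim (simp add: s'_def)
    with x show ?thesis
      by (rule Lim_transform_eventually)
  qed
  have "(\<lambda>i. LINT x|lebesgue. indicator {a<..b} x *\<^sub>R norm (w x - s' i x)) \<longlonglongrightarrow> (LINT x::real|lebesgue. (0::real))"
  proof (rule integral_dominated_convergence[where f = "\<lambda>_. 0" and w = "\<lambda>x. indicator {a<..b} x *\<^sub>R (3 * norm (w x))"])
    show "integrable lebesgue (\<lambda>x. indicator {a<..b} x *\<^sub>R (3 * norm (w x)))"
      using set_integrable_mult_right[of 3, OF w(2)] by (simp add: set_integrable_def)
    show "(\<lambda>x. indicator {a<..b} x *\<^sub>R norm (w x - s' i x)) \<in> borel_measurable lebesgue" for i
      using int[of i] by (auto simp: set_integrable_def intro: borel_measurable_integrable)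
    have "AE x\<in>{a<..b} in lebesgue. (\<lambda>i. s i x) \<longlonglongrightarrow> w x"
      using s(2) by (subst (asm) AE_restrict_space_iff) auto
    then show "AE x in lebesgue. (\<lambda>i. indicator {a<..b} x *\<^sub>R norm (w x - s' i x)) \<longlonglongrightarrow> 0"
    proof eventually_elim
      case (elim x)
      show ?case
      proof (cases "x \<in> {a<..b}")
        case True
        then have "(\<lambda>i. w x - s' i x) \<longlonglongrightarrow> w x - w x"
          using elim lim by (intro tendsto_intros) auto
        then show ?thesis using True by (simp add: tendsto_norm_zero)
      qed simp
    qed
    show "AE x in lebesgue. norm (indicator {a<..b} x *\<^sub>R norm (w x - s' i x)) \<le> indicator {a<..b} x *\<^sub>R (3 * norm (w x))" for i
      using bd by (auto split: split_indicator)
  qed simp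
  then have "eventually (\<lambda>i. (LINT x:{a<..b}|lebesgue. norm (w x - s' i x)) < e) sequentially"
    using e by (intro order_tendstoD(2)[of _ 0]) (auto simp: set_lebesgue_integral_def)
  then obtain i where "(LINT x:{a<..b}|lebesgue. norm (w x - s' i x)) < e"
    by (auto simp: eventually_sequentially)
  then show ?thesis
    using that[of "s' i"] s' int by blast
qed

text \<open>For a simple \<open>w\<close> the integral is a finite sum of integrals of fixed
  functionals over measurable sets, where convergence on intervals suffices. The uniform bound
  \<open>B\<close> makes the general case follow by approximating \<open>w\<close> in L^1.\<close>

lemma pairing_weak_convergence:
  fixes w :: "real \<Rightarrow> 'v::real_normed_vector \<Rightarrow>\<^sub>L real" and D :: "real \<Rightarrow> 'v" and Dn :: "nat \<Rightarrow> real \<Rightarrow> 'v"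
  assumes w: "strongly_measurable (lebesgue_on {a<..b}) w" "set_integrable lebesgue {a<..b} (\<lambda>t. norm (w t))"
    and D: "strongly_measurable (lebesgue_on {a<..b}) D" "AE t\<in>{a<..b} in lebesgue. norm (D t) \<le> B"
    and Dn: "\<And>n. strongly_measurable (lebesgue_on {a<..b}) (Dn n)" "\<And>n. AE t\<in>{a<..b} in lebesgue. norm (Dn n t) \<le> B"
    and conv: "\<And>(\<phi> :: 'v \<Rightarrow>\<^sub>L real) s t. a \<le> s \<Longrightarrow> s \<le> t \<Longrightarrow> t \<le> b \<Longrightarrow>
      (\<lambda>n. LINT x:{s<..t}|lebesgue. \<phi> (Dn n x)) \<longlonglongrightarrow> (LINT x:{s<..t}|lebesgue. \<phi> (D x))"
    and ab: "a \<le> b" and B: "B \<ge> 0"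
  shows "(\<lambda>n. LINT x:{a<..b}|lebesgue. w x (Dn n x)) \<longlonglongrightarrow> (LINT x:{a<..b}|lebesgue. w x (D x))"
proof -
  let ?I = "{a<..b}"
  let ?M = "lebesgue_on ?I"
  have sm: "strongly_measurable ?M (\<lambda>x. Dn n x - D x)" for n
    by (rule strongly_measurable_compose2[OF Dn(1) D(1)]) (intro continuous_intros)
  have bd: "AE t\<in>?I in lebesgue. norm (Dn n t - D t) \<le> 2 * B" for n
    using Dn(2)[of n] D(2)
  proof eventually_elim
    case (elim t)
    then show ?case using norm_triangle_ineq4[of "Dn n t" "D t"] by auto
  qed
  have \<phi>i: "set_integrable lebesgue ?I (\<lambda>x. \<phi> (f x))"
    if "strongly_measurable ?M f" "AE t\<in>?I in lebesgue. norm (f t) \<le> C" for \<phi> :: "'v \<Rightarrow>\<^sub>L real" and f C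
    by (rule set_integrable_blinfun_L1[OF that(1) set_integrable_norm_bounded[OF that]])
  have sets: "(\<lambda>n. LINT x:A|lebesgue. \<phi> (Dn n x - D x)) \<longlonglongrightarrow> 0"
    if A: "A \<in> sets lebesgue" "A \<subseteq> ?I" for A and \<phi> :: "'v \<Rightarrow>\<^sub>L real"
  proof -
    \<comment> \<open>Extension by zero, since the convergence lemma for measurable sets is
      formulated on the whole line.\<close>
    let ?g = "\<lambda>n x. indicator ?I x *\<^sub>R \<phi> (Dn n x - D x)"
    have gi: "set_integrable lebesgue ?I (\<lambda>x. \<phi> (Dn n x - D x))" for n
      by (rule \<phi>i[OF sm bd])
    have Ioc: "(\<lambda>n. LINT x:{s<..t}|lebesgue. \<phi> (Dn n x - D x)) \<longlonglongrightarrow> 0" if "a \<le> s" "s \<le> t" "t \<le> b" for s t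
    proof -
      have "(LINT x:{s<..t}|lebesgue. \<phi> (Dn n x - D x))
          = (LINT x:{s<..t}|lebesgue. \<phi> (Dn n x)) - (LINT x:{s<..t}|lebesgue. \<phi> (D x))" for n
        unfolding blinfun.diff_right
        using that by (intro set_integral_diff(2) set_integrable_Ioc_subset[OF \<phi>i[OF Dn]] set_integrable_Ioc_subset[OF \<phi>i[OF D]]) auto
      then show ?thesis
        using conv[OF that, of \<phi>] by (simp add: LIM_zero)
    qed
    have "(\<lambda>n. LINT x:A|lebesgue. ?g n x) \<longlonglongrightarrow> 0"
    proof (rule measurable_sets_integral_tendsto_0[OF _ _ _ _ _ A(1)])
      show "integrable lebesgue (\<lambda>x. indicator ?I x *\<^sub>R (norm \<phi> * (2 * B)))"
        using set_integrable_const_Ioc[of a b "norm \<phi> * (2 * B)"] by (simp only: set_integrable_def)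
      show "?g n \<in> borel_measurable lebesgue" for n
        using gi[of n] unfolding set_integrable_def by (rule borel_measurable_integrable)
      show "AE x in lebesgue. \<bar>?g n x\<bar> \<le> indicator ?I x *\<^sub>R (norm \<phi> * (2 * B))" for n
        using bd[of n]
      proof eventually_elim
        case (elim x)
        show ?case
        proof (cases "x \<in> ?I")
          case True
          then have "norm \<phi> * norm (Dn n x - D x) \<le> norm \<phi> * (2 * B)"
            using elim by (intro mult_left_mono) auto
          then show ?thesis
            using norm_blinfun[of \<phi> "Dn n x - D x"] True by simp
        qed simp
      qed
      show "(\<lambda>n. LINT x|lebesgue. ?g n x) \<longlonglongrightarrow> 0"
        using Ioc[of a b] ab by (simp add: set_lebesgue_integral_def)
      fix s t :: real
      have eq: "(LINT x:{s<..t}|lebesgue. ?g n x) = (LINT x:{max s a<..min t b}|lebesgue. \<phi> (Dn n x - D x))" for n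
        unfolding set_lebesgue_integral_def
        by (rule Bochner_Integration.integral_cong) (auto simp: indicator_def)
      show "(\<lambda>n. LINT x:{s<..t}|lebesgue. ?g n x) \<longlonglongrightarrow> 0"
      proof (cases "max s a \<le> min t b")
        case True
        then show ?thesis unfolding eq by (intro Ioc) auto
      next
        case False
        then have E: "{max s a<..min t b} = {}" by auto
        show ?thesis unfolding eq E by (simp add: set_lebesgue_integral_def)
      qed
    qed
    also have "(\<lambda>n. LINT x:A|lebesgue. ?g n x) = (\<lambda>n. LINT x:A|lebesgue. \<phi> (Dn n x - D x))"
      unfolding set_lebesgue_integral_def
      using A(2) by (intro ext Bochner_Integration.integral_cong) (auto simp: indicator_def)
    finally show ?thesis .
  qed
  have simple: "(\<lambda>n. LINT x:?I|lebesgue. s x (Dn n x - D x)) \<longlonglongrightarrow> 0" if s: "simple_function ?M s" for s :: "real \<Rightarrow> 'v \<Rightarrow>\<^sub>L real"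
  proof -
    \<comment> \<open>The level sets of the simple function, on each of which it is one fixed
      functional.\<close>
    let ?A = "\<lambda>\<phi>. s -` {\<phi>} \<inter> ?I"
    have fin: "finite (s ` ?I)" using simple_functionD(1)[OF s] by simp
    have A: "?A \<phi> \<in> sets lebesgue" for \<phi>
    proof -
      have "?A \<phi> \<in> sets ?M" using simple_functionD(2)[OF s, of "{\<phi>}"] by simp
      then show ?thesis by (subst (asm) sets_restrict_space_iff) auto
    qed
    have I: "?I = (\<Union>\<phi>\<in>s ` ?I. ?A \<phi>)" by auto
    have "(LINT x:?I|lebesgue. s x (Dn n x - D x)) = (\<Sum>\<phi>\<in>s ` ?I. LINT x:?A \<phi>|lebesgue. \<phi> (Dn n x - D x))" for n
    proof -
      have eq: "indicator (?A \<phi>) x *\<^sub>R s x (Dn n x - D x) = indicator (?A \<phi>) x *\<^sub>R \<phi> (Dn n x - D x)" for \<phi> x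
        by (auto simp: indicator_def)
      have "(LINT x:(\<Union>\<phi>\<in>s ` ?I. ?A \<phi>)|lebesgue. s x (Dn n x - D x)) = (\<Sum>\<phi>\<in>s ` ?I. LINT x:?A \<phi>|lebesgue. s x (Dn n x - D x))"
      proof (rule set_integral_finite_Union[OF fin])
        show "disjoint_family_on ?A (s ` ?I)" by (auto simp: disjoint_family_on_def)
        fix \<phi>
        show "?A \<phi> \<in> sets lebesgue" by (rule A)
        have "set_integrable lebesgue (?A \<phi>) (\<lambda>x. \<phi> (Dn n x - D x))"
          by (rule set_integrable_subset[OF \<phi>i[OF sm bd] A]) auto
        then show "set_integrable lebesgue (?A \<phi>) (\<lambda>x. s x (Dn n x - D x))"
          unfolding set_integrable_def eq .
      qed
      then show ?thesis
        unfolding I[symmetric] set_lebesgue_integral_def eq .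
    qed
    moreover have "(\<lambda>n. \<Sum>\<phi>\<in>s ` ?I. LINT x:?A \<phi>|lebesgue. \<phi> (Dn n x - D x)) \<longlonglongrightarrow> (\<Sum>\<phi>\<in>s ` ?I. 0)"
      by (intro tendsto_sum sets A) auto
    ultimately show ?thesis by simp
  qed
  have wi: "set_integrable lebesgue ?I (\<lambda>x. w x (Dn n x - D x))" for n
    by (rule set_integrable_pairing[OF w sm bd])
  have "(\<lambda>n. LINT x:?I|lebesgue. w x (Dn n x - D x)) \<longlonglongrightarrow> 0"
  proof (rule LIMSEQ_I)
    fix e :: real assume e: "e > 0"
    \<comment> \<open>The differences \<open>Dn n x - D x\<close> are bounded by
      \<open>2 * B\<close>, so this accuracy leaves an error of at most \<open>e / 2\<close>, also
      when \<open>B = 0\<close>.\<close>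
    then have "e / (4 * B + 2) > 0" using B by simp
    then obtain s where s: "simple_function ?M s" "set_integrable lebesgue ?I (\<lambda>t. norm (w t - s t))"
      "(LINT t:?I|lebesgue. norm (w t - s t)) < e / (4 * B + 2)"
      using strongly_measurable_L1_approx[OF w] by blast
    have ssm: "strongly_measurable ?M s"
      unfolding strongly_measurable_def using s(1) by (intro exI[of _ "\<lambda>_. s"]) auto
    have wsm: "strongly_measurable ?M (\<lambda>t. w t - s t)"
      by (rule strongly_measurable_compose2[OF w(1) ssm]) (intro continuous_intros)
    obtain N where N: "\<And>n. n \<ge> N \<Longrightarrow> \<bar>LINT x:?I|lebesgue. s x (Dn n x - D x)\<bar> < e / 2"
      using LIMSEQ_D[OF simple[OF s(1)], of "e / 2"] e by auto
    show "\<exists>N. \<forall>n\<ge>N. norm ((LINT x:?I|lebesgue. w x (Dn n x - D x)) - 0) < e"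
    proof (intro exI[of _ N] allI impI)
      fix n assume "n \<ge> N"
      have wsi: "set_integrable lebesgue ?I (\<lambda>x. (w x - s x) (Dn n x - D x))"
        by (rule set_integrable_pairing[OF wsm s(2) sm bd])
      have si: "set_integrable lebesgue ?I (\<lambda>x. s x (Dn n x - D x))"
        using set_integral_diff(1)[OF wi[of n] wsi] by (simp add: blinfun.diff_left)
      have "\<bar>LINT x:?I|lebesgue. (w x - s x) (Dn n x - D x)\<bar> \<le> (LINT x:?I|lebesgue. norm ((w x - s x) (Dn n x - D x)))"
        using set_integral_norm_bound[OF wsi] by simp
      also have "\<dots> \<le> (LINT x:?I|lebesgue. (2 * B) * norm (w x - s x))"
      proof (rule set_integral_mono_AE)
        show "AE x\<in>?I in lebesgue. norm ((w x - s x) (Dn n x - D x)) \<le> (2 * B) * norm (w x - s x)"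
          using bd[of n]
        proof eventually_elim
          case (elim x)
          show ?case
          proof
            assume "x \<in> ?I"
            then have "norm (w x - s x) * norm (Dn n x - D x) \<le> norm (w x - s x) * (2 * B)"
              using elim by (intro mult_left_mono) auto
            then show "norm ((w x - s x) (Dn n x - D x)) \<le> (2 * B) * norm (w x - s x)"
              using norm_blinfun[of "w x - s x" "Dn n x - D x"] by (simp add: mult.commute)
          qed
        qed
        show "set_integrable lebesgue ?I (\<lambda>x. norm ((w x - s x) (Dn n x - D x)))"
          by (rule set_integrable_norm[OF wsi])
        show "set_integrable lebesgue ?I (\<lambda>x. (2 * B) * norm (w x - s x))"
          by (intro set_integrable_mult_right s(2))
      qed
      also have "\<dots> = (2 * B) * (LINT x:?I|lebesgue. norm (w x - s x))"
        by (rule set_integral_mult_right)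
      also have "\<dots> \<le> (2 * B) * (e / (4 * B + 2))"
        using s(3) B by (intro mult_left_mono) auto
      also have "\<dots> \<le> e / 2"
        using B e by (simp add: divide_simps)
      finally have 1: "\<bar>LINT x:?I|lebesgue. (w x - s x) (Dn n x - D x)\<bar> \<le> e / 2" .
      have "(LINT x:?I|lebesgue. w x (Dn n x - D x)) = (LINT x:?I|lebesgue. (w x - s x) (Dn n x - D x) + s x (Dn n x - D x))"
        by (simp add: blinfun.diff_left)
      also have "\<dots> = (LINT x:?I|lebesgue. (w x - s x) (Dn n x - D x)) + (LINT x:?I|lebesgue. s x (Dn n x - D x))"
        by (rule set_integral_add(2)[OF wsi si])
      finally show "norm ((LINT x:?I|lebesgue. w x (Dn n x - D x)) - 0) < e"
        using 1 N[OF \<open>n \<ge> N\<close>] by simp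
    qed
  qed
  moreover have "(LINT x:?I|lebesgue. w x (Dn n x - D x)) = (LINT x:?I|lebesgue. w x (Dn n x)) - (LINT x:?I|lebesgue. w x (D x))" for n
    unfolding blinfun.diff_right
    by (intro set_integral_diff(2) set_integrable_pairing[OF w Dn] set_integrable_pairing[OF w D])
  ultimately show ?thesis
    by (simp add: LIM_zero_iff)
qed

section \<open>Symmetric difference quotients and the kinetic energy\<close>

lemma symmetric_difference_quotient:
  fixes f :: "real \<Rightarrow> 'a::real_normed_vector" and \<eta> :: "nat \<Rightarrow> real"
  assumes f: "(f has_vector_derivative f') (at t)" and \<eta>: "\<eta> \<longlonglongrightarrow> 0" "\<And>n. \<eta> n > 0"
  shows "(\<lambda>n. (1 / (2 * \<eta> n)) *\<^sub>R (f (t + \<eta> n) - f (t - \<eta> n))) \<longlonglongrightarrow> f'"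
proof (rule LIMSEQ_I)
  fix e :: real assume e: "e > 0"
  obtain d where d: "d > 0" "\<And>y. norm (y - t) < d \<Longrightarrow> norm (f y - f t - (y - t) *\<^sub>R f') \<le> e / 2 * norm (y - t)"
    using f e unfolding has_vector_derivative_def has_derivative_at_alt by (meson half_gt_zero)
  obtain N where N: "\<And>n. n \<ge> N \<Longrightarrow> \<eta> n < d"
    using LIMSEQ_D[OF \<eta>(1) d(1)] \<eta>(2) by (auto simp: abs_of_pos)
  show "\<exists>N. \<forall>n\<ge>N. norm ((1 / (2 * \<eta> n)) *\<^sub>R (f (t + \<eta> n) - f (t - \<eta> n)) - f') < e"
  proof (intro exI[of _ N] allI impI)
    fix n assume n: "n \<ge> N"
    define r where "r = \<eta> n"
    have r: "r > 0" "r < d" using \<eta>(2) N[OF n] by (auto simp: r_def)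
    let ?p = "f (t + r) - f t - r *\<^sub>R f'" and ?m = "f (t - r) - f t + r *\<^sub>R f'"
    have "norm ?p \<le> e / 2 * r" "norm ?m \<le> e / 2 * r"
      using d(2)[of "t + r"] d(2)[of "t - r"] r by auto
    then have pm: "norm (?p - ?m) \<le> e * r"
      using norm_triangle_ineq4[of ?p ?m] by linarith
    have pm_eq: "f (t + r) - f (t - r) - (2 * r) *\<^sub>R f' = ?p - ?m"
    proof -
      have "(2 * r) *\<^sub>R f' = r *\<^sub>R f' + r *\<^sub>R f'"
        unfolding scaleR_left_distrib[symmetric] by simp
      then show ?thesis by simp
    qed
    have "(1 / (2 * r)) *\<^sub>R (f (t + r) - f (t - r)) - f' = (1 / (2 * r)) *\<^sub>R (f (t + r) - f (t - r)) - (1 / (2 * r)) *\<^sub>R (2 * r) *\<^sub>R f'"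
      using r by simp
    also have "\<dots> = (1 / (2 * r)) *\<^sub>R (f (t + r) - f (t - r) - (2 * r) *\<^sub>R f')"
      by (rule scaleR_diff_right[symmetric])
    also note pm_eq
    finally have "norm ((1 / (2 * r)) *\<^sub>R (f (t + r) - f (t - r)) - f') = (1 / (2 * r)) * norm (?p - ?m)"
      using r by simp
    also have "\<dots> \<le> (1 / (2 * r)) * (e * r)"
      using pm r by (intro mult_left_mono) auto
    also have "\<dots> < e" using r e by simp
    finally show "norm ((1 / (2 * \<eta> n)) *\<^sub>R (f (t + \<eta> n) - f (t - \<eta> n)) - f') < e"
      by (simp only: r_def)
  qed
qed

lemma integral_has_real_derivative_interior:
  fixes c :: "real \<Rightarrow> real"
  assumes "continuous_on {a..b} c" "a < x" "x < b"
  shows "((\<lambda>x. integral {a..x} c) has_real_derivative c x) (at x)"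
  using integral_has_real_derivative[OF assms(1), of x] assms(2,3) at_within_Icc_at[OF assms(2,3)] by simp

text \<open>Integrating the quotient of \<psi> gives the quotient of its primitive at the two end
  points, and these are averages of \<psi> over shrinking neighbourhoods of \<open>t\<close> and
  \<open>s\<close>.\<close>

lemma integral_symmetric_difference:
  fixes \<psi> :: "real \<Rightarrow> real" and \<eta> :: "nat \<Rightarrow> real"
  assumes \<psi>: "continuous_on {0..T} \<psi>" and \<eta>: "\<eta> \<longlonglongrightarrow> 0" "\<And>n. \<eta> n > 0"
    and st: "s \<le> t" "\<And>n. 0 < s - \<eta> n" "\<And>n. t + \<eta> n < T"
  shows "(\<lambda>n. LINT r:{s<..t}|lebesgue. (1 / (2 * \<eta> n)) * (\<psi> (r + \<eta> n) - \<psi> (r - \<eta> n))) \<longlonglongrightarrow> \<psi> t - \<psi> s"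
proof -
  define \<Psi> where "\<Psi> x = integral {0..x} \<psi>" for x
  have \<Psi>: "(\<Psi> has_real_derivative \<psi> x) (at x)" if "0 < x" "x < T" for x
    unfolding \<Psi>_def[abs_def] by (rule integral_has_real_derivative_interior[OF \<psi> that])
  have eq: "(LINT r:{s<..t}|lebesgue. (1 / (2 * \<eta> n)) * (\<psi> (r + \<eta> n) - \<psi> (r - \<eta> n)))
      = (1 / (2 * \<eta> n)) * (\<Psi> (t + \<eta> n) - \<Psi> (t - \<eta> n)) - (1 / (2 * \<eta> n)) * (\<Psi> (s + \<eta> n) - \<Psi> (s - \<eta> n))" for n
  proof -
    note n = \<eta>(2)[of n] st(2)[of n] st(3)[of n]
    have "ac_deriv s t (\<lambda>r. (1 / (2 * \<eta> n)) * (\<Psi> (r + \<eta> n) - \<Psi> (r - \<eta> n))) (\<lambda>r. (1 / (2 * \<eta> n)) * (\<psi> (r + \<eta> n) - \<psi> (r - \<eta> n)))"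
    proof (rule ac_deriv_C1)
      fix x assume x: "s \<le> x" "x \<le> t"
      have 1: "((\<lambda>r. \<Psi> (r + \<eta> n)) has_real_derivative \<psi> (x + \<eta> n)) (at x)"
        using \<Psi>[of "x + \<eta> n"] x n DERIV_shift[of \<Psi> _ x "\<eta> n"] by auto
      have 2: "((\<lambda>r. \<Psi> (r - \<eta> n)) has_real_derivative \<psi> (x - \<eta> n)) (at x)"
        using \<Psi>[of "x - \<eta> n"] x n DERIV_shift[of \<Psi> _ x "- \<eta> n"] by auto
      show "((\<lambda>r. (1 / (2 * \<eta> n)) * (\<Psi> (r + \<eta> n) - \<Psi> (r - \<eta> n))) has_real_derivative
          (1 / (2 * \<eta> n)) * (\<psi> (x + \<eta> n) - \<psi> (x - \<eta> n))) (at x within {s..t})"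
        by (intro DERIV_cmult DERIV_diff DERIV_subset[OF 1] DERIV_subset[OF 2]) auto
    next
      show "continuous_on {s..t} (\<lambda>r. (1 / (2 * \<eta> n)) * (\<psi> (r + \<eta> n) - \<psi> (r - \<eta> n)))"
        by (intro continuous_intros continuous_on_compose2[OF \<psi>]) (use n in auto)
    qed
    from ac_derivD(2)[OF this, of s t] show ?thesis using st(1) by simp
  qed
  have "(\<lambda>n. (1 / (2 * \<eta> n)) *\<^sub>R (\<Psi> (x + \<eta> n) - \<Psi> (x - \<eta> n))) \<longlonglongrightarrow> \<psi> x" if "s \<le> x" "x \<le> t" for x
    using \<Psi>[of x] that st(2,3)[of 0] \<eta>(2)[of 0]
    by (intro symmetric_difference_quotient \<eta>) (auto simp: has_real_derivative_iff_has_vector_derivative[symmetric])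
  from tendsto_diff[OF this[of t] this[of s]] show ?thesis
    unfolding eq using st(1) by simp
qed

text \<open>
  The velocity is only \<open>H\<close>-valued, so the product rule does not apply to \<open>(h, h)\<close> directly.
  It is applied to \<open>(h, k\<^sub>\<eta>)\<close>, where \<open>k\<^sub>\<eta>\<close> is the symmetric difference quotient of \<open>\<iota> u\<close>;
  a shift of the integration variable turns \<open>\<integral>(h, k\<^sub>\<eta>')\<close> into averages of \<open>(h, h)\<close> near the end
  points, which contribute one half of the increment.
\<close>

lemma kinetic_energy_deriv:
  fixes u u1 :: "real \<Rightarrow> 'v::real_inner" and w2 :: "real \<Rightarrow> 'v \<Rightarrow>\<^sub>L real"
    and \<iota> :: "'v \<Rightarrow>\<^sub>L 'h::real_inner"
  assumes T: "T > 0" and u: "continuous_on {0..T} u"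
    and prim: "\<And>\<phi> :: 'v \<Rightarrow>\<^sub>L real. ac_deriv 0 T (\<lambda>t. \<phi> (u t)) (\<lambda>t. \<phi> (u1 t))"
    and u1: "strongly_measurable (lebesgue_on {0<..T}) u1" "AE t\<in>{0<..T} in lebesgue. norm (u1 t) \<le> B" "B \<ge> 0"
    and w2: "strongly_measurable (lebesgue_on {0<..T}) w2" "set_integrable lebesgue {0<..T} (\<lambda>t. norm (w2 t))"
    and h: "continuous_on {0..T} h" "\<And>v. ac_deriv 0 T (\<lambda>t. \<iota> v \<bullet> h t) (\<lambda>t. w2 t v)"
    and k: "\<And>e. ac_deriv 0 T (\<lambda>t. e \<bullet> \<iota> (u t)) (\<lambda>t. e \<bullet> h t)"
  shows "ac_deriv 0 T (\<lambda>t. (h t \<bullet> h t) / 2) (\<lambda>t. w2 t (u1 t))"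
proof -
  have wi: "set_integrable lebesgue {0<..T} (\<lambda>t. w2 t (u1 t))"
    by (rule set_integrable_pairing[OF w2 u1(1,2)])
  have kd: "((\<lambda>t. \<iota> (u t)) has_vector_derivative h t) (at t)" if "0 < t" "t < T" for t
    by (rule velocity_has_vector_derivative[OF h(1) k that])
  \<comment> \<open>The increment is tested against itself in the inner product of V. The Lipschitz
    bound keeps the difference quotients of \<open>u\<close> bounded by \<open>B\<close>, as the
    weak convergence lemma requires.\<close>
  have lip: "norm (u y - u x) \<le> B * (y - x)" if xy: "0 \<le> x" "x \<le> y" "y \<le> T" for x y
  proof -
    define e where "e = u y - u x"
    let ?\<phi> = "blinfun_inner_right e"
    have i: "set_integrable lebesgue {x<..y} (\<lambda>t. e \<bullet> u1 t)"
      using set_integrable_Ioc_subset[OF ac_derivD(1)[OF prim[of ?\<phi>]], of x y] xy by simp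
    have "e \<bullet> e = e \<bullet> u y - e \<bullet> u x"
      by (subst (2) e_def) (rule inner_diff_right)
    also have "\<dots> = (LINT t:{x<..y}|lebesgue. e \<bullet> u1 t)"
      using ac_derivD(2)[OF prim[of ?\<phi>], of x y] xy by simp
    also have "\<dots> \<le> (LINT t:{x<..y}|lebesgue. norm e * B)"
    proof (rule set_integral_mono_AE[OF i set_integrable_const_Ioc])
      show "AE t\<in>{x<..y} in lebesgue. e \<bullet> u1 t \<le> norm e * B"
        using u1(2)
      proof eventually_elim
        case (elim t)
        show ?case
        proof
          assume "t \<in> {x<..y}"
          then have "norm e * norm (u1 t) \<le> norm e * B"
            using elim xy by (intro mult_left_mono) auto
          then show "e \<bullet> u1 t \<le> norm e * B"
            using norm_cauchy_schwarz[of e "u1 t"] by linarith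
        qed
      qed
    qed
    also have "\<dots> = norm e * (B * (y - x))"
      using xy by (simp add: set_lebesgue_integral_def)
    finally have "norm e * norm e \<le> norm e * (B * (y - x))"
      by (simp only: dot_square_norm power2_eq_square)
    then show ?thesis
      using u1(3) xy by (cases "e = 0") (auto simp: e_def)
  qed
  have interior: "h t \<bullet> h t - h s \<bullet> h s = 2 * (LINT r:{s<..t}|lebesgue. w2 r (u1 r))" if st: "0 < s" "s \<le> t" "t < T" for s t
  proof -
    \<comment> \<open>The shifts tend to 0 and are small enough for \<open>s - \<eta> n\<close> and
      \<open>t + \<eta> n\<close> to stay inside the open time interval.\<close>
    define \<eta> where "\<eta> n = (min s (T - t) / 2) * inverse (real (Suc n))" for n
    have \<eta>0: "\<eta> \<longlonglongrightarrow> 0"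
      unfolding \<eta>_def by (rule tendsto_eq_intros LIMSEQ_inverse_real_of_nat refl)+ simp
    have \<eta>p: "\<eta> n > 0" for n
      using st by (simp add: \<eta>_def)
    have \<eta>le: "\<eta> n \<le> min s (T - t) / 2" for n
      using st unfolding \<eta>_def by (intro mult_left_le) (auto simp: inverse_le_1_iff)
    have \<eta>s: "0 < s - \<eta> n" and \<eta>t: "t + \<eta> n < T" for n
      using \<eta>le[of n] \<eta>p[of n] st by auto
    define f where "f n r = (1 / (2 * \<eta> n)) *\<^sub>R (u (r + \<eta> n) - u (r - \<eta> n))" for n r
    define k1 where "k1 n r = (1 / (2 * \<eta> n)) *\<^sub>R (h (r + \<eta> n) - h (r - \<eta> n))" for n r
    have shift: "continuous_on {s..t} (\<lambda>r. F (r + \<eta> n))" "continuous_on {s..t} (\<lambda>r. F (r - \<eta> n))"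
      if "continuous_on {0..T} F" for F :: "real \<Rightarrow> 'a::topological_space" and n
      using \<eta>s[of n] \<eta>t[of n] \<eta>p[of n]
      by (auto intro!: continuous_on_compose2[OF that] continuous_intros)
    have fc: "continuous_on {s..t} (f n)" for n
      unfolding f_def[abs_def] by (intro continuous_intros shift u)
    have k1c: "continuous_on {s..t} (k1 n)" for n
      unfolding k1_def[abs_def] by (intro continuous_intros shift h)
    have hc: "continuous_on {s..t} h"
      by (rule continuous_on_subset[OF h(1)]) (use st in auto)
    have sub: "{s<..t} \<subseteq> {0<..T}" using st by auto
    have sm: "strongly_measurable (lebesgue_on {s<..t}) F" if "strongly_measurable (lebesgue_on {0<..T}) F" for F :: "real \<Rightarrow> 'a::real_normed_vector"
      by (rule strongly_measurable_subset[OF that sub]) auto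
    have w2n: "set_integrable lebesgue {s<..t} (\<lambda>t. norm (w2 t))"
      by (rule set_integrable_Ioc_subset[OF w2(2)]) (use st in auto)
    have pr: "h t \<bullet> \<iota> (f n t) - h s \<bullet> \<iota> (f n s)
        = (LINT r:{s<..t}|lebesgue. w2 r (f n r)) + (LINT r:{s<..t}|lebesgue. h r \<bullet> k1 n r)" for n
    proof -
      have "ac_deriv s t (\<lambda>t. h t \<bullet> \<iota> (f n t)) (\<lambda>t. w2 t (f n t) + h t \<bullet> k1 n t)"
      proof (rule ac_deriv_pairing[OF sm[OF w2(1)] w2n hc _ fc k1c])
        show "ac_deriv s t (\<lambda>t. \<iota> v \<bullet> h t) (\<lambda>t. w2 t v)" for v
          by (rule ac_deriv_subinterval[OF h(2)]) (use st in auto)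
        fix e
        show "ac_deriv s t (\<lambda>t. e \<bullet> \<iota> (f n t)) (\<lambda>t. e \<bullet> k1 n t)"
        proof (rule ac_deriv_C1)
          show "continuous_on {s..t} (\<lambda>t. e \<bullet> k1 n t)"
            by (intro continuous_intros k1c)
          fix x assume x: "s \<le> x" "x \<le> t"
          have d: "((\<lambda>t. e \<bullet> \<iota> (u t)) has_real_derivative e \<bullet> h y) (at y)" if "0 < y" "y < T" for y
            using bounded_linear.has_vector_derivative[OF bounded_linear_inner_right kd[OF that], of e]
            by (simp add: has_real_derivative_iff_has_vector_derivative)
          have 1: "((\<lambda>r. e \<bullet> \<iota> (u (r + \<eta> n))) has_real_derivative e \<bullet> h (x + \<eta> n)) (at x)"
            using d[of "x + \<eta> n"] x \<eta>s[of n] \<eta>t[of n] \<eta>p[of n] DERIV_shift[of "\<lambda>t. e \<bullet> \<iota> (u t)" _ x "\<eta> n"] by auto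
          have 2: "((\<lambda>r. e \<bullet> \<iota> (u (r - \<eta> n))) has_real_derivative e \<bullet> h (x - \<eta> n)) (at x)"
            using d[of "x - \<eta> n"] x \<eta>s[of n] \<eta>t[of n] \<eta>p[of n] DERIV_shift[of "\<lambda>t. e \<bullet> \<iota> (u t)" _ x "- \<eta> n"] by auto
          have "((\<lambda>r. (1 / (2 * \<eta> n)) * (e \<bullet> \<iota> (u (r + \<eta> n)) - e \<bullet> \<iota> (u (r - \<eta> n)))) has_real_derivative
              (1 / (2 * \<eta> n)) * (e \<bullet> h (x + \<eta> n) - e \<bullet> h (x - \<eta> n))) (at x within {s..t})"
            by (intro DERIV_cmult DERIV_diff DERIV_subset[OF 1] DERIV_subset[OF 2]) auto
          then show "((\<lambda>t. e \<bullet> \<iota> (f n t)) has_real_derivative e \<bullet> k1 n x) (at x within {s..t})"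
            by (simp add: f_def k1_def blinfun.scaleR_right blinfun.diff_right inner_diff_right)
        qed
      qed
      note ac = this
      obtain C where C: "C \<ge> 0" "\<And>r. r \<in> {s..t} \<Longrightarrow> norm (f n r) \<le> C"
        using continuous_bounded_Icc[OF fc] by blast
      have "set_integrable lebesgue {s<..t} (\<lambda>r. w2 r (f n r))"
        by (rule set_integrable_pairing[OF sm[OF w2(1)] w2n continuous_imp_strongly_measurable[OF fc], where B = C]) (use C in auto)
      moreover have "set_integrable lebesgue {s<..t} (\<lambda>r. h r \<bullet> k1 n r)"
        by (intro set_integrable_Ioc_continuous continuous_intros hc k1c)
      ultimately show ?thesis
        using ac_derivD(2)[OF ac, of s t] st by simp
    qed
    have L1: "(\<lambda>n. h x \<bullet> \<iota> (f n x)) \<longlonglongrightarrow> h x \<bullet> h x" if "s \<le> x" "x \<le> t" for x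
      using symmetric_difference_quotient[OF kd[of x] \<eta>0 \<eta>p] that st
      by (intro tendsto_inner tendsto_const) (simp add: f_def blinfun.scaleR_right blinfun.diff_right)
    \<comment> \<open>The convergence of \<open>f n\<close> to \<open>u1\<close> is checked on
      integrals of fixed functionals over intervals, where it reduces to averages of the continuous
      function \<open>\<phi> (u t)\<close>.\<close>
    have L2: "(\<lambda>n. LINT r:{s<..t}|lebesgue. w2 r (f n r)) \<longlonglongrightarrow> (LINT r:{s<..t}|lebesgue. w2 r (u1 r))"
    proof (rule pairing_weak_convergence[OF sm[OF w2(1)] w2n sm[OF u1(1)] _ _ _ _ st(2) u1(3)])
      show "AE t'\<in>{s<..t} in lebesgue. norm (u1 t') \<le> B"
        using u1(2) by eventually_elim (use st in auto)
      show "strongly_measurable (lebesgue_on {s<..t}) (f n)" for n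
        by (rule continuous_imp_strongly_measurable[OF fc])
      show "AE r\<in>{s<..t} in lebesgue. norm (f n r) \<le> B" for n
      proof (intro always_eventually allI impI)
        fix r assume r: "r \<in> {s<..t}"
        have "norm (u (r + \<eta> n) - u (r - \<eta> n)) \<le> B * ((r + \<eta> n) - (r - \<eta> n))"
          by (rule lip) (use r \<eta>s[of n] \<eta>t[of n] \<eta>p[of n] in auto)
        then have "(1 / (2 * \<eta> n)) * norm (u (r + \<eta> n) - u (r - \<eta> n)) \<le> (1 / (2 * \<eta> n)) * (B * (2 * \<eta> n))"
          using \<eta>p[of n] by (intro mult_left_mono) auto
        then show "norm (f n r) \<le> B"
          using \<eta>p[of n] by (simp add: f_def)
      qed
      fix \<phi> :: "'v \<Rightarrow>\<^sub>L real" and s' t' assume *: "s \<le> s'" "s' \<le> t'" "t' \<le> t"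
      have "continuous_on {0..T} (\<lambda>t. \<phi> (u t))"
        by (intro continuous_intros u)
      then have "(\<lambda>n. LINT r:{s'<..t'}|lebesgue. (1 / (2 * \<eta> n)) * (\<phi> (u (r + \<eta> n)) - \<phi> (u (r - \<eta> n)))) \<longlonglongrightarrow> \<phi> (u t') - \<phi> (u s')"
        by (rule integral_symmetric_difference[OF _ \<eta>0 \<eta>p *(2)])
          (meson * \<eta>s \<eta>t add_mono diff_mono le_less_trans less_le_trans order_refl)+
      moreover have "\<phi> (u t') - \<phi> (u s') = (LINT x:{s'<..t'}|lebesgue. \<phi> (u1 x))"
        using ac_derivD(2)[OF prim[of \<phi>], of s' t'] * st by simp
      ultimately show "(\<lambda>n. LINT x:{s'<..t'}|lebesgue. \<phi> (f n x)) \<longlonglongrightarrow> (LINT x:{s'<..t'}|lebesgue. \<phi> (u1 x))"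
        by (simp add: f_def blinfun.scaleR_right blinfun.diff_right)
    qed
    have L3: "(\<lambda>n. LINT r:{s<..t}|lebesgue. h r \<bullet> k1 n r) \<longlonglongrightarrow> (h t \<bullet> h t) / 2 - (h s \<bullet> h s) / 2"
    proof -
      \<comment> \<open>By symmetry of the inner product, \<open>h r \<bullet> k1 n r\<close> is
        \<open>c n r - c n (r - \<eta> n)\<close> divided by \<open>2 * \<eta> n\<close>. Its
        integral therefore telescopes to averages of \<open>c n\<close> near \<open>t\<close> and
        \<open>s\<close>.\<close>
      define c where "c n r = h r \<bullet> h (r + \<eta> n)" for n r
      define C where "C n x = integral {0..x} (c n)" for n x
      have cc: "continuous_on {0..T - \<eta> n} (c n)" for n
        unfolding c_def[abs_def] using \<eta>p[of n]
        by (intro continuous_intros continuous_on_compose2[OF h(1)] continuous_on_subset[OF h(1)]) auto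
      have Cd: "(C n has_real_derivative c n x) (at x)" if "0 < x" "x < T - \<eta> n" for n x
        unfolding C_def[abs_def] by (rule integral_has_real_derivative_interior[OF cc that])
      have eq: "(LINT r:{s<..t}|lebesgue. h r \<bullet> k1 n r)
          = (1 / 2) * ((C n t - C n (t - \<eta> n)) / \<eta> n) - (1 / 2) * ((C n s - C n (s - \<eta> n)) / \<eta> n)" for n
      proof -
        note n = \<eta>s[of n] \<eta>t[of n] \<eta>p[of n]
        have "ac_deriv s t (\<lambda>r. (1 / (2 * \<eta> n)) * (C n r - C n (r - \<eta> n))) (\<lambda>r. h r \<bullet> k1 n r)"
        proof (rule ac_deriv_C1)
          show "continuous_on {s..t} (\<lambda>r. h r \<bullet> k1 n r)"
            by (intro continuous_intros hc k1c)
          fix x assume x: "s \<le> x" "x \<le> t"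
          have 1: "(C n has_real_derivative c n x) (at x)"
            by (rule Cd) (use x n st in auto)
          have 2: "((\<lambda>r. C n (r - \<eta> n)) has_real_derivative c n (x - \<eta> n)) (at x)"
            using Cd[of "x - \<eta> n" n] x n DERIV_shift[of "C n" _ x "- \<eta> n"] by auto
          have "((\<lambda>r. (1 / (2 * \<eta> n)) * (C n r - C n (r - \<eta> n))) has_real_derivative
              (1 / (2 * \<eta> n)) * (c n x - c n (x - \<eta> n))) (at x within {s..t})"
            by (intro DERIV_cmult DERIV_diff DERIV_subset[OF 1] DERIV_subset[OF 2]) auto
          moreover have "(1 / (2 * \<eta> n)) * (c n x - c n (x - \<eta> n)) = h x \<bullet> k1 n x"
            by (simp add: c_def k1_def inner_diff_right inner_commute)
          ultimately show "((\<lambda>r. (1 / (2 * \<eta> n)) * (C n r - C n (r - \<eta> n))) has_real_derivative h x \<bullet> k1 n x) (at x within {s..t})"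
            by simp
        qed
        from ac_derivD(2)[OF this, of s t] show ?thesis
          using st n by (simp add: field_simps)
      qed
      have lim: "(\<lambda>n. (C n x - C n (x - \<eta> n)) / \<eta> n) \<longlonglongrightarrow> h x \<bullet> h x" if x: "s \<le> x" "x \<le> t" for x
      proof -
        \<comment> \<open>The average of \<open>c n\<close> over an interval of length
          \<open>\<eta> n\<close> is a value of \<open>c n\<close> at an intermediate point.\<close>
        have "\<exists>\<xi>. x - \<eta> n < \<xi> \<and> \<xi> < x \<and> (C n x - C n (x - \<eta> n)) / \<eta> n = c n \<xi>" for n
        proof -
          note n = \<eta>s[of n] \<eta>t[of n] \<eta>p[of n]
          have "\<exists>\<xi>. x - \<eta> n < \<xi> \<and> \<xi> < x \<and> C n x - C n (x - \<eta> n) = (x - (x - \<eta> n)) * c n \<xi>"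
            by (rule MVT2) (use n x in \<open>auto intro!: Cd\<close>)
          then show ?thesis using n by auto
        qed
        then obtain \<xi> where \<xi>: "\<And>n. x - \<eta> n < \<xi> n" "\<And>n. \<xi> n < x" "\<And>n. (C n x - C n (x - \<eta> n)) / \<eta> n = c n (\<xi> n)"
          by metis
        have "\<xi> \<longlonglongrightarrow> x"
        proof (rule tendsto_sandwich[OF always_eventually always_eventually _ tendsto_const])
          show "(\<lambda>n. x - \<eta> n) \<longlonglongrightarrow> x"
            using tendsto_diff[OF tendsto_const \<eta>0, of x] by simp
        qed (use \<xi> in \<open>auto intro: less_imp_le\<close>)
        moreover have "(\<lambda>n. \<xi> n + \<eta> n) \<longlonglongrightarrow> x"
          using tendsto_add[OF \<open>\<xi> \<longlonglongrightarrow> x\<close> \<eta>0] by simp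
        moreover have hx: "isCont h x"
          using h(1) x st by (intro continuous_on_interior[of "{0..T}" h]) auto
        ultimately have "(\<lambda>n. h (\<xi> n) \<bullet> h (\<xi> n + \<eta> n)) \<longlonglongrightarrow> h x \<bullet> h x"
          by (intro tendsto_inner isCont_tendsto_compose[OF hx])
        then show ?thesis unfolding \<xi>(3) c_def .
      qed
      have "(\<lambda>n. (1 / 2) * ((C n t - C n (t - \<eta> n)) / \<eta> n) - (1 / 2) * ((C n s - C n (s - \<eta> n)) / \<eta> n))
          \<longlonglongrightarrow> (1 / 2) * (h t \<bullet> h t) - (1 / 2) * (h s \<bullet> h s)"
        by (intro tendsto_intros lim) (use st in auto)
      then show ?thesis unfolding eq by simp
    qed
    have "(\<lambda>n. h t \<bullet> \<iota> (f n t) - h s \<bullet> \<iota> (f n s)) \<longlonglongrightarrow> h t \<bullet> h t - h s \<bullet> h s"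
      by (intro tendsto_diff L1) (use st in auto)
    moreover have "(\<lambda>n. h t \<bullet> \<iota> (f n t) - h s \<bullet> \<iota> (f n s))
        \<longlonglongrightarrow> (LINT r:{s<..t}|lebesgue. w2 r (u1 r)) + ((h t \<bullet> h t) / 2 - (h s \<bullet> h s) / 2)"
      unfolding pr by (intro tendsto_add L2 L3)
    \<comment> \<open>Half of the increment on the left reappears on the right; solving for it
      produces the factor 2 and hence the derivative of one half of the squared norm.\<close>
    ultimately have "h t \<bullet> h t - h s \<bullet> h s = (LINT r:{s<..t}|lebesgue. w2 r (u1 r)) + ((h t \<bullet> h t) / 2 - (h s \<bullet> h s) / 2)"
      by (rule LIMSEQ_unique)
    then show ?thesis by (simp add: field_simps)
  qed
  define L where "L t = (LINT r:{0<..t}|lebesgue. w2 r (u1 r))" for t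
  have L: "ac_deriv 0 T L (\<lambda>t. w2 t (u1 t))"
    unfolding L_def by (rule ac_deriv_integral[OF wi])
  define R where "R t = (h t \<bullet> h t) / 2 - L t" for t
  have Rc: "continuous_on {0..T} R"
    unfolding R_def[abs_def] by (intro continuous_intros h ac_deriv_continuous[OF L]) simp
  have Req: "R s = R t" if "0 < s" "s \<le> t" "t < T" for s t
    using interior[OF that] ac_derivD(2)[OF L, of s t] that by (simp add: R_def)
  \<comment> \<open>The identity holds so far only for times in the open interval; continuity
    carries it to 0 and \<open>T\<close>.\<close>
  have Rconst: "R x = R (T/2)" if "x \<in> {0..T}" for x
  proof (rule continuous_constant_on_closure[of "{0<..<T}" R "R (T/2)" x])
    show "continuous_on (closure {0<..<T}) R" using Rc T by simp
    show "x \<in> closure {0<..<T}" using that T by simp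
    fix y assume y: "y \<in> {0<..<T}"
    show "R y = R (T/2)"
    proof (cases "y \<le> T/2")
      case True
      then show ?thesis using y T by (intro Req) auto
    next
      case False
      then show ?thesis using y T by (intro Req[symmetric]) auto
    qed
  qed
  have "ac_deriv 0 T (\<lambda>t. R (T/2) + L t) (\<lambda>t. w2 t (u1 t))"
    using ac_deriv_add[OF ac_deriv_const[of 0 T "R (T/2)"] L] by simp
  then show ?thesis
  proof (rule ac_deriv_cong[OF _ _ _ wi])
    fix t assume "0 \<le> t" "t \<le> T"
    then have "R t = R (T/2)" by (intro Rconst) auto
    then show "R (T/2) + L t = (h t \<bullet> h t) / 2" by (simp add: R_def)
  qed simp
qed

section \<open>The Lyapunov inequality\<close>

text \<open>A form of Young's inequality with explicit constant. Either \<open>X\<close> is at most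
  \<open>d * y powr (s - r)\<close> and the first term suffices, or \<open>y\<close> is bounded by a
  power of \<open>X / d\<close> and the second one does.\<close>

lemma powr_interpolate:
  fixes X d y r s :: real
  assumes "X > 0" "d > 0" "y \<ge> 0" "r > 0" "s > r"
  shows "X * y powr r \<le> d * y powr s + X * (X / d) powr (r / (s - r))"
proof (cases "X \<le> d * y powr (s - r)")
  case True
  have "X * y powr r \<le> d * y powr (s - r) * y powr r"
    using True by (intro mult_right_mono) auto
  also have "\<dots> = d * y powr s"
    by (simp add: mult.assoc flip: powr_add)
  also have "\<dots> \<le> d * y powr s + X * (X / d) powr (r / (s - r))"
    using assms by simp
  finally show ?thesis .
next
  case False
  have "y powr r = (y powr (s - r)) powr (r / (s - r))"
    using assms by (simp add: powr_powr)
  also have "\<dots> \<le> (X / d) powr (r / (s - r))"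
    using False assms by (intro powr_mono2) (auto simp: field_simps)
  finally have "X * y powr r \<le> X * (X / d) powr (r / (s - r))"
    using assms by (intro mult_left_mono) auto
  then show ?thesis using assms by (simp add: add_increasing)
qed

text \<open>The pointwise core of the estimate, free of function spaces: \<open>y\<close> is the
  norm of u' in X, \<open>a\<close> and \<open>b\<close> are the derivatives of E and P, and
  \<open>k\<close> is 1/(\<beta>+2). Since \<open>E \<ge> 1\<close>, every power of \<open>E\<close>
  with exponent at most 1 + \<gamma> is bounded by the good term.\<close>

lemma lyapunov_inequality:
  fixes \<alpha> \<gamma> k d2 d3 C3 A p :: real
  assumes \<alpha>: "\<alpha> > 0" and \<gamma>: "\<gamma> > 0" "2 * \<gamma> \<le> \<alpha>" and k: "0 < k" "k < 1" "(\<gamma> + k) * (\<alpha> + 2) \<le> 1 + \<gamma>"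
    and pos: "d2 > 0" "d3 > 0" "C3 \<ge> 0" "A > 0" "p \<ge> 0"
  obtains e c C where "e > 0" "c > 0" "C \<ge> 0"
    "\<And>E P. E \<ge> 1 \<Longrightarrow> \<bar>P\<bar> \<le> p * E powr (1 - \<gamma>) \<Longrightarrow> \<bar>e * E powr \<gamma> * P\<bar> \<le> E / 2"
    "\<And>E P y a b. E \<ge> 1 \<Longrightarrow> \<bar>P\<bar> \<le> p * E powr (1 - \<gamma>) \<Longrightarrow> y \<ge> 0 \<Longrightarrow>
      a \<le> - d3 * y powr (\<alpha> + 2) + C3 \<Longrightarrow>
      b \<le> - d2 * E + A * (1 + y\<^sup>2 + y powr (\<alpha> + 1) * E powr k + E powr k) \<Longrightarrow>
      (1 + e * \<gamma> * E powr (\<gamma> - 1) * P) * a + e * E powr \<gamma> * b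
        \<le> - c * (E + e * E powr \<gamma> * P) powr (1 + \<gamma>) + C"
proof -
  \<comment> \<open>Young's inequality is applied twice with weight \<open>d\<close>; together this
    uses \<open>d3 / 4\<close>, half of the dissipation \<open>d3 / 2\<close> left after
    multiplication by a factor of at least 1/2.\<close>
  define d where "d = d3 / 8"
  have d: "d > 0" using pos by (simp add: d_def)
  \<comment> \<open>The first bound makes the perturbation at most \<open>E / 2\<close>, the second
    keeps the factor of \<open>a\<close> between 1/2 and 3/2, and the last two make each Young
    remainder at most \<open>e * (d2 / 8)\<close> times the good power of \<open>E\<close>.\<close>
  define e where "e = min (min (1 / (2 * (p + 1))) (1 / (2 * (\<gamma> * p + 1))))
    (min (d / A * (d2 / (8 * A)) powr (\<alpha> / 2)) (d / A * (d2 / (8 * A)) powr (1 / (\<alpha> + 1))))"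
  have \<gamma>p: "\<gamma> * p \<ge> 0" using \<gamma> pos by simp
  have e: "e > 0"
    using pos d \<gamma>p by (auto simp: e_def add_nonneg_pos)
  have "e \<le> 1 / (2 * (p + 1))" "e \<le> 1 / (2 * (\<gamma> * p + 1))"
    "e \<le> d / A * (d2 / (8 * A)) powr (\<alpha> / 2)" "e \<le> d / A * (d2 / (8 * A)) powr (1 / (\<alpha> + 1))"
    by (simp_all add: e_def)
  note ele = this
  have e1: "e * p \<le> 1 / 2"
  proof -
    have "e * p \<le> 1 / (2 * (p + 1)) * p" using ele(1) pos by (intro mult_right_mono) auto
    also have "\<dots> \<le> 1 / 2" using pos by (simp add: divide_simps)
    finally show ?thesis .
  qed
  have e2: "e * (\<gamma> * p) \<le> 1 / 2"
  proof -
    have "e * (\<gamma> * p) \<le> 1 / (2 * (\<gamma> * p + 1)) * (\<gamma> * p)" using ele(2) \<gamma>p by (intro mult_right_mono) auto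
    also have "\<dots> \<le> 1 / 2" using \<gamma>p by (simp add: divide_simps)
    finally show ?thesis .
  qed
  have e34: "A * (e * A / d) powr r \<le> d2 / 8" if "e \<le> d / A * (d2 / (8 * A)) powr (1 / r)" "r > 0" for r
  proof -
    have "e * A / d \<le> (d2 / (8 * A)) powr (1 / r)"
      using that(1) pos d by (simp add: field_simps)
    then have "(e * A / d) powr r \<le> ((d2 / (8 * A)) powr (1 / r)) powr r"
      using e pos d that(2) by (intro powr_mono2) auto
    also have "\<dots> = d2 / (8 * A)"
      using that(2) pos by (simp add: powr_powr)
    finally show ?thesis using pos by (simp add: field_simps)
  qed
  \<comment> \<open>The constant of \<open>powr_interpolate\<close> for \<gamma> + \<open>k\<close>
    against 1 + \<gamma> with weight \<open>d2 / 4\<close>; it absorbs the terms without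
    \<open>y\<close>.\<close>
  define K where "K = 2 * A * (2 * A / (d2 / 4)) powr ((\<gamma> + k) / (1 + \<gamma> - (\<gamma> + k)))"
  have K: "K \<ge> 0" using pos by (simp add: K_def)
  \<comment> \<open>The loss of (2/3)^(1+\<gamma>) comes from replacing \<open>E\<close> by the
    functional, which is at most 3/2 times \<open>E\<close>.\<close>
  define c where "c = e * (d2 / 2) * (2 / 3) powr (1 + \<gamma>)"
  define C where "C = 3 / 2 * C3 + e * K"
  have small: "\<bar>e * E powr \<gamma> * P\<bar> \<le> E / 2" if E: "E \<ge> 1" and P: "\<bar>P\<bar> \<le> p * E powr (1 - \<gamma>)" for E P
  proof -
    have "\<bar>e * E powr \<gamma> * P\<bar> = e * E powr \<gamma> * \<bar>P\<bar>"
      using e by (simp add: abs_mult)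
    also have "\<dots> \<le> e * E powr \<gamma> * (p * E powr (1 - \<gamma>))"
      using P e by (intro mult_left_mono) auto
    also have "\<dots> = e * p * (E powr \<gamma> * E powr (1 - \<gamma>))" by (simp add: mult_ac)
    also have "E powr \<gamma> * E powr (1 - \<gamma>) = E" using E by (simp flip: powr_add)
    also have "e * p * E \<le> 1 / 2 * E" using e1 E by (intro mult_right_mono) auto
    finally show ?thesis by simp
  qed
  show ?thesis
  proof (rule that[of e c C])
    show "e > 0" by (rule e)
    show "c > 0" using e pos by (simp add: c_def)
    show "C \<ge> 0" using e pos K by (simp add: C_def)
    show "\<bar>e * E powr \<gamma> * P\<bar> \<le> E / 2" if "E \<ge> 1" "\<bar>P\<bar> \<le> p * E powr (1 - \<gamma>)" for E P
      by (rule small[OF that])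
  next
    fix E P y a b :: real
    assume E: "E \<ge> 1" and P: "\<bar>P\<bar> \<le> p * E powr (1 - \<gamma>)" and y: "y \<ge> 0"
      and a: "a \<le> - d3 * y powr (\<alpha> + 2) + C3"
      and b: "b \<le> - d2 * E + A * (1 + y\<^sup>2 + y powr (\<alpha> + 1) * E powr k + E powr k)"
    define f where "f = 1 + e * \<gamma> * E powr (\<gamma> - 1) * P"
    have "\<bar>e * \<gamma> * E powr (\<gamma> - 1) * P\<bar> \<le> 1 / 2"
    proof -
      have "\<bar>e * \<gamma> * E powr (\<gamma> - 1) * P\<bar> = e * \<gamma> * E powr (\<gamma> - 1) * \<bar>P\<bar>"
        using e \<gamma> by (simp add: abs_mult)
      also have "\<dots> \<le> e * \<gamma> * E powr (\<gamma> - 1) * (p * E powr (1 - \<gamma>))"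
        using P e \<gamma> by (intro mult_left_mono) auto
      also have "\<dots> = e * (\<gamma> * p) * (E powr (\<gamma> - 1) * E powr (1 - \<gamma>))" by (simp add: mult_ac)
      also have "E powr (\<gamma> - 1) * E powr (1 - \<gamma>) = 1" using E by (simp flip: powr_add)
      finally show ?thesis using e2 by simp
    qed
    then have f: "1 / 2 \<le> f" "f \<le> 3 / 2"
      unfolding f_def abs_le_iff by linarith+
    define Y where "Y = y powr (\<alpha> + 2)"
    have Y: "Y \<ge> 0" by (simp add: Y_def)
    have fa: "f * a \<le> - (d3 / 2) * Y + 3 / 2 * C3"
    proof -
      have "f * a \<le> f * (- d3 * Y + C3)"
        using a f by (intro mult_left_mono) (auto simp: Y_def)
      also have "\<dots> = - (f * (d3 * Y)) + f * C3" by (simp add: algebra_simps)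
      also have "\<dots> \<le> - (1 / 2 * (d3 * Y)) + 3 / 2 * C3"
        using f pos Y by (intro add_mono le_imp_neg_le mult_right_mono) auto
      finally show ?thesis by simp
    qed
    define Z where "Z = E powr (1 + \<gamma>)"
    have E0: "E > 0" using E by simp
    have Xd: "(e * A * E powr g / d) powr r = (e * A / d) powr r * E powr (g * r)" for g r
    proof -
      have "e * A * E powr g / d = (e * A / d) * E powr g" by simp
      also have "\<dots> powr r = (e * A / d) powr r * E powr (g * r)"
        using e pos d by (subst powr_mult) (auto simp: powr_powr)
      finally show ?thesis .
    qed
    \<comment> \<open>The kinetic term; the resulting exponent \<gamma> + 2\<gamma>/\<alpha> is at
      most 1 + \<gamma> because 2\<gamma> is at most \<alpha>.\<close>
    have b1: "e * A * E powr \<gamma> * y\<^sup>2 \<le> d * Y + e * (d2 / 8) * Z"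
    proof -
      let ?X = "e * A * E powr \<gamma>"
      have X: "?X > 0" using e pos E0 by simp
      have "?X * y\<^sup>2 = ?X * y powr 2"
        using y by (cases "y = 0") (auto simp: powr_numeral)
      also have "\<dots> \<le> d * y powr (\<alpha> + 2) + ?X * (?X / d) powr (2 / (\<alpha> + 2 - 2))"
        by (rule powr_interpolate[OF X d y]) (use \<alpha> in auto)
      also have "(?X / d) powr (2 / (\<alpha> + 2 - 2)) = (e * A / d) powr (2 / \<alpha>) * E powr (\<gamma> * (2 / \<alpha>))"
        unfolding Xd by simp
      also have "?X * ((e * A / d) powr (2 / \<alpha>) * E powr (\<gamma> * (2 / \<alpha>)))
          = e * (A * (e * A / d) powr (2 / \<alpha>)) * E powr (\<gamma> + \<gamma> * (2 / \<alpha>))"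
        by (simp add: powr_add mult_ac)
      also have "\<dots> \<le> e * (d2 / 8) * Z"
      proof (intro mult_mono mult_left_mono)
        show "A * (e * A / d) powr (2 / \<alpha>) \<le> d2 / 8"
          using e34[of "2 / \<alpha>"] ele(3) \<alpha> by simp
        have "\<gamma> + \<gamma> * (2 / \<alpha>) \<le> 1 + \<gamma>" using \<gamma> \<alpha> by (simp add: field_simps)
        then show "E powr (\<gamma> + \<gamma> * (2 / \<alpha>)) \<le> Z"
          unfolding Z_def using E by (rule powr_mono)
      qed (use e pos in auto)
      finally show ?thesis by (simp add: Y_def)
    qed
    \<comment> \<open>The damping term paired with u; here the exponent is (\<gamma> + k)(\<alpha> +
      2), bounded by the third hypothesis on \<open>k\<close>.\<close>
    have b2: "e * A * E powr \<gamma> * (y powr (\<alpha> + 1) * E powr k) \<le> d * Y + e * (d2 / 8) * Z"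
    proof -
      let ?X = "e * A * E powr (\<gamma> + k)"
      have X: "?X > 0" using e pos E0 by simp
      have "e * A * E powr \<gamma> * (y powr (\<alpha> + 1) * E powr k) = ?X * y powr (\<alpha> + 1)"
        by (simp add: powr_add mult_ac)
      also have "\<dots> \<le> d * y powr (\<alpha> + 2) + ?X * (?X / d) powr ((\<alpha> + 1) / (\<alpha> + 2 - (\<alpha> + 1)))"
        by (rule powr_interpolate[OF X d y]) (use \<alpha> in auto)
      also have "(?X / d) powr ((\<alpha> + 1) / (\<alpha> + 2 - (\<alpha> + 1))) = (e * A / d) powr (\<alpha> + 1) * E powr ((\<gamma> + k) * (\<alpha> + 1))"
        unfolding Xd by simp
      also have "?X * ((e * A / d) powr (\<alpha> + 1) * E powr ((\<gamma> + k) * (\<alpha> + 1)))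
          = e * (A * (e * A / d) powr (\<alpha> + 1)) * (E powr (\<gamma> + k) * E powr ((\<gamma> + k) * (\<alpha> + 1)))"
        by (simp add: mult_ac)
      also have "E powr (\<gamma> + k) * E powr ((\<gamma> + k) * (\<alpha> + 1)) = E powr ((\<gamma> + k) * (\<alpha> + 2))"
        by (simp add: algebra_simps flip: powr_add)
      also have "e * (A * (e * A / d) powr (\<alpha> + 1)) * E powr ((\<gamma> + k) * (\<alpha> + 2)) \<le> e * (d2 / 8) * Z"
      proof (intro mult_mono mult_left_mono)
        show "A * (e * A / d) powr (\<alpha> + 1) \<le> d2 / 8"
          using e34[of "\<alpha> + 1"] ele(4) \<alpha> by simp
        show "E powr ((\<gamma> + k) * (\<alpha> + 2)) \<le> Z"
          unfolding Z_def using k(3) E by (rule powr_mono)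
      qed (use e pos in auto)
      finally show ?thesis by (simp add: Y_def)
    qed
    have b3: "e * A * E powr \<gamma> * (1 + E powr k) \<le> e * (d2 / 4) * Z + e * K"
    proof -
      have "1 \<le> E powr k" using E k by (simp add: ge_one_powr_ge_zero)
      then have "A * E powr \<gamma> * (1 + E powr k) \<le> A * E powr \<gamma> * (2 * E powr k)"
        using pos by (intro mult_left_mono) auto
      also have "\<dots> = 2 * A * E powr (\<gamma> + k)" by (simp add: powr_add mult_ac)
      also have "\<dots> \<le> d2 / 4 * E powr (1 + \<gamma>) + K"
        unfolding K_def by (rule powr_interpolate) (use pos E \<gamma> k in auto)
      finally have "e * (A * E powr \<gamma> * (1 + E powr k)) \<le> e * (d2 / 4 * Z + K)"
        using e by (intro mult_left_mono) (auto simp: Z_def)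
      then show ?thesis by (simp add: algebra_simps)
    qed
    have "e * E powr \<gamma> * b \<le> e * E powr \<gamma> * (- d2 * E + A * (1 + y\<^sup>2 + y powr (\<alpha> + 1) * E powr k + E powr k))"
      using b e by (intro mult_left_mono) auto
    also have "\<dots> = - e * d2 * (E powr \<gamma> * E) + e * A * E powr \<gamma> * y\<^sup>2
        + e * A * E powr \<gamma> * (y powr (\<alpha> + 1) * E powr k) + e * A * E powr \<gamma> * (1 + E powr k)"
      by (simp add: algebra_simps)
    also have "E powr \<gamma> * E = Z"
      using E0 by (simp add: Z_def powr_add)
    \<comment> \<open>Of the good term, 1/8 + 1/8 + 1/4 is spent on the three groups of errors and
      one half remains.\<close>
    finally have "e * E powr \<gamma> * b \<le> - e * d2 * Z + (d * Y + e * (d2 / 8) * Z) + (d * Y + e * (d2 / 8) * Z) + (e * (d2 / 4) * Z + e * K)"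
      using b1 b2 b3 by linarith
    also have "\<dots> = d3 / 4 * Y - e * (d2 / 2) * Z + e * K"
      by (simp add: d_def algebra_simps)
    finally have "f * a + e * E powr \<gamma> * b \<le> - (d3 / 4) * Y - e * (d2 / 2) * Z + C"
      using fa by (simp add: C_def algebra_simps)
    moreover have "0 \<le> d3 / 4 * Y" using Y pos by simp
    ultimately have main: "f * a + e * E powr \<gamma> * b \<le> - e * (d2 / 2) * Z + C" by simp
    have "c * (E + e * E powr \<gamma> * P) powr (1 + \<gamma>) \<le> e * (d2 / 2) * Z"
    proof -
      have s: "\<bar>e * E powr \<gamma> * P\<bar> \<le> E / 2" by (rule small[OF E P])
      have "(2 / 3) powr (1 + \<gamma>) * (E + e * E powr \<gamma> * P) powr (1 + \<gamma>) = (2 / 3 * (E + e * E powr \<gamma> * P)) powr (1 + \<gamma>)"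
        using s E0 by (subst powr_mult) (auto simp: abs_le_iff)
      also have "\<dots> \<le> E powr (1 + \<gamma>)"
        using s E0 \<gamma> by (intro powr_mono2) (auto simp: abs_le_iff)
      finally have "e * (d2 / 2) * ((2 / 3) powr (1 + \<gamma>) * (E + e * E powr \<gamma> * P) powr (1 + \<gamma>)) \<le> e * (d2 / 2) * Z"
        unfolding Z_def using e pos by (intro mult_left_mono) auto
      then show ?thesis by (simp add: c_def mult_ac)
    qed
    with main show "(1 + e * \<gamma> * E powr (\<gamma> - 1) * P) * a + e * E powr \<gamma> * b
        \<le> - c * (E + e * E powr \<gamma> * P) powr (1 + \<gamma>) + C"
      unfolding f_def by linarith
  qed
qed

section \<open>Comparison with an explicit supersolution\<close>

text \<open>The function \<open>q\<close> solves q' = -(c/2) q^(1+\<gamma>) and is infinite at 0, so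
  it starts above any \<Phi>. Half of the decay rate drives \<open>q\<close>; the other half,
  evaluated at the constant \<open>K\<close>, cancels \<open>C\<close>. After a last contact with
  \<open>z = q + K\<close> the function \<Phi> would have to decrease at least as fast as
  \<open>z\<close>, so it cannot end above it.\<close>

lemma ac_deriv_powr_decay:
  fixes c C \<gamma> :: real
  assumes pos: "\<gamma> > 0" "c > 0" "C \<ge> 0"
    and \<Phi>: "ac_deriv 0 T \<Phi> \<rho>"
    and \<rho>: "AE t\<in>{0<..T} in lebesgue. \<rho> t \<le> - c * \<Phi> t powr (1 + \<gamma>) + C"
    and t: "0 < t" "t \<le> T"
  shows "\<Phi> t \<le> (c * \<gamma> / 2 * t) powr (- 1 / \<gamma>) + (2 * C / c) powr (1 / (1 + \<gamma>))"
proof (rule ccontr)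
  define A where "A = c * \<gamma> / 2"
  define K where "K = (2 * C / c) powr (1 / (1 + \<gamma>))"
  define q where "q s = (A * s) powr (- 1 / \<gamma>)" for s
  define z where "z s = q s + K" for s
  have A: "A > 0" using pos by (simp add: A_def)
  have K: "K \<ge> 0" "K powr (1 + \<gamma>) = 2 * C / c"
    using pos by (auto simp: K_def powr_powr)
  assume "\<not> ?thesis"
  then have gt: "\<Phi> t > z t" by (simp add: z_def q_def K_def A_def)
  have \<Phi>c: "continuous_on {0..T} \<Phi>" by (rule ac_deriv_continuous[OF \<Phi>])
  obtain M where M: "M \<ge> 0" "\<And>s. s \<in> {0..T} \<Longrightarrow> norm (\<Phi> s) \<le> M"
    using continuous_bounded_Icc[OF \<Phi>c] by blast
  \<comment> \<open>Chosen so that \<open>q s0\<close> is at least \<open>M + 1\<close>, which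
    exceeds \<Phi> everywhere; this is the place where the initial value is forgotten.\<close>
  define s0 where "s0 = min t ((M + 1) powr (- \<gamma>) / A)"
  have s0: "0 < s0" "s0 \<le> t" using t A M by (auto simp: s0_def)
  have "\<Phi> s0 \<le> z s0"
  proof -
    have "A * s0 \<le> (M + 1) powr (- \<gamma>)"
      using A by (simp add: s0_def min_def field_simps)
    then have "((M + 1) powr (- \<gamma>)) powr (- 1 / \<gamma>) \<le> q s0"
      unfolding q_def using A s0 pos by (intro powr_mono2') auto
    moreover have "((M + 1) powr (- \<gamma>)) powr (- 1 / \<gamma>) = M + 1"
      using pos M by (simp add: powr_powr)
    ultimately show ?thesis
      using M(2)[of s0] s0 t K by (simp add: z_def)
  qed
  have q: "(q has_real_derivative - (c / 2) * q s powr (1 + \<gamma>)) (at s)" if "s > 0" for s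
  proof -
    have "(q has_real_derivative (- 1 / \<gamma>) * (A * s) powr (- 1 / \<gamma> - 1) * A) (at s)"
      unfolding q_def[abs_def] using that A
      by (auto intro!: derivative_eq_intros)
    moreover have "(- 1 / \<gamma>) * (A * s) powr (- 1 / \<gamma> - 1) * A = - (c / 2) * q s powr (1 + \<gamma>)"
    proof -
      have "- 1 / \<gamma> * (1 + \<gamma>) = - 1 / \<gamma> - 1" using pos by (simp add: field_simps)
      then have "q s powr (1 + \<gamma>) = (A * s) powr (- 1 / \<gamma> - 1)"
        unfolding q_def powr_powr by simp
      then show ?thesis using pos by (simp add: A_def)
    qed
    ultimately show ?thesis by (simp only:)
  qed
  have qc: "continuous_on {s..t} q" if "s > 0" for s
    using that by (intro continuous_at_imp_continuous_on ballI DERIV_isCont[OF q]) auto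
  let ?S = "{s \<in> {s0..t}. \<Phi> s - z s \<le> 0}"
  have "compact ?S"
  proof -
    have "continuous_on {s0..t} (\<lambda>s. \<Phi> s - z s)"
      unfolding z_def[abs_def] using s0 t by (intro continuous_intros qc continuous_on_subset[OF \<Phi>c]) auto
    then have "closed {s \<in> {s0..t}. \<Phi> s - z s \<in> {..0}}"
      by (intro continuous_closed_preimage[unfolded vimage_def Int_def mem_Collect_eq, simplified]) auto
    then have "compact ({s0..t} \<inter> {s \<in> {s0..t}. \<Phi> s - z s \<in> {..0}})"
      by (intro compact_Int_closed) auto
    moreover have "{s0..t} \<inter> {s \<in> {s0..t}. \<Phi> s - z s \<in> {..0}} = ?S" by auto
    ultimately show ?thesis by simp
  qed
  moreover have "?S \<noteq> {}" using \<open>\<Phi> s0 \<le> z s0\<close> s0 by auto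
  \<comment> \<open>The last time at which \<Phi> does not exceed \<open>z\<close>; beyond it the
    strict reverse inequality holds up to \<open>t\<close>.\<close>
  ultimately obtain s1 where s1: "s1 \<in> ?S" "\<And>s. s \<in> ?S \<Longrightarrow> s \<le> s1"
    by (meson compact_attains_sup)
  have s1t: "0 < s1" "s1 \<le> t" "\<Phi> s1 \<le> z s1" using s1 s0 by auto
  have above: "\<Phi> s > z s" if "s \<in> {s1<..t}" for s
  proof (rule ccontr)
    assume "\<not> \<Phi> s > z s"
    then have "s \<in> ?S" using that s1(1) by auto
    then have "s \<le> s1" by (rule s1(2))
    then show False using that by simp
  qed
  have ze: "ac_deriv s1 t z (\<lambda>s. - (c / 2) * q s powr (1 + \<gamma>))"
  proof (rule ac_deriv_C1)
    fix x assume "s1 \<le> x" "x \<le> t"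
    then show "(z has_real_derivative - (c / 2) * q x powr (1 + \<gamma>)) (at x within {s1..t})"
      unfolding z_def[abs_def] using s1t
      by (auto intro!: derivative_eq_intros DERIV_subset[OF q])
  next
    show "continuous_on {s1..t} (\<lambda>s. - (c / 2) * q s powr (1 + \<gamma>))"
      using s1t A by (intro continuous_intros qc) (auto simp: q_def)
  qed
  have "\<Phi> t - \<Phi> s1 = (LINT s:{s1<..t}|lebesgue. \<rho> s)"
    using ac_derivD(2)[OF \<Phi>, of s1 t] s1t t by simp
  also have "\<dots> \<le> (LINT s:{s1<..t}|lebesgue. - (c / 2) * q s powr (1 + \<gamma>))"
  proof (rule set_integral_mono_AE)
    show "set_integrable lebesgue {s1<..t} \<rho>"
      by (rule set_integrable_Ioc_subset[OF ac_derivD(1)[OF \<Phi>]]) (use s1t t in auto)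
    show "set_integrable lebesgue {s1<..t} (\<lambda>s. - (c / 2) * q s powr (1 + \<gamma>))"
      by (rule ac_derivD(1)[OF ze])
    show "AE s\<in>{s1<..t} in lebesgue. \<rho> s \<le> - (c / 2) * q s powr (1 + \<gamma>)"
      using \<rho>
    proof eventually_elim
      case (elim s)
      show ?case
      proof
        assume s: "s \<in> {s1<..t}"
        have q0: "q s \<ge> 0" by (simp add: q_def)
        \<comment> \<open>Both powers are bounded by that of \<open>z\<close>, hence so is their
          mean; the half of \<open>K powr (1 + \<gamma>) = 2 * C / c\<close> gives exactly
          \<open>C\<close> after multiplication by \<open>c\<close>.\<close>
        have "(1 / 2) * (q s powr (1 + \<gamma>) + K powr (1 + \<gamma>)) \<le> z s powr (1 + \<gamma>)"
        proof -
          have "q s powr (1 + \<gamma>) \<le> z s powr (1 + \<gamma>)" "K powr (1 + \<gamma>) \<le> z s powr (1 + \<gamma>)"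
            using q0 K(1) pos by (auto simp: z_def intro!: powr_mono2)
          then show ?thesis by simp
        qed
        also have "z s powr (1 + \<gamma>) \<le> \<Phi> s powr (1 + \<gamma>)"
          using above[OF s] q0 K pos by (intro powr_mono2) (auto simp: z_def)
        finally have "c * ((1 / 2) * (q s powr (1 + \<gamma>) + 2 * C / c)) \<le> c * \<Phi> s powr (1 + \<gamma>)"
          unfolding K(2) using pos by (intro mult_left_mono) auto
        then have "c / 2 * q s powr (1 + \<gamma>) + C \<le> c * \<Phi> s powr (1 + \<gamma>)"
          using pos by (simp add: algebra_simps)
        moreover have "\<rho> s \<le> - c * \<Phi> s powr (1 + \<gamma>) + C"
          using elim s s1t t by auto
        ultimately show "\<rho> s \<le> - (c / 2) * q s powr (1 + \<gamma>)" by simp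
      qed
    qed
  qed
  also have "\<dots> = z t - z s1"
    using ac_derivD(2)[OF ze, of s1 t] s1t by simp
  finally show False using gt s1t by simp
qed

section \<open>Energy identities of a strong solution\<close>

text \<open>Everything the energy argument extracts from a strong solution, in scalar form. The
  derivative of \<iota> \<open>u\<close> in H exists at every interior time and equals
  \<open>h\<close>, so the final bound can be stated for all \<open>t\<close> and not just almost
  all.\<close>

lemma strong_solution_structure:
  fixes u :: "real \<Rightarrow> 'v::real_inner" and \<iota> :: "'v \<Rightarrow>\<^sub>L 'h::{real_inner, complete_space}"
  assumes T: "T > 0" and sol: "strong_solution T \<iota> gradF g u"
  obtains u1 :: "real \<Rightarrow> 'v" and w2 :: "real \<Rightarrow> 'v \<Rightarrow>\<^sub>L real" and h :: "real \<Rightarrow> 'h" and B :: real where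
    "continuous_on {0..T} u" "continuous_on {0..T} h"
    "\<And>\<phi> :: 'v \<Rightarrow>\<^sub>L real. ac_deriv 0 T (\<lambda>t. \<phi> (u t)) (\<lambda>t. \<phi> (u1 t))"
    "strongly_measurable (lebesgue_on {0<..T}) u1" "AE t\<in>{0<..T} in lebesgue. norm (u1 t) \<le> B" "B \<ge> 0"
    "AE t\<in>{0<..T} in lebesgue. \<iota> (u1 t) = h t"
    "\<And>t. 0 < t \<Longrightarrow> t < T \<Longrightarrow> ((\<lambda>s. \<iota> (u s)) has_vector_derivative h t) (at t)"
    "ac_deriv 0 T (\<lambda>t. (h t \<bullet> h t) / 2) (\<lambda>t. w2 t (u1 t))"
    "ac_deriv 0 T (\<lambda>t. h t \<bullet> \<iota> (u t)) (\<lambda>t. w2 t (u t) + h t \<bullet> h t)"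
    "AE t\<in>{0<..T} in lebesgue. w2 t + gradF (u t) + g t (u1 t) = 0"
proof -
  obtain u1 w1 w2 where uc: "continuous_on {0..T} u" and u1L: "u1 \<in> Linf T" and wu: "weak_deriv T u u1"
    and w1: "weak_deriv T (\<lambda>t. pivot_embed \<iota> (u t)) w1" and w2L: "w2 \<in> L1 T" and w2: "weak_deriv T w1 w2"
    and eq: "AE t in lebesgue_on {0<..<T}. w2 t + gradF (u t) + g t (u1 t) = 0"
    using sol unfolding strong_solution_def by blast
  obtain B where u1: "strongly_measurable (lebesgue_on {0<..T}) u1" "AE t\<in>{0<..T} in lebesgue. norm (u1 t) \<le> B" "B \<ge> 0"
    by (rule Linf_D[OF u1L])
  note u1n = set_integrable_norm_bounded[OF u1(1,2)]
  have prim: "ac_deriv 0 T (\<lambda>t. \<phi> (u t)) (\<lambda>t. \<phi> (u1 t))" for \<phi> :: "'v \<Rightarrow>\<^sub>L real"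
    by (rule weak_deriv_primitive[OF wu T uc u1(1) u1n])
  obtain h where h: "continuous_on {0..T} h" and hAE: "AE t\<in>{0<..T} in lebesgue. \<iota> (u1 t) = h t"
    and hv: "\<And>v. ac_deriv 0 T (\<lambda>t. \<iota> v \<bullet> h t) (\<lambda>t. w2 t v)"
    by (rule velocity_exists[OF T u1 L1_D[OF w2L] weak_deriv2_primitive[OF T wu w1 w2 u1(1) u1n w2L]]) (rule that)
  have k: "ac_deriv 0 T (\<lambda>t. e \<bullet> \<iota> (u t)) (\<lambda>t. e \<bullet> h t)" for e
  proof (rule ac_deriv_cong)
    show "ac_deriv 0 T (\<lambda>t. (blinfun_inner_right e o\<^sub>L \<iota>) (u t)) (\<lambda>t. (blinfun_inner_right e o\<^sub>L \<iota>) (u1 t))"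
      by (rule prim)
    show "AE t\<in>{0<..T} in lebesgue. (blinfun_inner_right e o\<^sub>L \<iota>) (u1 t) = e \<bullet> h t"
      using hAE by eventually_elim auto
    show "set_integrable lebesgue {0<..T} (\<lambda>t. e \<bullet> h t)"
      by (intro set_integrable_Ioc_continuous continuous_intros h)
  qed simp
  show ?thesis
  proof (rule that[OF uc h prim u1 hAE])
    show "((\<lambda>s. \<iota> (u s)) has_vector_derivative h t) (at t)" if "0 < t" "t < T" for t
      by (rule velocity_has_vector_derivative[OF h k that])
    show "ac_deriv 0 T (\<lambda>t. (h t \<bullet> h t) / 2) (\<lambda>t. w2 t (u1 t))"
      by (rule kinetic_energy_deriv[OF T uc prim u1 L1_D[OF w2L] h hv k])
    show "ac_deriv 0 T (\<lambda>t. h t \<bullet> \<iota> (u t)) (\<lambda>t. w2 t (u t) + h t \<bullet> h t)"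
      by (rule ac_deriv_pairing[OF L1_D[OF w2L] h hv uc h k])
    show "AE t\<in>{0<..T} in lebesgue. w2 t + gradF (u t) + g t (u1 t) = 0"
      by (rule AE_lebesgue_on_IooD[OF eq])
  qed
qed

lemma potential_energy_deriv:
  fixes u u1 :: "real \<Rightarrow> 'v::real_inner" and gradF :: "'v \<Rightarrow> 'v \<Rightarrow>\<^sub>L real"
  assumes u: "continuous_on {0..T} u"
    and prim: "\<And>\<phi> :: 'v \<Rightarrow>\<^sub>L real. ac_deriv 0 T (\<lambda>t. \<phi> (u t)) (\<lambda>t. \<phi> (u1 t))"
    and u1: "strongly_measurable (lebesgue_on {0<..T}) u1" "AE t\<in>{0<..T} in lebesgue. norm (u1 t) \<le> B"
    and F: "\<And>v. (F has_derivative blinfun_apply (gradF v)) (at v)" "continuous_on UNIV gradF"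
  shows "ac_deriv 0 T (\<lambda>t. F (u t)) (\<lambda>t. gradF (u t) (u1 t))"
proof (rule ac_deriv_chain[OF prim u _ _ open_UNIV _ F(1,2)])
  show "set_integrable lebesgue {0<..T} (\<lambda>t. norm (u1 t))"
    by (rule set_integrable_norm_bounded[OF u1])
  have c: "continuous_on {0..T} (\<lambda>t. gradF (u t))"
    by (rule continuous_on_compose2[OF F(2) u]) auto
  show "set_integrable lebesgue {0<..T} (\<lambda>t. gradF (u t) (u1 t))"
    by (rule set_integrable_pairing[OF continuous_imp_strongly_measurable[OF c] _ u1])
      (intro set_integrable_Ioc_continuous continuous_intros c)
qed auto

text \<open>The chain rule on the half plane where the first coordinate is positive, since there the
  real power is continuously differentiable.\<close>

lemma lyapunov_deriv:
  assumes E: "ac_deriv 0 T E a" "\<And>t. t \<in> {0..T} \<Longrightarrow> E t > 0" and P: "ac_deriv 0 T P b"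
  shows "ac_deriv 0 T (\<lambda>t. E t + \<epsilon> * E t powr \<gamma> * P t)
    (\<lambda>t. (1 + \<epsilon> * \<gamma> * E t powr (\<gamma> - 1) * P t) * a t + \<epsilon> * E t powr \<gamma> * b t)"
proof -
  let ?S = "{0<..} \<times> UNIV :: (real \<times> real) set"
  have "ac_deriv 0 T (\<lambda>t. fst (E t, P t) + \<epsilon> * fst (E t, P t) powr \<gamma> * snd (E t, P t))
    (\<lambda>t. (1 + \<epsilon> * \<gamma> * fst (E t, P t) powr (\<gamma> - 1) * snd (E t, P t)) * a t + (\<epsilon> * fst (E t, P t) powr \<gamma>) * b t)"
  proof (rule ac_deriv_chain2[OF E(1) P, where S = ?S])
    show "open ?S" by (intro open_Times) auto
    show "(E t, P t) \<in> ?S" if "0 \<le> t" "t \<le> T" for t using E(2)[of t] that by auto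
    fix x :: "real \<times> real" assume "x \<in> ?S"
    then have "fst x > 0" by auto
    then show "((\<lambda>x. fst x + \<epsilon> * fst x powr \<gamma> * snd x) has_derivative
        (\<lambda>h. (1 + \<epsilon> * \<gamma> * fst x powr (\<gamma> - 1) * snd x) * fst h + (\<epsilon> * fst x powr \<gamma>) * snd h)) (at x)"
      by (auto intro!: derivative_eq_intros simp: algebra_simps powr_diff)
  next
    show "continuous_on ?S (\<lambda>x. 1 + \<epsilon> * \<gamma> * fst x powr (\<gamma> - 1) * snd x)" "continuous_on ?S (\<lambda>x. \<epsilon> * fst x powr \<gamma>)"
      by (auto intro!: continuous_intros)
  qed
  then show ?thesis by simp
qed

section \<open>The exponents and the decay estimate\<close>

text \<open>The second relation serves the kinetic term and the third the damping term in the
  Lyapunov inequality. The fourth gives |P| <= p E^(1-\<gamma>), because P is a product of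
  quantities of order E^(1/2) and E^(1/(\<beta>+2)).\<close>

lemma exponent_relations:
  fixes \<alpha> \<beta> \<gamma> :: real
  assumes "0 < \<alpha>" "\<alpha> < \<beta>" and \<gamma>: "\<gamma> = min (\<alpha> / 2) ((\<beta> - \<alpha>) / ((\<alpha> + 1) * (\<beta> + 2)))"
  shows "\<gamma> > 0" "2 * \<gamma> \<le> \<alpha>" "(\<gamma> + 1 / (\<beta> + 2)) * (\<alpha> + 2) \<le> 1 + \<gamma>" "1 / 2 + 1 / (\<beta> + 2) \<le> 1 - \<gamma>"
proof -
  show "\<gamma> > 0" "2 * \<gamma> \<le> \<alpha>" using assms by (auto simp: \<gamma>)
  have "\<gamma> * (\<alpha> + 1) \<le> (\<beta> - \<alpha>) / (\<beta> + 2)"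
  proof -
    have "\<gamma> * (\<alpha> + 1) \<le> (\<beta> - \<alpha>) / ((\<alpha> + 1) * (\<beta> + 2)) * (\<alpha> + 1)"
      using assms by (intro mult_right_mono) auto
    also have "\<dots> = (\<beta> - \<alpha>) / (\<beta> + 2)" using assms by simp
    finally show ?thesis .
  qed
  also have "(\<beta> - \<alpha>) / (\<beta> + 2) = 1 - (\<alpha> + 2) / (\<beta> + 2)"
    using assms by (simp add: field_simps)
  finally have g: "\<gamma> * (\<alpha> + 1) \<le> 1 - (\<alpha> + 2) / (\<beta> + 2)" .
  then show "(\<gamma> + 1 / (\<beta> + 2)) * (\<alpha> + 2) \<le> 1 + \<gamma>"
    by (simp add: algebra_simps)
  have "2 * \<gamma> \<le> 1 - 2 / (\<beta> + 2)"
  \<comment> \<open>At equality the two entries of the minimum coincide; on either side of it the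
    smaller one alone gives the bound \<beta>/(\<beta>+2) for 2\<gamma>.\<close>
  proof (cases "\<alpha> * (\<beta> + 2) \<le> \<beta>")
    case True
    then have "\<alpha> \<le> \<beta> / (\<beta> + 2)" using assms by (simp add: field_simps)
    also have "\<beta> / (\<beta> + 2) = 1 - 2 / (\<beta> + 2)" using assms by (simp add: field_simps)
    finally show ?thesis using \<open>2 * \<gamma> \<le> \<alpha>\<close> by simp
  next
    case False
    have "\<gamma> \<le> (\<beta> - \<alpha>) / ((\<alpha> + 1) * (\<beta> + 2))" using \<gamma> by simp
    also have "\<dots> \<le> (\<beta> / 2) / (\<beta> + 2)"
    proof -
      have "(\<beta> - \<alpha>) / (\<alpha> + 1) \<le> \<beta> / 2"
        using False assms by (simp add: field_simps)
      then have "(\<beta> - \<alpha>) / (\<alpha> + 1) / (\<beta> + 2) \<le> (\<beta> / 2) / (\<beta> + 2)"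
        using assms by (intro divide_right_mono) auto
      then show ?thesis by simp
    qed
    also have "(\<beta> / 2) / (\<beta> + 2) = (\<beta> / (\<beta> + 2)) / 2"
      by (simp only: divide_divide_eq_left mult.commute)
    finally have "2 * \<gamma> \<le> \<beta> / (\<beta> + 2)"
      by (simp only: le_divide_eq_numeral1 mult.commute)
    also have "\<beta> / (\<beta> + 2) = 1 - 2 / (\<beta> + 2)" using assms by (simp add: field_simps)
    finally show ?thesis .
  qed
  then show "1 / 2 + 1 / (\<beta> + 2) \<le> 1 - \<gamma>" by simp
qed

text \<open>Both constants are quantified before \<open>T\<close>, \<open>F\<close>,
  \<open>g\<close> and \<open>u\<close>, which expresses their uniformity. By injectivity of the
  adjoint imbeddings, \<open>inv (dual_embed (iYX o\<^sub>L iVY))\<close> selects the unique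
  representative of \<open>g t v\<close> in X', whose norm enters (vi).\<close>

theorem theorem3p2:
  fixes iVY :: "'v::{real_inner, complete_space} \<Rightarrow>\<^sub>L 'y::banach"
    and iYX :: "'y \<Rightarrow>\<^sub>L 'x::banach"
    and iXH :: "'x \<Rightarrow>\<^sub>L 'h::{real_inner, complete_space}"
    and \<alpha> \<beta> \<gamma> \<delta>\<^sub>1 \<delta>\<^sub>2 \<delta>\<^sub>3 D\<^sub>4 C\<^sub>1 C\<^sub>2 C\<^sub>3 C\<^sub>4 :: real
  assumes chain: "space_chain iVY iYX iXH"
    and "0 < \<alpha>" and "\<alpha> < \<beta>"
    and "\<delta>\<^sub>1 > 0" and "\<delta>\<^sub>2 > 0" and "\<delta>\<^sub>3 > 0" and "D\<^sub>4 > 0"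
    and "C\<^sub>1 \<ge> 0" and "C\<^sub>2 \<ge> 0" and "C\<^sub>3 \<ge> 0" and "C\<^sub>4 \<ge> 0"
    and \<gamma>: "\<gamma> = min (\<alpha> / 2) ((\<beta> - \<alpha>) / ((\<alpha> + 1) * (\<beta> + 2)))"
  shows "\<exists>\<Gamma> \<Gamma>' :: real.
    \<forall>(T :: real) (F :: 'v \<Rightarrow> real) (gradF :: 'v \<Rightarrow> 'v \<Rightarrow>\<^sub>L real)
      (g :: real \<Rightarrow> 'v \<Rightarrow> 'v \<Rightarrow>\<^sub>L real) (u :: real \<Rightarrow> 'v).
      T > 0 \<longrightarrow>
      (\<forall>v. (F has_derivative blinfun_apply (gradF v)) (at v)) \<and> continuous_on UNIV gradF \<longrightarrow>
      (\<forall>v \<in> Linf T. (\<lambda>t. g t (v t)) \<in> L1 T) \<longrightarrow>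
      (\<forall>v. F v \<ge> \<delta>\<^sub>1 * norm (iVY v) powr (\<beta> + 2) - C\<^sub>1) \<longrightarrow>
      (\<forall>v. blinfun_apply (gradF v) v \<ge> \<delta>\<^sub>2 * F v - C\<^sub>2) \<longrightarrow>
      (AE t in lebesgue_on {0<..<T}. \<forall>v.
         blinfun_apply (g t v) v \<ge> \<delta>\<^sub>3 * norm ((iYX o\<^sub>L iVY) v) powr (\<alpha> + 2) - C\<^sub>3) \<longrightarrow>
      (\<forall>t \<in> {0<..<T}. \<forall>v. g t v \<in> range (dual_embed (iYX o\<^sub>L iVY))) \<longrightarrow>
      (AE t in lebesgue_on {0<..<T}. \<forall>v.
         norm (inv (dual_embed (iYX o\<^sub>L iVY)) (g t v))
           \<le> D\<^sub>4 * norm ((iYX o\<^sub>L iVY) v) powr (\<alpha> + 1) + C\<^sub>4) \<longrightarrow>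
      strong_solution T (iXH o\<^sub>L iYX o\<^sub>L iVY) gradF g u \<longrightarrow>
      (\<forall>t \<in> {0<..<T}.
         (norm (vector_derivative (\<lambda>s. (iXH o\<^sub>L iYX o\<^sub>L iVY) (u s)) (at t)))\<^sup>2 + F (u t)
           \<le> \<Gamma> * t powr (- 1 / \<gamma>) + \<Gamma>')"
proof -
  define k where "k = 1 / (\<beta> + 2)"
  define j where "j = iYX o\<^sub>L iVY"
  define \<iota> where "\<iota> = iXH o\<^sub>L iYX o\<^sub>L iVY"
  have \<iota>j: "\<iota> v = iXH (j v)" for v by (simp add: \<iota>_def j_def)
  note pos = \<open>0 < \<alpha>\<close> \<open>\<alpha> < \<beta>\<close> \<open>\<delta>\<^sub>1 > 0\<close> \<open>\<delta>\<^sub>2 > 0\<close> \<open>\<delta>\<^sub>3 > 0\<close> \<open>D\<^sub>4 > 0\<close> \<open>C\<^sub>1 \<ge> 0\<close> \<open>C\<^sub>2 \<ge> 0\<close> \<open>C\<^sub>3 \<ge> 0\<close> \<open>C\<^sub>4 \<ge> 0\<close>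
  note ex = exponent_relations[OF pos(1,2) \<gamma>, folded k_def]
  have k: "0 < k" "k < 1" using pos by (auto simp: k_def)
  \<comment> \<open>From coercivity the norm of \<open>u\<close> in Y is at most a power
    \<open>k\<close> of \<open>E / \<delta>\<^sub>1\<close>; the imbedding into X adds its
    norm.\<close>
  define c2 where "c2 = norm iYX * (1 / \<delta>\<^sub>1) powr k"
  have c2: "c2 \<ge> 0" by (simp add: c2_def)
  \<comment> \<open>The factor 2 is that of the bound of \<open>norm (h s)\<close> by twice the
    square root of \<open>E s\<close>.\<close>
  define p where "p = 2 * norm iXH * c2"
  have p: "p \<ge> 0" using c2 by (simp add: p_def)
  \<comment> \<open>The sum of the four coefficients in the upper bound for \<open>b\<close>, so
    that it dominates each of them; the final 1 makes it positive.\<close>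
  define A where "A = (\<delta>\<^sub>2 / 2 + 1) * (norm iXH)\<^sup>2 + (\<delta>\<^sub>2 * (C\<^sub>1 + 1) + C\<^sub>2) + D\<^sub>4 * c2 + C\<^sub>4 * c2 + 1"
  have A: "A > 0"
    unfolding A_def using pos c2 by (intro add_nonneg_pos add_nonneg_nonneg mult_nonneg_nonneg) auto
  obtain e c C where e: "e > 0" and c: "c > 0" and C: "C \<ge> 0" and
    small: "\<And>E P. E \<ge> 1 \<Longrightarrow> \<bar>P\<bar> \<le> p * E powr (1 - \<gamma>) \<Longrightarrow> \<bar>e * E powr \<gamma> * P\<bar> \<le> E / 2" and
    lyap: "\<And>E P y a b. E \<ge> 1 \<Longrightarrow> \<bar>P\<bar> \<le> p * E powr (1 - \<gamma>) \<Longrightarrow> y \<ge> 0 \<Longrightarrow>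
      a \<le> - \<delta>\<^sub>3 * y powr (\<alpha> + 2) + C\<^sub>3 \<Longrightarrow>
      b \<le> - \<delta>\<^sub>2 * E + A * (1 + y\<^sup>2 + y powr (\<alpha> + 1) * E powr k + E powr k) \<Longrightarrow>
      (1 + e * \<gamma> * E powr (\<gamma> - 1) * P) * a + e * E powr \<gamma> * b
        \<le> - c * (E + e * E powr \<gamma> * P) powr (1 + \<gamma>) + C"
    by (rule lyapunov_inequality[OF pos(1) ex(1,2) k ex(3) pos(4,5,9) A p]) (rule that)
  \<comment> \<open>One factor 2 comes from bounding E by twice \<Phi>, the other from bounding the
    quantity in the theorem by twice E.\<close>
  define \<Gamma> where "\<Gamma> = 4 * (c * \<gamma> / 2) powr (- 1 / \<gamma>)"
  define \<Gamma>' where "\<Gamma>' = 4 * (2 * C / c) powr (1 / (1 + \<gamma>))"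
  show ?thesis
    unfolding j_def[symmetric] \<iota>_def[symmetric]
  proof (rule exI[of _ \<Gamma>], rule exI[of _ \<Gamma>'], intro allI impI ballI)
    fix T :: real and F :: "'v \<Rightarrow> real" and gradF :: "'v \<Rightarrow> 'v \<Rightarrow>\<^sub>L real"
      and g :: "real \<Rightarrow> 'v \<Rightarrow> 'v \<Rightarrow>\<^sub>L real" and u :: "real \<Rightarrow> 'v" and t :: real
    assume T: "T > 0"
      and F: "(\<forall>v. (F has_derivative blinfun_apply (gradF v)) (at v)) \<and> continuous_on UNIV gradF"
      and coerc: "\<forall>v. F v \<ge> \<delta>\<^sub>1 * norm (iVY v) powr (\<beta> + 2) - C\<^sub>1"
      and grad: "\<forall>v. blinfun_apply (gradF v) v \<ge> \<delta>\<^sub>2 * F v - C\<^sub>2"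
      and diss: "AE t in lebesgue_on {0<..<T}. \<forall>v. blinfun_apply (g t v) v \<ge> \<delta>\<^sub>3 * norm (j v) powr (\<alpha> + 2) - C\<^sub>3"
      and range: "\<forall>t \<in> {0<..<T}. \<forall>v. g t v \<in> range (dual_embed j)"
      and bound: "AE t in lebesgue_on {0<..<T}. \<forall>v. norm (inv (dual_embed j) (g t v)) \<le> D\<^sub>4 * norm (j v) powr (\<alpha> + 1) + C\<^sub>4"
      and sol: "strong_solution T \<iota> gradF g u"
      and t: "t \<in> {0<..<T}"
    have F1: "\<And>v. (F has_derivative blinfun_apply (gradF v)) (at v)" and F2: "continuous_on UNIV gradF"
      using F by auto
    obtain u1 :: "real \<Rightarrow> 'v" and w2 :: "real \<Rightarrow> 'v \<Rightarrow>\<^sub>L real" and h :: "real \<Rightarrow> 'h" and B :: real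
      where u: "continuous_on {0..T} u" and h: "continuous_on {0..T} h"
      and prim: "\<And>\<phi> :: 'v \<Rightarrow>\<^sub>L real. ac_deriv 0 T (\<lambda>t. \<phi> (u t)) (\<lambda>t. \<phi> (u1 t))"
      and u1: "strongly_measurable (lebesgue_on {0<..T}) u1" "AE t\<in>{0<..T} in lebesgue. norm (u1 t) \<le> B" "B \<ge> 0"
      and hu1: "AE t\<in>{0<..T} in lebesgue. \<iota> (u1 t) = h t"
      and hd: "\<And>t. 0 < t \<Longrightarrow> t < T \<Longrightarrow> ((\<lambda>s. \<iota> (u s)) has_vector_derivative h t) (at t)"
      and kin: "ac_deriv 0 T (\<lambda>t. (h t \<bullet> h t) / 2) (\<lambda>t. w2 t (u1 t))"
      and P: "ac_deriv 0 T (\<lambda>t. h t \<bullet> \<iota> (u t)) (\<lambda>t. w2 t (u t) + h t \<bullet> h t)"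
      and eq: "AE t\<in>{0<..T} in lebesgue. w2 t + gradF (u t) + g t (u1 t) = 0"
      by (rule strong_solution_structure[OF T sol]) (rule that)
    \<comment> \<open>The shift makes the energy at least 1, as the comparison of its powers
      requires.\<close>
    define E where "E t = (h t \<bullet> h t) / 2 + F (u t) + (C\<^sub>1 + 1)" for t
    define a where "a t = w2 t (u1 t) + gradF (u t) (u1 t)" for t
    define Q where "Q t = h t \<bullet> \<iota> (u t)" for t
    define b where "b t = w2 t (u t) + h t \<bullet> h t" for t
    define \<Phi> where "\<Phi> t = E t + e * E t powr \<gamma> * Q t" for t
    have E1: "E s \<ge> 1" and Y: "norm (iVY (u s)) \<le> (1 / \<delta>\<^sub>1) powr k * E s powr k" and hE: "norm (h s) \<le> 2 * E s powr (1 / 2)" for s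
    proof -
      have F0: "\<delta>\<^sub>1 * norm (iVY (u s)) powr (\<beta> + 2) \<le> F (u s) + C\<^sub>1" using coerc[rule_format, of "u s"] by linarith
      have d0: "0 \<le> \<delta>\<^sub>1 * norm (iVY (u s)) powr (\<beta> + 2)" using pos by simp
      have hh: "0 \<le> h s \<bullet> h s" by simp
      show E1: "E s \<ge> 1" unfolding E_def using F0 d0 hh by linarith
      have "\<delta>\<^sub>1 * norm (iVY (u s)) powr (\<beta> + 2) \<le> E s" unfolding E_def using F0 hh by linarith
      then have "norm (iVY (u s)) powr (\<beta> + 2) \<le> 1 / \<delta>\<^sub>1 * E s" using pos by (simp add: field_simps)
      then have "(norm (iVY (u s)) powr (\<beta> + 2)) powr k \<le> (1 / \<delta>\<^sub>1 * E s) powr k"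
        using k by (intro powr_mono2) auto
      moreover have "(norm (iVY (u s)) powr (\<beta> + 2)) powr k = norm (iVY (u s))"
        using pos by (simp add: powr_powr k_def)
      moreover have "(1 / \<delta>\<^sub>1 * E s) powr k = (1 / \<delta>\<^sub>1) powr k * E s powr k"
        by (rule powr_mult)
      ultimately show "norm (iVY (u s)) \<le> (1 / \<delta>\<^sub>1) powr k * E s powr k" by simp
      have "(norm (h s))\<^sup>2 \<le> 4 * E s"
        unfolding E_def power2_norm_eq_inner using F0 d0 hh pos(7) by argo
      then have "norm (h s) \<le> sqrt (4 * E s)"
        by (rule real_le_rsqrt)
      also have "\<dots> = 2 * E s powr (1 / 2)"
        using E1 by (simp add: real_sqrt_mult powr_half_sqrt)
      finally show "norm (h s) \<le> 2 * E s powr (1 / 2)" .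
    qed
    have X: "norm (j (u s)) \<le> c2 * E s powr k" for s
    proof -
      have "norm (j (u s)) \<le> norm iYX * norm (iVY (u s))"
        unfolding j_def using norm_blinfun[of iYX "iVY (u s)"] by simp
      also have "\<dots> \<le> norm iYX * ((1 / \<delta>\<^sub>1) powr k * E s powr k)"
        by (intro mult_left_mono Y) simp
      finally show ?thesis by (simp add: c2_def mult.assoc)
    qed
    have Qb: "\<bar>Q s\<bar> \<le> p * E s powr (1 - \<gamma>)" for s
    proof -
      have "norm (\<iota> (u s)) \<le> norm iXH * (c2 * E s powr k)"
        unfolding \<iota>j using norm_blinfun[of iXH "j (u s)"] mult_left_mono[OF X[of s] norm_ge_zero[of iXH]] by linarith
      then have "norm (h s) * norm (\<iota> (u s)) \<le> (2 * E s powr (1 / 2)) * (norm iXH * (c2 * E s powr k))"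
        by (intro mult_mono hE) auto
      then have "\<bar>Q s\<bar> \<le> (2 * E s powr (1 / 2)) * (norm iXH * (c2 * E s powr k))"
        unfolding Q_def using Cauchy_Schwarz_ineq2[of "h s" "\<iota> (u s)"] by linarith
      also have "\<dots> = p * E s powr (1 / 2 + k)"
        by (simp add: p_def powr_add mult_ac)
      also have "\<dots> \<le> p * E s powr (1 - \<gamma>)"
        using ex(4) E1[of s] p by (intro mult_left_mono powr_mono) auto
      finally show ?thesis .
    qed
    have Ed: "ac_deriv 0 T E a"
    proof -
      have "ac_deriv 0 T (\<lambda>t. F (u t)) (\<lambda>t. gradF (u t) (u1 t))"
        by (rule potential_energy_deriv[OF u prim u1(1,2) F1 F2])
      from ac_deriv_add[OF ac_deriv_add[OF kin this] ac_deriv_const[of 0 T "C\<^sub>1 + 1"]]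
      show ?thesis by (simp add: E_def[abs_def] a_def[abs_def])
    qed
    have "ac_deriv 0 T Q b"
      using P by (simp add: Q_def[abs_def] b_def[abs_def])
    then have \<Phi>: "ac_deriv 0 T \<Phi> (\<lambda>t. (1 + e * \<gamma> * E t powr (\<gamma> - 1) * Q t) * a t + e * E t powr \<gamma> * b t)"
      unfolding \<Phi>_def[abs_def] using E1 by (intro lyapunov_deriv[OF Ed]) (auto intro: less_le_trans[OF zero_less_one])
    have "AE s in lebesgue. s \<in> {0<..T} \<longrightarrow>
      (1 + e * \<gamma> * E s powr (\<gamma> - 1) * Q s) * a s + e * E s powr \<gamma> * b s \<le> - c * \<Phi> s powr (1 + \<gamma>) + C"
    proof -
      \<comment> \<open>The range condition on \<open>g\<close> concerns the open interval, so the
        right end point of the half-open one is discarded.\<close>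
      have notT: "AE s in lebesgue. s \<notin> {T}" by (rule AE_not_in) simp
      show ?thesis
        using AE_lebesgue_on_IooD[OF diss] AE_lebesgue_on_IooD[OF bound] eq hu1 notT
      proof eventually_elim
        case (elim s)
        show ?case
        proof
          assume s: "s \<in> {0<..T}"
          define y where "y = norm (j (u1 s))"
          have y: "y \<ge> 0" by (simp add: y_def)
          have gs: "g s (u1 s) = - (w2 s + gradF (u s))"
            using elim(3) s by (metis add.commute eq_neg_iff_add_eq_0)
          have w: "w2 s v = - gradF (u s) v - g s (u1 s) v" for v
            unfolding gs by (simp add: blinfun.minus_left blinfun.add_left blinfun.diff_left)
          have as: "a s \<le> - \<delta>\<^sub>3 * y powr (\<alpha> + 2) + C\<^sub>3"
          proof -
            have "\<delta>\<^sub>3 * y powr (\<alpha> + 2) - C\<^sub>3 \<le> g s (u1 s) (u1 s)"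
              using elim(1) s by (simp add: y_def)
            then show ?thesis by (simp add: a_def w)
          qed
          have gu: "\<bar>g s (u1 s) (u s)\<bar> \<le> (D\<^sub>4 * y powr (\<alpha> + 1) + C\<^sub>4) * (c2 * E s powr k)"
          proof -
            \<comment> \<open>The representative of the damping term in X', which allows its pairing
              with \<open>u s\<close> to be estimated in the norm of X.\<close>
            define G where "G = inv (dual_embed j) (g s (u1 s))"
            have "s \<in> {0<..<T}" using s elim(5) by auto
            then have "g s (u1 s) = dual_embed j G"
              unfolding G_def using range by (simp add: f_inv_into_f)
            then have "g s (u1 s) (u s) = G (j (u s))"
              by (simp add: dual_embed_def)
            then have "\<bar>g s (u1 s) (u s)\<bar> \<le> norm G * norm (j (u s))"
              using norm_blinfun[of G "j (u s)"] by simp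
            also have "\<dots> \<le> (D\<^sub>4 * y powr (\<alpha> + 1) + C\<^sub>4) * (c2 * E s powr k)"
              using elim(2) s X[of s] pos by (intro mult_mono) (auto simp: G_def y_def)
            finally show ?thesis .
          qed
          have hy: "h s \<bullet> h s \<le> (norm iXH)\<^sup>2 * y\<^sup>2"
          proof -
            have "norm (h s) \<le> norm iXH * y"
              using elim(4) s norm_blinfun[of iXH "j (u1 s)"] by (simp add: y_def flip: \<iota>j)
            then have "(norm (h s))\<^sup>2 \<le> (norm iXH * y)\<^sup>2"
              by (intro power_mono) auto
            then show ?thesis by (simp add: power2_norm_eq_inner power_mult_distrib)
          qed
          have bs: "b s \<le> - \<delta>\<^sub>2 * E s + A * (1 + y\<^sup>2 + y powr (\<alpha> + 1) * E s powr k + E s powr k)"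
          proof -
            define q1 q2 q3 where "q1 = y\<^sup>2" and "q2 = y powr (\<alpha> + 1) * E s powr k" and "q3 = E s powr k"
            have q: "q1 \<ge> 0" "q2 \<ge> 0" "q3 \<ge> 0" by (simp_all add: q1_def q2_def q3_def)
            define n where "n = (norm iXH)\<^sup>2"
            have n: "n \<ge> 0" by (simp add: n_def)
            have "b s = - gradF (u s) (u s) - g s (u1 s) (u s) + h s \<bullet> h s"
              by (simp add: b_def w)
            also have "\<dots> \<le> - (\<delta>\<^sub>2 * F (u s) - C\<^sub>2) + (D\<^sub>4 * y powr (\<alpha> + 1) + C\<^sub>4) * (c2 * E s powr k) + h s \<bullet> h s"
              using grad[rule_format, of "u s"] gu by linarith
            \<comment> \<open>Replacing \<open>F\<close> by the full energy adds
              \<open>\<delta>\<^sub>2 / 2\<close> times the squared norm of \<open>h s\<close>,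
              which joins the kinetic term of \<open>b\<close>.\<close>
            also have "\<delta>\<^sub>2 * F (u s) = \<delta>\<^sub>2 * E s - \<delta>\<^sub>2 / 2 * (h s \<bullet> h s) - \<delta>\<^sub>2 * (C\<^sub>1 + 1)"
              by (simp add: E_def algebra_simps)
            also have "- (\<delta>\<^sub>2 * E s - \<delta>\<^sub>2 / 2 * (h s \<bullet> h s) - \<delta>\<^sub>2 * (C\<^sub>1 + 1) - C\<^sub>2) + (D\<^sub>4 * y powr (\<alpha> + 1) + C\<^sub>4) * (c2 * E s powr k) + h s \<bullet> h s
                = - \<delta>\<^sub>2 * E s + (\<delta>\<^sub>2 / 2 + 1) * (h s \<bullet> h s) + (\<delta>\<^sub>2 * (C\<^sub>1 + 1) + C\<^sub>2) + D\<^sub>4 * c2 * q2 + C\<^sub>4 * c2 * q3"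
              by (simp add: q2_def q3_def algebra_simps)
            also have "\<dots> \<le> - \<delta>\<^sub>2 * E s + (\<delta>\<^sub>2 / 2 + 1) * n * q1 + (\<delta>\<^sub>2 * (C\<^sub>1 + 1) + C\<^sub>2) * 1 + D\<^sub>4 * c2 * q2 + C\<^sub>4 * c2 * q3"
            proof -
              have "(\<delta>\<^sub>2 / 2 + 1) * (h s \<bullet> h s) \<le> (\<delta>\<^sub>2 / 2 + 1) * (n * q1)"
                using hy pos by (intro mult_left_mono) (auto simp: n_def q1_def)
              then show ?thesis by (simp add: mult.assoc)
            qed
            also have "\<dots> \<le> - \<delta>\<^sub>2 * E s + A * q1 + A * 1 + A * q2 + A * q3"
            proof -
              have nn: "0 \<le> (\<delta>\<^sub>2 / 2 + 1) * n" "0 \<le> \<delta>\<^sub>2 * (C\<^sub>1 + 1) + C\<^sub>2" "0 \<le> D\<^sub>4 * c2" "0 \<le> C\<^sub>4 * c2"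
                using pos c2 n by (auto intro!: add_nonneg_nonneg mult_nonneg_nonneg)
              then have "(\<delta>\<^sub>2 / 2 + 1) * n \<le> A" "\<delta>\<^sub>2 * (C\<^sub>1 + 1) + C\<^sub>2 \<le> A" "D\<^sub>4 * c2 \<le> A" "C\<^sub>4 * c2 \<le> A"
                unfolding A_def n_def[symmetric] by linarith+
              then show ?thesis
                using q by (intro add_mono order_refl mult_right_mono) auto
            qed
            also have "\<dots> = - \<delta>\<^sub>2 * E s + A * (1 + q1 + q2 + q3)" by (simp add: algebra_simps)
            finally show ?thesis by (simp add: q1_def q2_def q3_def)
          qed
          show "(1 + e * \<gamma> * E s powr (\<gamma> - 1) * Q s) * a s + e * E s powr \<gamma> * b s \<le> - c * \<Phi> s powr (1 + \<gamma>) + C"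
            unfolding \<Phi>_def by (rule lyap[OF E1 Qb y as bs])
        qed
      qed
    qed
    from ac_deriv_powr_decay[OF ex(1) c C \<Phi> this, of t] t
    have dec: "\<Phi> t \<le> (c * \<gamma> / 2 * t) powr (- 1 / \<gamma>) + (2 * C / c) powr (1 / (1 + \<gamma>))"
      by simp
    have "E t \<le> 2 * \<Phi> t"
      using small[OF E1 Qb, of t] by (simp add: \<Phi>_def abs_le_iff)
    \<comment> \<open>Twice the energy contains \<open>F (u t)\<close> twice; the surplus copy is
      compensated by the constant because \<open>F (u t) + C\<^sub>1\<close> is nonnegative.\<close>
    moreover have "(norm (h t))\<^sup>2 + F (u t) \<le> 2 * E t"
    proof -
      have "0 \<le> \<delta>\<^sub>1 * norm (iVY (u t)) powr (\<beta> + 2)" using pos by simp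
      then have "0 \<le> F (u t) + C\<^sub>1" using coerc[rule_format, of "u t"] by linarith
      then show ?thesis using pos by (simp add: E_def power2_norm_eq_inner)
    qed
    moreover have "(c * \<gamma> / 2 * t) powr (- 1 / \<gamma>) = (c * \<gamma> / 2) powr (- 1 / \<gamma>) * t powr (- 1 / \<gamma>)"
      by (rule powr_mult)
    ultimately have "(norm (h t))\<^sup>2 + F (u t) \<le> \<Gamma> * t powr (- 1 / \<gamma>) + \<Gamma>'"
      using dec by (simp add: \<Gamma>_def \<Gamma>'_def)
    moreover have "vector_derivative (\<lambda>s. \<iota> (u s)) (at t) = h t"
      using hd[of t] t by (intro vector_derivative_at) auto
    ultimately show "(norm (vector_derivative (\<lambda>s. \<iota> (u s)) (at t)))\<^sup>2 + F (u t) \<le> \<Gamma> * t powr (- 1 / \<gamma>) + \<Gamma>'"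
      by simp
  qed
qed

end
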